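(* Let $G$ be an $H$-type group with center $\mathfrak z$. A subset $Z\subset\mathfrak z^*\setminus\{0\}$ is an injectivity set of the X-ray transform $I$ if and only if $\bigcup_{\lambda\in Z}\Gamma_\lambda^*$ is dense in $\mathfrak z^*$.
   Context: $H$-type group: $\mathfrak g$ is a finite-dimensional real Lie algebra with $[\mathfrak g,[\mathfrak g,\mathfrak g]]=0$ and an inner product $\langle\cdot,\cdot\rangle$; $\mathfrak z\ne0$ is its center, $\mathfrak v\neq 0$ the orthogonal complement of $\mathfrak z$. For $\mu\in\mathfrak z^*$ let $J_\mu:\mathfrak v\to\mathfrak v$ be the skew-adjoint map with $\langle J_\mu V,W\rangle=\mu([V,W])$; one requires $J_\mu^2=-|\mu|^2\mathrm{Id}$ for all $\mu\in\mathfrak z^*$. $G$ is $\mathfrak v\times\mathfrak z$ with product $(x,u)(x',u')=(x+x',u+u'+\tfrac12[x,x'])$ and Haar measure $dx\,du$. The inner product identifies $\mathfrak v^*\cong\mathfrak v$, $\mathfrak z^*\cong\mathfrak z$; $S(\mathfrak v^* )$ is the unit sphere; $\hat\lambda=\lambda/|\lambda|$. For $\nu\in S(\mathfrak v^* )$, $\lambda\in\mathfrak z^*\setminus\{0\}$ let $\gamma_{\nu,\lambda}(s)=\big(e^{sJ_\lambda}J_\lambda^{-1}\nu,\ \tfrac{s}{2|\lambda|}\hat\lambda\big)\in G$, $s\in\mathbb R$ (the left translates of these curves are exactly the unit-speed sub-Riemannian geodesics of charge $\lambda$). Let $\Gamma_\lambda=\{(0,j\pi|\lambda|^{-2}\hat\lambda):j\in\mathbb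 Z\}$, $G_\lambda=G/\Gamma_\lambda$ with the induced Haar measure, and for $f\in L^1(G)$ let $I_{\nu,\lambda}f(x,u)=\int_{\mathbb R}f((x,u)\gamma_{\nu,\lambda}(s))\,ds$, which is a well-defined element of $L^1(G_\lambda)$. Visible frequencies: $\Gamma_\lambda^*=\{\mu\in\mathfrak z^*:\mu\cdot\lambda\in2|\lambda|^3\mathbb Z\}$. For $f\in L^1(G)$, a set $Z\subset\mathfrak z^*\setminus\{0\}$ is a zero set of $If$ if for every $\lambda\in Z$ there exists $\nu\in S(\mathfrak v^* )$ with $I_{\nu,\lambda}f=0$. $Z$ is an injectivity set of $I$ if the only $f\in L^1(G)$ having $Z$ as a zero set of $If$ is $f=0$. *)

theory Defs
  imports "HOL-Analysis.Analysis"
begin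

text \<open>
  The Lie algebra is an arbitrary finite-dimensional real inner product space (class
  \<^class>\<open>euclidean_space\<close>) with a bracket \<open>br\<close>. The inner product identifies the dual spaces
  \<open>\<zz>\<^sup>*\<close> and \<open>\<vv>\<^sup>*\<close> with the subspaces \<open>center br\<close> and \<open>hor br\<close>, so covectors are elements of these
  subspaces, and \<open>sgn lam\<close> is \<open>lam / |lam|\<close>.
\<close>

definition center :: "('g::euclidean_space \<Rightarrow> 'g \<Rightarrow> 'g) \<Rightarrow> 'g set" where
  "center br = {u. \<forall>x. br u x = 0}"

definition hor :: "('g::euclidean_space \<Rightarrow> 'g \<Rightarrow> 'g) \<Rightarrow> 'g set" where
  "hor br = (center br)\<^sup>\<bottom>"

definition J :: "('g::euclidean_space \<Rightarrow> 'g \<Rightarrow> 'g) \<Rightarrow> 'g \<Rightarrow> 'g \<Rightarrow> 'g" where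
  "J br \<mu> V = (THE Y. Y \<in> hor br \<and> (\<forall>W\<in>hor br. Y \<bullet> W = \<mu> \<bullet> br V W))"

definition lie_bracket :: "('g::euclidean_space \<Rightarrow> 'g \<Rightarrow> 'g) \<Rightarrow> bool" where
  "lie_bracket br \<longleftrightarrow> bilinear br \<and> (\<forall>x. br x x = 0) \<and>
     (\<forall>x y z. br x (br y z) + br y (br z x) + br z (br x y) = 0)"

definition H_type :: "('g::euclidean_space \<Rightarrow> 'g \<Rightarrow> 'g) \<Rightarrow> bool" where
  "H_type br \<longleftrightarrow> lie_bracket br \<and> (\<forall>x y z. br x (br y z) = 0) \<and>
     center br \<noteq> {0} \<and> hor br \<noteq> {0} \<and>
     (\<forall>\<mu>\<in>center br. \<forall>V\<in>hor br. J br \<mu> (J br \<mu> V) = - (norm \<mu>)\<^sup>2 *\<^sub>R V)"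

text \<open>
  The group \<open>G = \<vv> \<times> \<zz>\<close> is realised on the whole space, the pair \<open>(x, u)\<close> being the vector \<open>x + u\<close>
  of the orthogonal sum \<open>\<vv> \<oplus> \<zz>\<close>; lemma \<open>gmul_pair\<close> recovers the product in terms of pairs. As
  the sum is orthogonal, the Haar measure \<open>dx du\<close> is \<^const>\<open>lborel\<close>.
\<close>

definition gmul :: "('g::euclidean_space \<Rightarrow> 'g \<Rightarrow> 'g) \<Rightarrow> 'g \<Rightarrow> 'g \<Rightarrow> 'g" where
  "gmul br g h = g + h + (1/2) *\<^sub>R br g h"

definition op_exp :: "('g::euclidean_space \<Rightarrow> 'g) \<Rightarrow> 'g \<Rightarrow> 'g" where
  "op_exp A x = (\<Sum>n. (A ^^ n) x /\<^sub>R fact n)"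

definition geodesic :: "('g::euclidean_space \<Rightarrow> 'g \<Rightarrow> 'g) \<Rightarrow> 'g \<Rightarrow> 'g \<Rightarrow> real \<Rightarrow> 'g" where
  "geodesic br \<nu> lam s =
     op_exp (\<lambda>X. s *\<^sub>R J br lam X) (inv_into (hor br) (J br lam) \<nu>) + (s / (2 * norm lam)) *\<^sub>R sgn lam"

definition Gam :: "'g::euclidean_space \<Rightarrow> 'g set" where
  "Gam lam = range (\<lambda>j::int. (of_int j * pi / (norm lam)\<^sup>2) *\<^sub>R sgn lam)"

definition lcoset :: "('g::euclidean_space \<Rightarrow> 'g \<Rightarrow> 'g) \<Rightarrow> 'g \<Rightarrow> 'g \<Rightarrow> 'g set" where
  "lcoset br lam g = gmul br g ` Gam lam"

text \<open>
  The quotient \<open>G / Gam lam\<close> carries the quotient \<open>\<sigma>\<close>-algebra and the Haar measure induced from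
  \<open>G\<close>: the measure of a set of cosets is the Lebesgue measure of the part of its preimage lying
  in the fundamental domain \<open>fund_dom lam\<close>.
\<close>

definition fund_dom :: "'g::euclidean_space \<Rightarrow> 'g set" where
  "fund_dom lam = {g. 0 \<le> g \<bullet> sgn lam \<and> g \<bullet> sgn lam < pi / (norm lam)\<^sup>2}"

definition quot_haar :: "('g::euclidean_space \<Rightarrow> 'g \<Rightarrow> 'g) \<Rightarrow> 'g \<Rightarrow> 'g set measure" where
  "quot_haar br lam =
     distr (restrict_space lborel (fund_dom lam))
       (sigma (range (lcoset br lam)) {A. A \<subseteq> range (lcoset br lam) \<and> lcoset br lam -` A \<in> sets borel})
       (lcoset br lam)"

text \<open>
  A function on \<open>G / Gam lam\<close>, evaluated at a coset through an arbitrary representative; by lemma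
  \<open>xray_lcoset\<close> the choice is immaterial. For integrable \<open>f\<close> the integrand is integrable for almost
  every coset (the Bochner integral is \<open>0\<close> on the remaining ones).
\<close>

definition xray :: "('g::euclidean_space \<Rightarrow> 'g \<Rightarrow> 'g) \<Rightarrow> 'g \<Rightarrow> 'g \<Rightarrow> ('g \<Rightarrow> complex) \<Rightarrow> 'g set \<Rightarrow> complex"
  where
  "xray br \<nu> lam f q = (\<integral>s. f (gmul br (SOME g. g \<in> q) (geodesic br \<nu> lam s)) \<partial>lborel)"

definition visible :: "('g::euclidean_space \<Rightarrow> 'g \<Rightarrow> 'g) \<Rightarrow> 'g \<Rightarrow> 'g set" where
  "visible br lam = {\<mu>\<in>center br. \<exists>k::int. \<mu> \<bullet> lam = 2 * norm lam ^ 3 * of_int k}"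

definition zero_set ::
  "('g::euclidean_space \<Rightarrow> 'g \<Rightarrow> 'g) \<Rightarrow> ('g \<Rightarrow> complex) \<Rightarrow> 'g set \<Rightarrow> bool" where
  "zero_set br f Z \<longleftrightarrow>
     (\<forall>lam\<in>Z. \<exists>\<nu>\<in>hor br. norm \<nu> = 1 \<and> (AE q in quot_haar br lam. xray br \<nu> lam f q = 0))"

definition injectivity_set :: "('g::euclidean_space \<Rightarrow> 'g \<Rightarrow> 'g) \<Rightarrow> 'g set \<Rightarrow> bool" where
  "injectivity_set br Z \<longleftrightarrow>
     (\<forall>f :: 'g \<Rightarrow> complex. integrable lborel f \<and> zero_set br f Z \<longrightarrow> (AE x in lborel. f x = 0))"

lemma H_type_bilinear: "H_type br \<Longrightarrow> bilinear br"
  by (simp add: H_type_def lie_bracket_def)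

lemma br_center_left: "u \<in> center br \<Longrightarrow> br u x = 0"
  by (simp add: center_def)

lemma br_skew:
  assumes "H_type br" shows "br x y = - br y x"
proof -
  have b: "bilinear br" and a: "\<And>x. br x x = 0"
    using assms by (simp_all add: H_type_def lie_bracket_def)
  have "br (x + y) (x + y) = br x y + br y x"
    by (simp add: bilinear_ladd[OF b] bilinear_radd[OF b] a[of x] a[of y])
  then have "br x y + br y x = 0" using a[of "x + y"] by metis
  then show ?thesis by (simp only: eq_neg_iff_add_eq_0)
qed

lemma br_center_right: "H_type br \<Longrightarrow> u \<in> center br \<Longrightarrow> br x u = 0"
  using br_skew[of br x u] by (simp add: center_def)

lemma gmul_pair:
  assumes "H_type br" "u \<in> center br" "u' \<in> center br"
  shows "gmul br (x + u) (x' + u') = (x + x') + (u + u' + (1/2) *\<^sub>R br x x')"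
  using assms br_center_right[OF assms(1)]
  by (simp add: gmul_def bilinear_ladd[OF H_type_bilinear] bilinear_radd[OF H_type_bilinear]
      br_center_left algebra_simps)

lemma hor_subspace: "subspace (hor br)"
  by (simp add: hor_def subspace_orthogonal_comp)

lemma J_unique:
  assumes "Y \<in> hor br" "\<And>W. W \<in> hor br \<Longrightarrow> Y \<bullet> W = \<mu> \<bullet> br V W"
  shows "J br \<mu> V = Y"
  unfolding J_def
proof (rule the_equality)
  fix Y' assume Y': "Y' \<in> hor br \<and> (\<forall>W\<in>hor br. Y' \<bullet> W = \<mu> \<bullet> br V W)"
  then have d: "Y' - Y \<in> hor br" using assms(1) hor_subspace subspace_diff by blast
  then have "(Y' - Y) \<bullet> (Y' - Y) = 0"
    using Y' assms(2) by (simp add: inner_diff_left)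
  then show "Y' = Y" by simp
qed (use assms in auto)

lemma J_props:
  assumes "H_type br"
  shows J_hor: "J br \<mu> V \<in> hor br"
    and J_inner: "W \<in> hor br \<Longrightarrow> J br \<mu> V \<bullet> W = \<mu> \<bullet> br V W"
proof -
  have l: "linear (br V)" using H_type_bilinear[OF assms] by (simp add: bilinear_def)
  let ?Y = "adjoint (br V) \<mu>"
  have i: "?Y \<bullet> W = \<mu> \<bullet> br V W" for W by (simp add: adjoint_clauses[OF l])
  have h: "?Y \<in> hor br"
    by (auto simp: hor_def orthogonal_comp_def orthogonal_def inner_commute[of _ ?Y] i
        br_center_right[OF assms])
  have "J br \<mu> V = ?Y" using J_unique[OF h] i by blast
  then show "J br \<mu> V \<in> hor br" "W \<in> hor br \<Longrightarrow> J br \<mu> V \<bullet> W = \<mu> \<bullet> br V W"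
    using h i by simp_all
qed

lemma J_linear:
  assumes "H_type br"
  shows "J br \<mu> (a *\<^sub>R x + b *\<^sub>R y) = a *\<^sub>R J br \<mu> x + b *\<^sub>R J br \<mu> y"
  by (rule J_unique)
    (auto intro!: subspace_add subspace_scale hor_subspace J_hor[OF assms]
      simp: inner_add_left inner_add_right J_inner[OF assms] bilinear_ladd[OF H_type_bilinear[OF assms]]
        bilinear_lmul[OF H_type_bilinear[OF assms]])

lemma op_exp_J:
  assumes "H_type br" "lam \<in> center br" "lam \<noteq> 0" "x \<in> hor br"
  shows "op_exp (\<lambda>X. s *\<^sub>R J br lam X) x =
    cos (s * norm lam) *\<^sub>R x + (sin (s * norm lam) / norm lam) *\<^sub>R J br lam x"
proof -
  let ?c = "norm lam" and ?A = "\<lambda>X. s *\<^sub>R J br lam X"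
  have c: "?c > 0" using assms by simp
  have JJ: "J br lam (J br lam x) = - ?c\<^sup>2 *\<^sub>R x"
    using assms by (simp add: H_type_def)
  have "(?A ^^ n) x /\<^sub>R fact n =
      (cos_coeff n *\<^sub>R (s * ?c) ^ n) *\<^sub>R x + ((sin_coeff n *\<^sub>R (s * ?c) ^ n) / ?c) *\<^sub>R J br lam x" for n
  proof (induction n)
    case 0 then show ?case by simp
  next
    case (Suc n)
    let ?p = "cos_coeff n * (s * ?c) ^ n" and ?q = "sin_coeff n * (s * ?c) ^ n / ?c"
    have "J br lam ((?A ^^ n) x /\<^sub>R fact n) = J br lam ((?A ^^ n) x) /\<^sub>R fact n"
      using J_linear[OF assms(1), of lam "inverse (fact n)" "(?A ^^ n) x" 0 0] by simp
    then have "(?A ^^ Suc n) x /\<^sub>R fact (Suc n) =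
        (s / real (Suc n)) *\<^sub>R J br lam ((?A ^^ n) x /\<^sub>R fact n)"
      by (simp add: divide_simps mult.commute)
    also have "\<dots> = (s / real (Suc n)) *\<^sub>R (?p *\<^sub>R J br lam x + ?q *\<^sub>R (- ?c\<^sup>2 *\<^sub>R x))"
      using Suc.IH J_linear[OF assms(1)] by (simp add: JJ)
    also have "\<dots> = (- (s / real (Suc n)) * ?q * ?c\<^sup>2) *\<^sub>R x + (s / real (Suc n) * ?p) *\<^sub>R J br lam x"
      by (simp add: scaleR_add_right scaleR_diff_right)
    also have "- (s / real (Suc n)) * ?q * ?c\<^sup>2 = cos_coeff (Suc n) *\<^sub>R (s * ?c) ^ Suc n"
      using c by (simp add: cos_coeff_Suc power2_eq_square field_simps del: of_nat_Suc)
    also have "s / real (Suc n) * ?p = sin_coeff (Suc n) *\<^sub>R (s * ?c) ^ Suc n / ?c"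
      using c by (simp add: sin_coeff_Suc field_simps del: of_nat_Suc)
    finally show ?case .
  qed
  moreover have "(\<lambda>n. (cos_coeff n *\<^sub>R (s * ?c) ^ n) *\<^sub>R x +
      ((sin_coeff n *\<^sub>R (s * ?c) ^ n) / ?c) *\<^sub>R J br lam x)
      sums (cos (s * ?c) *\<^sub>R x + (sin (s * ?c) / ?c) *\<^sub>R J br lam x)"
    by (intro sums_add sums_scaleR_left sums_divide cos_converges sin_converges)
  ultimately show ?thesis
    unfolding op_exp_def by (simp add: sums_iff)
qed

lemma inv_J_hor:
  assumes "H_type br" "lam \<in> center br" "lam \<noteq> 0" "\<nu> \<in> hor br"
  shows "inv_into (hor br) (J br lam) \<nu> \<in> hor br"
proof (rule inv_into_into)
  have "J br lam (J br lam \<nu> /\<^sub>R - (norm lam)\<^sup>2) = \<nu>"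
    using assms J_linear[OF assms(1), of lam "inverse (- (norm lam)\<^sup>2)" "J br lam \<nu>" 0 0]
    by (simp add: H_type_def)
  moreover have "J br lam \<nu> /\<^sub>R - (norm lam)\<^sup>2 \<in> hor br"
    by (intro subspace_scale hor_subspace J_hor assms)
  ultimately show "\<nu> \<in> J br lam ` hor br" by (metis imageI)
qed

lemma geodesic_shift:
  assumes "H_type br" "lam \<in> center br" "lam \<noteq> 0" "\<nu> \<in> hor br"
  shows "geodesic br \<nu> lam (s + 2 * pi * of_int j / norm lam) =
    geodesic br \<nu> lam s + (of_int j * pi / (norm lam)\<^sup>2) *\<^sub>R sgn lam"
proof -
  have "(s + 2 * pi * of_int j / norm lam) * norm lam = s * norm lam + 2 * pi * of_int j"
    using assms by (simp add: field_simps)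
  moreover have "cos (t + 2 * pi * of_int j) = cos t" "sin (t + 2 * pi * of_int j) = sin t" for t :: real
    by (simp_all add: cos_add sin_add cos_int_2pin sin_int_2pin)
  moreover have "(s + 2 * pi * of_int j / norm lam) / (2 * norm lam) =
      s / (2 * norm lam) + of_int j * pi / (norm lam)\<^sup>2"
    using assms by (simp add: power2_eq_square field_simps)
  ultimately show ?thesis
    unfolding geodesic_def op_exp_J[OF assms(1-3) inv_J_hor[OF assms]]
    by (simp only: scaleR_add_left add.assoc)
qed

lemma center_scale: "H_type br \<Longrightarrow> u \<in> center br \<Longrightarrow> c *\<^sub>R u \<in> center br"
  by (simp add: center_def bilinear_lmul[OF H_type_bilinear])

lemma lcoset_eq:
  assumes "H_type br" "lam \<in> center br"
  shows "lcoset br lam g = range (\<lambda>j::int. g + (of_int j * pi / (norm lam)\<^sup>2) *\<^sub>R sgn lam)"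
proof -
  have "br g (c *\<^sub>R sgn lam) = 0" for c
    using assms by (intro br_center_right) (auto simp: sgn_div_norm center_scale)
  then show ?thesis by (simp add: lcoset_def Gam_def image_image gmul_def)
qed

lemma lcoset_measurable:
  "lcoset br lam \<in> restrict_space lborel (fund_dom lam) \<rightarrow>\<^sub>M
     sigma (range (lcoset br lam)) {A. A \<subseteq> range (lcoset br lam) \<and> lcoset br lam -` A \<in> sets borel}"
proof (rule measurable_measure_of)
  fix A assume "A \<in> {A. A \<subseteq> range (lcoset br lam) \<and> lcoset br lam -` A \<in> sets borel}"
  then show "lcoset br lam -` A \<inter> space (restrict_space lborel (fund_dom lam))
      \<in> sets (restrict_space lborel (fund_dom lam))"
    by (auto simp: sets_restrict_space space_restrict_space)
qed auto

lemma xray_lcoset: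
  assumes "H_type br" "lam \<in> center br" "lam \<noteq> 0" "\<nu> \<in> hor br"
  shows "xray br \<nu> lam f (lcoset br lam g) = (\<integral>s. f (gmul br g (geodesic br \<nu> lam s)) \<partial>lborel)"
proof -
  let ?w = "\<lambda>j::int. (of_int j * pi / (norm lam)\<^sup>2) *\<^sub>R sgn lam"
  let ?g = "SOME g'. g' \<in> lcoset br lam g"
  have "?g \<in> lcoset br lam g"
    by (rule someI_ex) (use lcoset_eq[OF assms(1,2)] in auto)
  then obtain j where j: "?g = g + ?w j"
    using lcoset_eq[OF assms(1,2)] by auto
  have w: "?w j \<in> center br"
    using assms by (auto simp: sgn_div_norm center_scale)
  have "gmul br ?g (geodesic br \<nu> lam s) = gmul br g (geodesic br \<nu> lam (2 * pi * of_int j / norm lam + 1 * s))"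
    for s
  proof -
    have "gmul br (g + ?w j) h = gmul br g (h + ?w j)" for h
      using w br_center_right[OF assms(1) w]
      by (simp add: gmul_def br_center_left bilinear_ladd[OF H_type_bilinear[OF assms(1)]]
          bilinear_radd[OF H_type_bilinear[OF assms(1)]])
    then show ?thesis
      using geodesic_shift[OF assms, of s j] by (simp only: j mult_1 add.commute[of _ s])
  qed
  then show ?thesis
    unfolding xray_def
    by (subst (2) lborel_integral_real_affine[where c = 1 and t = "2 * pi * of_int j / norm lam"]) simp_all
qed

end

theory Submission
  imports Defs "HOL-Complex_Analysis.Complex_Analysis" "HOL-Probability.Sinc_Integral"
begin

text \<open>
  If the visible frequencies miss a neighbourhood of \<open>\<mu>\<close>, let \<open>f\<close> be an integrable function with
  frequencies near \<open>\<mu>\<close>. For each \<open>\<lambda> \<in> Z\<close> it is a difference \<open>f(g) = h(g + \<tau>) - h(g)\<close>, \<open>\<tau>\<close> the generator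
  of \<open>\<Gamma>\<^sub>\<lambda>\<close> and \<open>h\<close> vanishing at infinity, so its integral over a geodesic telescopes to \<open>0\<close>.

  Conversely, \<open>I f = 0\<close> means that \<open>f\<close> is orthogonal to the means over geodesic arcs of all bounded
  \<open>\<Gamma>\<^sub>\<lambda>\<close>-periodic functions. If \<open>|\<lambda>|\<close> is bounded below on \<open>Z\<close>, density forces the hyperplanes
  \<open>\<mu> \<bullet> \<lambda> = 0\<close> to be dense; for such \<open>\<mu>\<close> the mean acts by multiplication by an oscillatory integral
  whose zeros form a null set. Otherwise there are \<open>\<lambda> \<in> Z\<close> tending to \<open>0\<close>, and every \<open>\<mu>\<close> with
  \<open>\<mu> \<bullet> lim \<lambda>/|\<lambda>| > 0\<close> is the limit of visible frequencies of index \<open>k \<rightarrow> \<infinity>\<close>. On polynomials times a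
  Gaussian the mean is triangular, with diagonal entries polynomial in \<open>k\<close> and nonzero at \<open>k = 0\<close>;
  as these do not vanish for large \<open>k\<close>, all Gaussian moments of \<open>f\<close> vanish in the limit, and summing
  them gives the vanishing of the Fourier transform of \<open>f\<close> at \<open>- \<mu>\<close>. Left translations of \<open>f\<close> move
  the frequency \<open>- \<mu>\<close> to every \<open>\<eta> - \<mu>\<close> with \<open>\<eta>\<close> horizontal.
\<close>

section \<open>Lebesgue measure under shears\<close>

text \<open>A zero set provides one direction \<nu> for each \<lambda>, with no control over how
  \<nu> varies with \<lambda>, so nothing can be averaged over directions; and \<open>f\<close> is
  merely integrable. What remains is one arc per charge, bounded test functions, and the continuity
  of the Fourier transform, by which vanishing on a dense set suffices. A visible frequency of index
  k is not decisive by itself, since a diagonal entry of the triangular system can vanish for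
  particular k; only large k is safe. Hence the split by the size of \<lambda>. The visible
  hyperplanes of \<lambda> have spacing 2 |\<lambda>|^2. If |\<lambda>| \<ge> r throughout,
  frequencies of nonzero index have norm at least 2 r^2; inside that ball density is due to index 0
  alone, and hyperplanes through 0 carry it everywhere by scaling. If \<lambda> tends to 0, the
  spacing shrinks, so a fixed frequency off the limit hyperplane is approximated with indices whose
  size tends to infinity, and compactness makes the uncontrolled \<nu> converge along a
  subsequence.\<close>

lemma linear_measurable:
  fixes T :: "'a::euclidean_space \<Rightarrow> 'b::euclidean_space"
  assumes "linear T" shows "T \<in> borel_measurable borel"
  using assms by (intro borel_measurable_continuous_onI linear_continuous_on)
    (simp add: linear_conv_bounded_linear)

lemma nn_integral_lborel_translate:
  fixes f :: "'a::euclidean_space \<Rightarrow> ennreal"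
  assumes [measurable]: "f \<in> borel_measurable borel"
  shows "(\<integral>\<^sup>+x. f (a + x) \<partial>lborel) = (\<integral>\<^sup>+x. f x \<partial>lborel)"
  by (subst (2) lborel_distr_plus[of a, symmetric]) (simp add: nn_integral_distr)

lemma nn_integral_lborel_reflect:
  fixes f :: "'a::euclidean_space \<Rightarrow> ennreal"
  assumes [measurable]: "f \<in> borel_measurable borel"
  shows "(\<integral>\<^sup>+x. f (a - x) \<partial>lborel) = (\<integral>\<^sup>+x. f x \<partial>lborel)"
  by (subst (2) lborel_affine[of "-1" a]) (simp_all add: nn_integral_density nn_integral_distr)

text \<open>Uniqueness of Haar measure: the image of Lebesgue measure under \<open>T\<close> is translation invariant.\<close>

lemma linear_image_lborel_proportional:
  fixes T :: "'a::euclidean_space \<Rightarrow> 'a"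
  assumes T: "linear T" and S: "\<And>x. T (S x) = x"
  shows "\<exists>C. \<forall>A\<in>sets borel. emeasure lborel (T -` A) = C * emeasure lborel A"
proof -
  have [measurable]: "T \<in> borel_measurable borel" by (rule linear_measurable[OF T])
  \<comment> \<open>Both sides evaluate the double integral of
    \<open>indicator A (T x) * indicator B (T x + y)\<close>: translating y decouples the factors,
    while translating x by \<open>S y\<close> and then reflecting y exchanges the roles of A and
    B.\<close>
  have key: "emeasure lborel (T -` A) * emeasure lborel B = emeasure lborel (T -` B) * emeasure lborel A"
    if [measurable]: "A \<in> sets borel" "B \<in> sets borel" for A B :: "'a set"
  proof -
    have pre: "emeasure lborel (T -` A) = (\<integral>\<^sup>+x. indicator A (T x) \<partial>lborel)" if [measurable]: "A \<in> sets borel" for A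
      proof -
      have "T -` A \<in> sets lborel" using measurable_sets_borel[of T borel A] by simp
      then have "emeasure lborel (T -` A) = (\<integral>\<^sup>+x. indicator (T -` A) x \<partial>lborel)" by simp
      also have "\<dots> = (\<integral>\<^sup>+x. indicator A (T x) \<partial>lborel)" by (intro nn_integral_cong) (simp add: indicator_def)
      finally show ?thesis .
    qed
    have "emeasure lborel (T -` A) * emeasure lborel B =
        (\<integral>\<^sup>+x. \<integral>\<^sup>+y. indicator A (T x) * indicator B y \<partial>lborel \<partial>lborel)"
      by (simp add: pre nn_integral_cmult nn_integral_multc)
    also have "\<dots> = (\<integral>\<^sup>+x. \<integral>\<^sup>+y. indicator A (T x) * indicator B (T x + y) \<partial>lborel \<partial>lborel)"
      by (intro nn_integral_cong nn_integral_lborel_translate[symmetric]) simp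
    also have "\<dots> = (\<integral>\<^sup>+y. \<integral>\<^sup>+x. indicator A (T x) * indicator B (T x + y) \<partial>lborel \<partial>lborel)"
      by (rule lborel_pair.Fubini') simp
    also have "\<dots> = (\<integral>\<^sup>+y. \<integral>\<^sup>+x. indicator A (T x - y) * indicator B (T x) \<partial>lborel \<partial>lborel)"
    proof (rule nn_integral_cong)
      fix y
      show "(\<integral>\<^sup>+x. indicator A (T x) * indicator B (T x + y) \<partial>lborel) =
          (\<integral>\<^sup>+x. indicator A (T x - y) * indicator B (T x) \<partial>(lborel :: 'a measure))"
        using nn_integral_lborel_translate[of "\<lambda>x. indicator A (T x - y) * indicator B (T x)" "S y"]
        by (simp add: linear_add[OF T] S add.commute)
    qed
    also have "\<dots> = (\<integral>\<^sup>+x. \<integral>\<^sup>+y. indicator A (T x - y) * indicator B (T x) \<partial>lborel \<partial>lborel)"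
      by (rule lborel_pair.Fubini') simp
    also have "\<dots> = (\<integral>\<^sup>+x. emeasure lborel A * indicator B (T x) \<partial>lborel)"
      by (intro nn_integral_cong) (simp add: nn_integral_multc nn_integral_lborel_reflect[of "indicator A"])
    also have "\<dots> = emeasure lborel (T -` B) * emeasure lborel A"
      by (simp add: pre nn_integral_cmult mult.commute)
    finally show ?thesis .
  qed
  have "emeasure lborel (T -` A) = emeasure lborel (T -` cbox 0 One) * emeasure lborel A"
    if "A \<in> sets borel" for A
    using key[OF that, of "cbox 0 One"] by (simp add: emeasure_lborel_cbox_eq)
  then show ?thesis by blast
qed

text \<open>Using the factor of proportionality twice gives C * C = 1, and a nonnegative C is then
  1. Shears are reduced to this case, so no determinant enters.\<close>

lemma distr_lborel_linear_involution:
  fixes T :: "'a::euclidean_space \<Rightarrow> 'a"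
  assumes T: "linear T" and inv: "\<And>x. T (T x) = x"
  shows "distr lborel borel T = lborel"
proof -
  have [measurable]: "T \<in> borel_measurable borel" by (rule linear_measurable[OF T])
  obtain C where C: "\<And>A. A \<in> sets borel \<Longrightarrow> emeasure lborel (T -` A) = C * emeasure lborel A"
    using linear_image_lborel_proportional[OF T inv] by metis
  let ?Q = "cbox 0 One :: 'a set"
  have "emeasure lborel (T -` (T -` ?Q)) = C * (C * emeasure lborel ?Q)"
    using C[of ?Q] C[of "T -` ?Q"] measurable_sets_borel[of T borel ?Q] by simp
  moreover have "T -` (T -` ?Q) = ?Q" by (auto simp: inv)
  ultimately have CC: "C * C = 1" by (simp add: emeasure_lborel_cbox_eq)
  have "C = 1"
  proof (cases C)
    case (real r)
    then have "ennreal (r * r) = 1" using CC by (simp add: ennreal_mult)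
    then have "r * r = 1" by (simp only: ennreal_eq_1)
    then have "r = 1" using real by (simp add: square_eq_1_iff)
    then show ?thesis using real by simp
  next
    case top then show ?thesis using CC by simp
  qed
  then show ?thesis
    by (intro measure_eqI) (simp_all add: emeasure_distr C)
qed

lemma linear_orthogonal_projection:
  fixes S :: "'a::euclidean_space set"
  assumes "subspace S"
  obtains P where "linear P" "\<And>x. P x \<in> S" "\<And>x y. y \<in> S \<Longrightarrow> (x - P x) \<bullet> y = 0"
    "\<And>x. x \<in> S \<Longrightarrow> P x = x"
proof -
  obtain B where B: "B \<subseteq> S" "pairwise orthogonal B" "\<And>x. x \<in> B \<Longrightarrow> norm x = 1" "independent B" "span B = S"
    using orthonormal_basis_subspace[OF assms] by metis
  have fin: "finite B" using B(4) independent_imp_finite by blast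
  define P where "P x = (\<Sum>b\<in>B. (x \<bullet> b) *\<^sub>R b)" for x
  have lin: "linear P"
    by (rule linearI) (simp_all add: P_def inner_add_left scaleR_add_left sum.distrib scaleR_sum_right)
  have PS: "P x \<in> S" for x
    unfolding P_def using B assms by (intro subspace_sum subspace_scale) auto
  have "(x - P x) \<bullet> b = 0" if b: "b \<in> B" for x b
  proof -
    have "P x \<bullet> b = (\<Sum>b'\<in>B. if b' = b then x \<bullet> b else 0)"
      unfolding P_def inner_sum_left
      using B(2,3) b by (intro sum.cong) (auto simp: pairwise_def orthogonal_def norm_eq_1)
    then show ?thesis using fin b by (simp add: inner_diff_left)
  qed
  then have ort: "(x - P x) \<bullet> y = 0" if "y \<in> S" for x y
    using orthogonal_to_span[of y B "x - P x"] that B(5) by (auto simp: orthogonal_def)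
  have "P x = x" if "x \<in> S" for x
  proof -
    have "(x - P x) \<bullet> (x - P x) = 0"
      using that PS assms by (intro ort subspace_diff) auto
    then show ?thesis by simp
  qed
  then show thesis using that[of P] lin PS ort by blast
qed

text \<open>A shear \<open>x \<mapsto> x + N x\<close> along \<open>S\<close> is the product of two involutions, one of them the
  reflection in the orthogonal complement of \<open>S\<close>.\<close>

lemma distr_lborel_shear:
  fixes N :: "'a::euclidean_space \<Rightarrow> 'a"
  assumes N: "linear N" and S: "subspace S" and NS: "\<And>x. N x \<in> S" and N0: "\<And>x. x \<in> S \<Longrightarrow> N x = 0"
  shows "distr lborel borel (\<lambda>x. a + (x + N x)) = lborel"
proof -
  obtain P where P: "linear P" "\<And>x. P x \<in> S" "\<And>x. x \<in> S \<Longrightarrow> P x = x"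
    using linear_orthogonal_projection[OF S] by metis
  define R where "R x = x - 2 *\<^sub>R P x" for x
  have R: "linear R" and RN: "linear (\<lambda>x. R (x + N x))"
    by (auto intro!: linearI simp: R_def linear_add[OF P(1)] linear_scale[OF P(1)] linear_add[OF N] linear_scale[OF N] algebra_simps)
  have RR: "R (R x) = x" for x
    by (simp add: R_def linear_diff[OF P(1)] linear_add[OF P(1)] P(2,3) scaleR_2)
  \<comment> \<open>As operators R N = - N and N R = N, so the map is R - N, and (R - N)^2 = 1
    because N N = 0.\<close>
  have inv: "R (R (x + N x) + N (R (x + N x))) = x" for x
  proof -
    have NR: "N (R y) = N y" for y
      by (simp add: R_def linear_diff[OF N] linear_scale[OF N] N0 P(2))
    have "R (N y) = - N y" for y
      by (simp add: R_def P(3) NS scaleR_2)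
    then show ?thesis
      by (simp add: linear_add[OF R] linear_diff[OF R] RR NR linear_add[OF N] linear_diff[OF N] N0 NS)
  qed
  have m [measurable]: "R \<in> borel_measurable borel" "(\<lambda>x. R (x + N x)) \<in> borel_measurable borel"
    "N \<in> borel_measurable borel"
    by (auto intro!: linear_measurable R RN N)
  have "distr lborel borel (\<lambda>x. a + (x + N x)) =
      distr (distr (distr lborel borel (\<lambda>x. R (x + N x))) borel R) borel ((+) a)"
    by (simp add: distr_distr o_def RR)
  then show ?thesis
    using distr_lborel_linear_involution[OF RN inv] distr_lborel_linear_involution[OF R RR]
    by (simp add: lborel_distr_plus)
qed

section \<open>Uniqueness of the Fourier transform\<close>

text \<open>The exponent is positive and carries no factor 2 \<pi>. Pairing with
  \<open>cis (- (\<mu> \<bullet> g))\<close> therefore produces the value at - \<mu>, the source of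
  the minus signs in the vanishing results.\<close>

definition fourier :: "('a::euclidean_space \<Rightarrow> complex) \<Rightarrow> 'a \<Rightarrow> complex" where
  "fourier f \<xi> = (\<integral>x. f x * cis (\<xi> \<bullet> x) \<partial>lborel)"

lemma borel_measurable_cis [measurable (raw)]:
  "f \<in> borel_measurable M \<Longrightarrow> (\<lambda>x. cis (f x)) \<in> borel_measurable M"
  by (simp add: cis_conv_exp)

lemma integrable_mult_bounded:
  fixes f w :: "'a \<Rightarrow> complex"
  assumes f: "integrable M f" and [measurable]: "w \<in> borel_measurable M" and "\<And>x. cmod (w x) \<le> C"
  shows "integrable M (\<lambda>x. f x * w x)"
proof (rule Bochner_Integration.integrable_bound)
  show "integrable M (\<lambda>x. C * norm (f x))" using f by simp
  show "AE x in M. norm (f x * w x) \<le> norm (C * norm (f x))"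
  proof (intro AE_I2)
    fix x
    have "norm (f x) * norm (w x) \<le> norm (f x) * C" using assms(3) by (intro mult_left_mono) auto
    then show "norm (f x * w x) \<le> norm (C * norm (f x))" by (simp add: norm_mult mult.commute)
  qed
qed (use f in simp)

lemma integral_mult_bounded_limit:
  fixes f v :: "'a \<Rightarrow> complex" and w :: "nat \<Rightarrow> 'a \<Rightarrow> complex"
  assumes f: "integrable M f" and m: "\<And>n::nat. w n \<in> borel_measurable M" "v \<in> borel_measurable M"
    and C: "\<And>n x. cmod (w n x) \<le> C" and lim: "\<And>x. (\<lambda>n. w n x) \<longlonglongrightarrow> v x"
  shows "(\<lambda>n. \<integral>x. f x * w n x \<partial>M) \<longlonglongrightarrow> (\<integral>x. f x * v x \<partial>M)"
proof (rule integral_dominated_convergence)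
  note [measurable] = m
  have [measurable]: "f \<in> borel_measurable M" using f by simp
  show "(\<lambda>x. f x * v x) \<in> borel_measurable M" "\<And>i. (\<lambda>x. f x * w i x) \<in> borel_measurable M" by simp_all
  show "integrable M (\<lambda>x. C * norm (f x))" using f by simp
  show "AE x in M. (\<lambda>i. f x * w i x) \<longlonglongrightarrow> f x * v x" by (intro AE_I2 tendsto_intros lim)
  fix i
  show "AE x in M. norm (f x * w i x) \<le> C * norm (f x)"
    using C[of i] by (intro AE_I2) (subst mult.commute, simp add: norm_mult mult_left_mono)
qed

lemma continuous_fourier:
  assumes "integrable lborel f"
  shows "continuous_on UNIV (fourier f)"
proof (rule continuous_on_sequentiallyI)
  fix u :: "nat \<Rightarrow> 'a" and a assume "u \<longlonglongrightarrow> a"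
  then show "(\<lambda>n. fourier f (u n)) \<longlonglongrightarrow> fourier f a"
    unfolding fourier_def using assms
    by (intro integral_mult_bounded_limit[where C = 1] tendsto_cis tendsto_inner tendsto_const) simp_all
qed

inductive trig_poly :: "('a::euclidean_space \<Rightarrow> complex) \<Rightarrow> bool" where
  char: "trig_poly (\<lambda>x. c * cis (\<xi> \<bullet> x))"
| add: "trig_poly p \<Longrightarrow> trig_poly q \<Longrightarrow> trig_poly (\<lambda>x. p x + q x)"

lemma trig_poly_const: "trig_poly (\<lambda>x. c)"
  using char[of c 0] by simp

lemma trig_poly_mult:
  assumes "trig_poly p" "trig_poly q" shows "trig_poly (\<lambda>x. p x * q x)"
  using assms(1)
proof induction
  case (char c \<xi>)
  show ?case using assms(2)
  proof induction
    case (char c' \<xi>')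
    have "(\<lambda>x. c * cis (\<xi> \<bullet> x) * (c' * cis (\<xi>' \<bullet> x))) = (\<lambda>x. (c * c') * cis ((\<xi> + \<xi>') \<bullet> x))"
      by (simp add: fun_eq_iff inner_add_left algebra_simps flip: cis_mult)
    then show ?case by (simp only: trig_poly.char)
  next
    case (add p q)
    then show ?case by (simp add: distrib_left trig_poly.add)
  qed
next
  case (add p q)
  then show ?case by (simp add: distrib_right trig_poly.add)
qed

lemma trig_poly_sin: "trig_poly (\<lambda>x. complex_of_real (sin (\<xi> \<bullet> x)))"
proof -
  have "complex_of_real (sin t) = (- \<i> / 2) * cis t + (\<i> / 2) * cis (- t)" for t
    by (simp add: complex_eq_iff)
  then have "(\<lambda>x. complex_of_real (sin (\<xi> \<bullet> x))) =
      (\<lambda>x. (- \<i> / 2) * cis (\<xi> \<bullet> x) + (\<i> / 2) * cis ((- \<xi>) \<bullet> x))" by (simp only: inner_minus_left)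
  then show ?thesis by (simp only: trig_poly.add[OF trig_poly.char trig_poly.char])
qed

lemma integral_trig_poly_eq_0:
  assumes "trig_poly p" and f: "integrable lborel f" and "\<And>\<xi>. fourier f \<xi> = 0"
  shows "integrable lborel (\<lambda>x. f x * p x) \<and> (\<integral>x. f x * p x \<partial>lborel) = 0"
  using assms(1)
proof induction
  case (char c \<xi>)
  have "integrable lborel (\<lambda>x. f x * (c * cis (\<xi> \<bullet> x)))"
    by (rule integrable_mult_bounded[OF f, where C = "cmod c"]) (simp_all add: norm_mult)
  moreover have "(\<integral>x. f x * (c * cis (\<xi> \<bullet> x)) \<partial>lborel) = c * fourier f \<xi>"
    unfolding fourier_def by (subst integral_mult_right_zero[symmetric]) (simp add: mult_ac)
  ultimately show ?case using assms(3) by simp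
next
  case (add p q)
  then show ?case by (simp add: distrib_left)
qed

text \<open>The bounded map \<open>sine_map L\<close> tends to the identity as \<open>L \<rightarrow> \<infinity>\<close>, and a polynomial in it is a
  trigonometric polynomial; Stone--Weierstrass on a cube then reaches all continuous functions of it.\<close>

definition sine_map :: "real \<Rightarrow> 'a::euclidean_space \<Rightarrow> 'a" where
  "sine_map L x = (\<Sum>b\<in>Basis. (L * sin ((x \<bullet> b) / L)) *\<^sub>R b)"

lemma trig_poly_real_polynomial_sine:
  assumes "real_polynomial_function P"
  shows "trig_poly (\<lambda>x. complex_of_real (P (sine_map L x)))"
  using assms
proof (induction rule: real_polynomial_function.induct)
  case (linear l)
  have "trig_poly (\<lambda>x. \<Sum>b\<in>B. complex_of_real (L * sin ((x \<bullet> b) / L) * l b))" if "finite B" for B :: "'a set"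
    using that
  proof induction
    case empty then show ?case by (simp add: trig_poly_const)
  next
    case (insert b B)
    have "trig_poly (\<lambda>x. complex_of_real (L * l b) * complex_of_real (sin ((b /\<^sub>R L) \<bullet> x)))"
      by (intro trig_poly_mult trig_poly_const trig_poly_sin)
    then have "trig_poly (\<lambda>x. complex_of_real (L * sin ((x \<bullet> b) / L) * l b))"
      by (simp add: inner_commute divide_inverse mult_ac)
    from trig_poly.add[OF this insert.IH] show ?case using insert.hyps by simp
  qed
  moreover have "l (sine_map L x) = (\<Sum>b\<in>Basis. L * sin ((x \<bullet> b) / L) * l b)" for x
    using linear by (simp add: sine_map_def linear_sum bounded_linear.linear linear_scale)
  ultimately show ?case by simp
qed (auto simp: trig_poly_const intro: trig_poly.add trig_poly_mult)

lemma sine_map_tendsto: "(\<lambda>n. sine_map (real (Suc n)) x) \<longlonglongrightarrow> x"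
proof -
  have "(\<lambda>n. real (Suc n) * sin (t / real (Suc n))) \<longlonglongrightarrow> t" for t :: real
  proof (cases "t = 0")
    case False
    have "((\<lambda>h. sin h / h) \<longlongrightarrow> 1) (at (0::real))"
      using DERIV_sin[of 0] unfolding DERIV_def by simp
    moreover have "filterlim (\<lambda>n. t / real (Suc n)) (at 0) sequentially"
      unfolding filterlim_at using False
      by (auto intro!: tendsto_divide_0[OF tendsto_const] filterlim_at_top_imp_at_infinity
          filterlim_compose[OF filterlim_real_sequentially filterlim_Suc] simp del: of_nat_Suc)
    ultimately have "(\<lambda>n. t * (sin (t / real (Suc n)) / (t / real (Suc n)))) \<longlonglongrightarrow> t * 1"
      by (intro tendsto_mult tendsto_const) (rule filterlim_compose)
    then show ?thesis using False by (simp add: mult_ac del: of_nat_Suc)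
  qed simp
  then have "(\<lambda>n. sine_map (real (Suc n)) x) \<longlonglongrightarrow> (\<Sum>b\<in>Basis. (x \<bullet> b) *\<^sub>R b)"
    unfolding sine_map_def by (intro tendsto_sum tendsto_scaleR tendsto_const)
  then show ?thesis by (simp add: euclidean_representation)
qed

lemma continuous_sine_map: "continuous_on UNIV (sine_map L)"
  unfolding sine_map_def[abs_def] by (cases "L = 0") (auto intro!: continuous_intros)

text \<open>The values of \<open>sine_map L\<close> stay in the cube of half-side L, where a
  polynomial approximates \<phi> within e. It integrates to 0 against f, so the integral is at most
  e times the L^1 norm of f.\<close>

lemma integral_sine_map_eq_0:
  fixes \<phi> :: "'a::euclidean_space \<Rightarrow> real"
  assumes f: "integrable lborel f" and F: "\<And>\<xi>. fourier f \<xi> = 0"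
    and \<phi>: "continuous_on UNIV \<phi>" and L: "L > 0"
  shows "(\<integral>x. f x * complex_of_real (\<phi> (sine_map L x)) \<partial>lborel) = 0"
proof -
  let ?K = "cbox (\<Sum>b\<in>Basis. (- L) *\<^sub>R b) (\<Sum>b\<in>Basis. L *\<^sub>R b) :: 'a set"
  have K: "sine_map L x \<in> ?K" for x
  proof -
    have "- L \<le> L * sin t \<and> L * sin t \<le> L" for t
      using L mult_left_mono[of "sin t" 1 L] mult_left_mono[of "-1" "sin t" L] by simp
    then show ?thesis by (simp add: mem_box sine_map_def inner_sum_left_Basis del: scaleR_minus_left)
  qed
  have [measurable]: "sine_map L \<in> borel_measurable borel" "\<phi> \<in> borel_measurable borel"
    using continuous_sine_map \<phi> by (auto intro: borel_measurable_continuous_onI)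
  obtain B where B: "\<And>y. y \<in> ?K \<Longrightarrow> \<bar>\<phi> y\<bar> \<le> B"
    using compact_imp_bounded[OF compact_continuous_image[OF continuous_on_subset[OF \<phi>] compact_cbox], of "\<Sum>b\<in>Basis. (- L) *\<^sub>R b" "\<Sum>b\<in>Basis. L *\<^sub>R b"]
    by (auto simp: bounded_iff)
  have int\<phi>: "integrable lborel (\<lambda>x. f x * complex_of_real (\<phi> (sine_map L x)))"
    using B K by (intro integrable_mult_bounded[OF f, where C = B]) auto
  have bound: "cmod (\<integral>x. f x * complex_of_real (\<phi> (sine_map L x)) \<partial>lborel) \<le> e * (\<integral>x. norm (f x) \<partial>lborel)"
    if e: "e > 0" for e
  proof -
    obtain P where P: "real_polynomial_function P" "\<And>x. x \<in> ?K \<Longrightarrow> \<bar>\<phi> x - P x\<bar> < e"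
      using Stone_Weierstrass_real_polynomial_function[OF compact_cbox continuous_on_subset[OF \<phi>] e] by blast
    note z = integral_trig_poly_eq_0[OF trig_poly_real_polynomial_sine[OF P(1), of L] f F]
    have "(\<integral>x. f x * complex_of_real (\<phi> (sine_map L x)) \<partial>lborel) =
        (\<integral>x. f x * complex_of_real (\<phi> (sine_map L x)) - f x * complex_of_real (P (sine_map L x)) \<partial>lborel)"
      using z int\<phi> by simp
    also have "cmod \<dots> \<le> (\<integral>x. norm (f x * complex_of_real (\<phi> (sine_map L x)) -
        f x * complex_of_real (P (sine_map L x))) \<partial>lborel)"
      by (rule integral_norm_bound)
    also have "\<dots> \<le> (\<integral>x. e * norm (f x) \<partial>lborel)"
    proof (rule integral_mono)
      fix x
      have "cmod (f x) * \<bar>\<phi> (sine_map L x) - P (sine_map L x)\<bar> \<le> cmod (f x) * e"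
        using P(2)[OF K[of x]] by (intro mult_left_mono) auto
      then show "norm (f x * complex_of_real (\<phi> (sine_map L x)) - f x * complex_of_real (P (sine_map L x)))
          \<le> e * norm (f x)"
        by (simp add: norm_mult mult.commute flip: right_diff_distrib of_real_diff)
    qed (use z int\<phi> f in auto)
    finally show ?thesis by simp
  qed
  show ?thesis
  proof (rule ccontr)
    let ?I = "cmod (\<integral>x. f x * complex_of_real (\<phi> (sine_map L x)) \<partial>lborel)"
    let ?N = "\<integral>x. norm (f x) \<partial>lborel"
    assume "\<not> ?thesis"
    then have I: "?I > 0" by simp
    have N: "?N \<ge> 0" by simp
    \<comment> \<open>The denominator \<open>?N + 1\<close> covers the case \<open>?N = 0\<close>;
      the half makes the contradiction strict.\<close>
    have "?I \<le> (?I / (?N + 1) / 2) * ?N" using I N by (intro bound divide_pos_pos) linarith+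
    also have "\<dots> \<le> ?I / 2"
    proof -
      have "i / (n + 1) / 2 * n \<le> i / 2" if "i > 0" "n \<ge> 0" for i n :: real
        using that by (simp add: field_simps)
      then show ?thesis using I N by blast
    qed
    finally show False using I by simp
  qed
qed

text \<open>Vanishing passes from bounded continuous functions to closed sets by distance cut-offs,
  then to Borel sets because the closed sets are an intersection-stable generator. A density whose
  integrals over all Borel sets vanish is 0 almost everywhere.\<close>

theorem fourier_unique:
  fixes f :: "'a::euclidean_space \<Rightarrow> complex"
  assumes f: "integrable lborel f" and F: "\<And>\<xi>. fourier f \<xi> = 0"
  shows "AE x in lborel. f x = 0"
proof -
  have cont: "(\<integral>x. f x * complex_of_real (\<phi> x) \<partial>lborel) = 0"
    if \<phi>: "continuous_on UNIV \<phi>" and b: "\<And>x. \<bar>\<phi> x\<bar> \<le> 1" for \<phi> :: "'a \<Rightarrow> real"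
  proof -
    have [measurable]: "sine_map L \<in> borel_measurable borel" "\<phi> \<in> borel_measurable borel" for L :: real
      using continuous_sine_map \<phi> by (auto intro: borel_measurable_continuous_onI)
    have "(\<lambda>n. \<integral>x. f x * complex_of_real (\<phi> (sine_map (real (Suc n)) x)) \<partial>lborel)
        \<longlonglongrightarrow> (\<integral>x. f x * complex_of_real (\<phi> x) \<partial>lborel)"
    proof (rule integral_mult_bounded_limit[OF f, where C = 1])
      fix x
      show "(\<lambda>n. complex_of_real (\<phi> (sine_map (real (Suc n)) x))) \<longlonglongrightarrow> complex_of_real (\<phi> x)"
        using continuous_on_tendsto_compose[OF \<phi> sine_map_tendsto] by (intro tendsto_of_real) auto
    qed (use b in auto)
    then show ?thesis
      using integral_sine_map_eq_0[OF f F \<phi>] by (simp add: LIMSEQ_const_iff del: of_nat_Suc)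
  qed
  have closed: "(\<integral>x. f x * indicator C x \<partial>lborel) = 0" if C: "closed C" for C :: "'a set"
  proof (cases "C = {}")
    case False
    let ?\<phi> = "\<lambda>n x. max 0 (1 - real n * setdist {x} C)"
    have c: "continuous_on UNIV (?\<phi> n)" for n by (intro continuous_intros continuous_on_setdist)
    have [measurable]: "?\<phi> n \<in> borel_measurable borel" for n by (intro borel_measurable_continuous_onI c)
    have [measurable]: "C \<in> sets borel" using C by simp
    have "(\<lambda>n. \<integral>x. f x * complex_of_real (?\<phi> n x) \<partial>lborel) \<longlonglongrightarrow> (\<integral>x. f x * indicator C x \<partial>lborel)"
    proof (rule integral_mult_bounded_limit[OF f, where C = 1])
      fix x
      have "(\<lambda>n. ?\<phi> n x) \<longlonglongrightarrow> indicator C x"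
      proof (cases "x \<in> C")
        case True then show ?thesis by (simp add: setdist_sing_in_set)
      next
        case x: False
        then have d: "setdist {x} C > 0" using C False setdist_pos_le[of "{x}" C] setdist_eq_0_closed[of C x]
          by (simp add: less_le)
        obtain N where "real N * setdist {x} C > 1" using reals_Archimedean3[OF d] by blast
        then have "?\<phi> n x = 0" if "n \<ge> N" for n
        proof -
          have "real N * setdist {x} C \<le> real n * setdist {x} C" using that d by (intro mult_right_mono) auto
          then show ?thesis using \<open>real N * setdist {x} C > 1\<close> by linarith
        qed
        then show ?thesis using x by (intro tendsto_eventually eventually_sequentiallyI) auto
      qed
      then have "(\<lambda>n. complex_of_real (?\<phi> n x)) \<longlonglongrightarrow> complex_of_real (indicator C x)" by (rule tendsto_of_real)
      then show "(\<lambda>n. complex_of_real (?\<phi> n x)) \<longlonglongrightarrow> indicator C x"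
        by (cases "x \<in> C") simp_all
      fix n show "cmod (complex_of_real (?\<phi> n x)) \<le> 1" by (simp add: setdist_pos_le)
    qed simp_all
    moreover have "(\<integral>x. f x * complex_of_real (?\<phi> n x) \<partial>lborel) = 0" for n
      by (intro cont c) (simp add: setdist_pos_le)
    ultimately show ?thesis by (simp only: LIMSEQ_const_iff)
  qed simp
  have borel: "(\<integral>x. f x * indicator A x \<partial>lborel) = 0" if "A \<in> sets borel" for A :: "'a set"
  proof -
    have "Int_stable {C::'a set. closed C}" "{C::'a set. closed C} \<subseteq> Pow UNIV"
      "A \<in> sigma_sets UNIV {C. closed C}"
      using that by (auto simp: Int_stable_def borel_eq_closed)
    then show ?thesis
    proof (induction rule: sigma_sets_induct_disjoint[consumes 3])
      case (compl A)
      have [measurable]: "A \<in> sets borel" using compl(1) by (simp add: borel_eq_closed)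
      have i: "integrable lborel (\<lambda>x. f x * indicator A x)"
        by (intro integrable_mult_bounded[OF f, where C = 1]) (auto simp: indicator_def)
      have "(\<lambda>x. f x * indicator (UNIV - A) x) = (\<lambda>x. f x - f x * indicator A x)"
        by (auto simp: indicator_def)
      then show ?case using compl i f closed[of UNIV] by simp
    next
      case (union A)
      have [measurable]: "A i \<in> sets borel" for i using union by (auto simp: borel_eq_closed)
      have i: "integrable lborel (\<lambda>x. f x * indicator (A n) x)" for n
        by (intro integrable_mult_bounded[OF f, where C = 1]) (auto simp: indicator_def)
      have "(\<lambda>n. \<integral>x. f x * (\<Sum>k<n. indicator (A k) x) \<partial>lborel)
          \<longlonglongrightarrow> (\<integral>x. f x * indicator (\<Union>i. A i) x \<partial>lborel)"
      proof (rule integral_mult_bounded_limit[OF f, where C = 1])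
        fix x
        have s: "(\<lambda>i. indicator (A i) x :: real) sums indicator (\<Union>i. A i) x"
          using indicator_sums[of A x] union by (auto simp: disjoint_family_on_def)
        have ind: "complex_of_real (indicator S x) = indicator S x" for S :: "'a set" by (simp add: indicator_def)
        have "(\<lambda>i. complex_of_real (indicator (A i) x)) sums complex_of_real (indicator (\<Union>i. A i) x)"
          using s by (rule sums_of_real)
        then show "(\<lambda>n. \<Sum>k<n. indicator (A k) x) \<longlonglongrightarrow> (indicator (\<Union>i. A i) x :: complex)"
          by (simp add: ind sums_def)
        fix n
        have "(\<Sum>k<n. indicator (A k) x :: real) \<le> indicator (\<Union>i. A i) x"
          using s by (intro sum_le_suminf[THEN order_trans]) (auto simp: sums_iff)
        also have "\<dots> \<le> 1" by (simp add: indicator_def)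
        finally have "cmod (complex_of_real (\<Sum>k<n. indicator (A k) x)) \<le> 1"
          by (simp only: norm_of_real) (simp add: sum_nonneg)
        then show "cmod (\<Sum>k<n. indicator (A k) x) \<le> 1" by (simp add: ind)
      qed simp_all
      moreover have "(\<integral>x. f x * (\<Sum>k<n. indicator (A k) x) \<partial>lborel) = 0" for n
        using union i by (simp only: sum_distrib_left Bochner_Integration.integral_sum sum.neutral_const)
      ultimately show ?case by (simp only: LIMSEQ_const_iff)
    qed (auto simp: closed)
  qed
  show ?thesis
  proof (rule sigma_finite_measure.density_zero[OF sigma_finite_lborel f])
    fix A :: "'a set" assume "A \<in> sets lborel"
    moreover have "indicat_real A x *\<^sub>R f x = f x * indicator A x" for x by (simp add: indicator_def)
    ultimately show "set_lebesgue_integral lborel A f = 0"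
      using borel[of A] by (simp add: set_lebesgue_integral_def)
  qed
qed

section \<open>Integrable functions with small spectrum\<close>

text \<open>\<open>V\<close> may fail to be integrable, so the two terms cannot be integrated
  separately. Instead D, the integral of V over [x, x + T], is an antiderivative of the difference
  and tends to 0 at both ends because V does.\<close>

lemma integral_shift_difference_eq_0:
  fixes V :: "real \<Rightarrow> complex"
  assumes cont: "continuous_on UNIV V" and top: "(V \<longlongrightarrow> 0) at_top" and bot: "(V \<longlongrightarrow> 0) at_bot"
    and T: "T > 0"
  shows "(\<integral>s. V (s + T) - V s \<partial>lborel) = 0"
proof (cases "integrable lborel (\<lambda>s. V (s + T) - V s)")
  case int: True
  have isC: "isCont V x" for x using cont by (simp add: continuous_on_eq_continuous_at)
  obtain W where W: "\<And>x. (W has_vector_derivative V x) (at x)"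
    using einterval_antiderivative[of "-\<infinity>" "\<infinity>" V] isC by auto
  define D where "D x = W (x + T) - W x" for x
  have D: "(D has_vector_derivative (V (x + T) - V x)) (at x)" for x
    unfolding D_def
  proof (intro has_vector_derivative_diff W)
    have "((\<lambda>x. x + T) has_vector_derivative 1) (at x)"
      unfolding has_real_derivative_iff_has_vector_derivative[symmetric] by (auto intro!: derivative_eq_intros)
    from vector_diff_chain_at[OF this W] show "((\<lambda>x. W (x + T)) has_vector_derivative V (x + T)) (at x)"
      by (simp add: o_def)
  qed
  have bound: "\<exists>\<xi>. x < \<xi> \<and> \<xi> < x + T \<and> norm (D x) \<le> T * norm (V \<xi>)" for x
  proof -
    have "\<exists>\<xi>\<in>{x<..<x+T}. norm (W (x + T) - W x) \<le> norm ((x + T - x) *\<^sub>R V \<xi>)"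
    proof (rule mvt_general)
      show "continuous_on {x..x+T} W"
        by (meson W has_vector_derivative_continuous continuous_at_imp_continuous_on)
      show "(W has_derivative (\<lambda>h. h *\<^sub>R V \<xi>)) (at \<xi>)" for \<xi>
        using W by (simp add: has_vector_derivative_def)
    qed (use T in simp)
    then show ?thesis using T by (auto simp: D_def)
  qed
  have Dtop: "(D \<longlongrightarrow> 0) at_top"
  proof (rule tendstoI)
    fix e :: real assume e: "e > 0"
    then have "\<forall>\<^sub>F x in at_top. dist (V x) 0 < e / T" using T by (intro tendstoD[OF top]) simp
    then obtain R where R: "\<And>x. x \<ge> R \<Longrightarrow> norm (V x) < e / T" by (auto simp: eventually_at_top_linorder)
    have "norm (D x) < e" if "x \<ge> R" for x
    proof -
      obtain \<xi> where "x < \<xi>" "norm (D x) \<le> T * norm (V \<xi>)" using bound by blast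
      moreover have "T * norm (V \<xi>) < T * (e / T)"
        using T R[of \<xi>] that \<open>x < \<xi>\<close> by (intro mult_strict_left_mono) auto
      ultimately show ?thesis using T by simp
    qed
    then show "\<forall>\<^sub>F x in at_top. dist (D x) 0 < e" by (auto simp: eventually_at_top_linorder)
  qed
  have Dbot: "(D \<longlongrightarrow> 0) at_bot"
  proof (rule tendstoI)
    fix e :: real assume e: "e > 0"
    then have "\<forall>\<^sub>F x in at_bot. dist (V x) 0 < e / T" using T by (intro tendstoD[OF bot]) simp
    then obtain R where R: "\<And>x. x \<le> R \<Longrightarrow> norm (V x) < e / T" by (auto simp: eventually_at_bot_linorder)
    have "norm (D x) < e" if "x \<le> R - T" for x
    proof -
      obtain \<xi> where "\<xi> < x + T" "norm (D x) \<le> T * norm (V \<xi>)" using bound by blast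
      moreover have "T * norm (V \<xi>) < T * (e / T)"
        using T R[of \<xi>] that \<open>\<xi> < x + T\<close> by (intro mult_strict_left_mono) auto
      ultimately show ?thesis using T by simp
    qed
    then show "\<forall>\<^sub>F x in at_bot. dist (D x) 0 < e" by (auto simp: eventually_at_bot_linorder)
  qed
  let ?u = "\<lambda>s. V (s + T) - V s"
  have FTC: "(\<integral>s. indicator {- real n..real n} s *\<^sub>R ?u s \<partial>lborel) = D (real n) - D (- real n)" for n
    by (rule integral_FTC_Icc)
      (auto intro!: D[THEN has_vector_derivative_at_within] continuous_intros continuous_on_subset[OF cont]
        continuous_on_compose2[OF cont])
  have "(\<lambda>n. \<integral>s. indicator {- real n..real n} s *\<^sub>R ?u s \<partial>lborel) \<longlonglongrightarrow> (\<integral>s. ?u s \<partial>lborel)"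
  proof (rule integral_dominated_convergence)
    show "integrable lborel (\<lambda>s. norm (?u s))" using int by simp
    show "AE s in lborel. (\<lambda>n. indicator {- real n..real n} s *\<^sub>R ?u s) \<longlonglongrightarrow> ?u s"
    proof (intro AE_I2 tendsto_eventually)
      fix s :: real
      obtain N where "\<bar>s\<bar> \<le> real N" using real_arch_simple by blast
      then show "\<forall>\<^sub>F n in sequentially. indicator {- real n..real n} s *\<^sub>R ?u s = ?u s"
        by (intro eventually_sequentiallyI[of N]) (auto simp: indicator_def abs_le_iff)
    qed
    show "AE s in lborel. norm (indicator {- real n..real n} s *\<^sub>R ?u s) \<le> norm (?u s)" for n
      by (auto simp: indicator_def)
  qed (use int in simp_all)
  moreover have "(\<lambda>n. D (real n) - D (- real n)) \<longlonglongrightarrow> 0 - 0"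
    by (intro tendsto_diff filterlim_compose[OF Dtop] filterlim_compose[OF Dbot]
        filterlim_real_sequentially filterlim_compose[OF filterlim_uminus_at_bot_at_top])
  ultimately show ?thesis by (simp add: FTC LIMSEQ_unique)
\<comment> \<open>Without integrability of the difference its Bochner integral has the default value
  0.\<close>
qed (simp add: not_integrable_integral_eq)

lemma integral_lborel_translate:
  fixes f :: "'a::euclidean_space \<Rightarrow> 'b::{banach, second_countable_topology}"
  assumes "f \<in> borel_measurable borel"
  shows "(\<integral>x. f (a + x) \<partial>lborel) = (\<integral>x. f x \<partial>lborel)"
  using assms by (subst (2) lborel_distr_plus[of a, symmetric]) (simp add: integral_distr)

lemma integrable_compact_support:
  fixes F :: "'a::euclidean_space \<Rightarrow> complex"
  assumes "continuous_on UNIV F" "compact K" "\<And>x. x \<notin> K \<Longrightarrow> F x = 0"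
  shows "integrable lborel F"
proof -
  have "integrable lborel (\<lambda>x. indicator K x *\<^sub>R F x)"
    using assms by (intro borel_integrable_compact) (auto intro: continuous_on_subset)
  moreover have "(\<lambda>x. indicator K x *\<^sub>R F x) = F" using assms(3) by (auto simp: indicator_def)
  ultimately show ?thesis by simp
qed

lemma bounded_compact_support:
  fixes F :: "'a::euclidean_space \<Rightarrow> complex"
  assumes "continuous_on UNIV F" "compact K" "\<And>x. x \<notin> K \<Longrightarrow> F x = 0"
  obtains B where "\<And>x. norm (F x) \<le> B" "B \<ge> 0"
proof -
  obtain B where "\<And>x. x \<in> K \<Longrightarrow> norm (F x) \<le> B"
    using compact_imp_bounded[OF compact_continuous_image[OF continuous_on_subset[OF assms(1)] assms(2)]]
    by (auto simp: bounded_iff)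
  then have "norm (F x) \<le> max 0 B" for x using assms(3)[of x] by (cases "x \<in> K") (simp_all add: le_max_iff_disj)
  then show thesis using that[of "max 0 B"] by simp
qed

text \<open>Translating by \<open>\<pi> \<xi> / |\<xi>|\<^sup>2\<close> changes the sign of the character.\<close>

lemma riemann_lebesgue:
  fixes F :: "'a::euclidean_space \<Rightarrow> complex"
  assumes cont: "continuous_on UNIV F" and R: "\<And>x. norm x > R \<Longrightarrow> F x = 0"
  shows "(fourier F \<longlongrightarrow> 0) at_infinity"
proof -
  have supp: "\<And>x. x \<notin> cball 0 R \<Longrightarrow> F x = 0" using R by simp
  have F: "integrable lborel F" by (rule integrable_compact_support[OF cont compact_cball supp])
  have [measurable]: "F \<in> borel_measurable borel" using F by simp
  obtain B where B: "\<And>x. norm (F x) \<le> B" "B \<ge> 0"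
    using bounded_compact_support[OF cont compact_cball supp] by blast
  define d where "d \<xi> = (pi / (norm \<xi>)\<^sup>2) *\<^sub>R \<xi>" for \<xi> :: 'a
  \<comment> \<open>The L^1 modulus of continuity of F, which bounds the transform at \<xi> once the
    shift \<open>d \<xi>\<close> is inserted.\<close>
  define \<omega> where "\<omega> a = (\<integral>x. norm (F x - F (a + x)) \<partial>lborel)" for a
  have "(\<lambda>n. \<omega> (X n)) \<longlonglongrightarrow> (\<integral>x. 0 \<partial>(lborel :: 'a measure))" if X: "X \<longlonglongrightarrow> 0" for X
  proof -
    obtain M where M: "\<And>n. norm (X n) \<le> M"
      using convergent_imp_Bseq[of X] X by (auto simp: convergent_def Bseq_def)
    show ?thesis
      unfolding \<omega>_def
    proof (rule integral_dominated_convergence; (intro AE_I2)?)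
      \<comment> \<open>The shifts of a convergent sequence are bounded by M, so all shifted
        supports lie in one ball.\<close>
      show "integrable lborel (\<lambda>x. 2 * B * indicat_real (cball 0 (R + M)) (x::'a))"
        using emeasure_compact_finite[OF compact_cball, of "0::'a" "R + M"]
        by (intro integrable_mult_right integrable_real_indicator) simp_all
      fix x :: 'a
      have "isCont F x" using cont by (simp add: continuous_on_eq_continuous_at)
      then have "(\<lambda>n. F (X n + x)) \<longlonglongrightarrow> F (0 + x)"
        by (intro isCont_tendsto_compose[of _ F] tendsto_intros X) simp
      then have "(\<lambda>n. norm (F x - F (X n + x))) \<longlonglongrightarrow> norm (F x - F (0 + x))"
        by (intro tendsto_intros)
      then show "(\<lambda>n. norm (F x - F (X n + x))) \<longlonglongrightarrow> 0" by simp
      fix n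
      show "norm (norm (F x - F (X n + x))) \<le> 2 * B * indicat_real (cball 0 (R + M)) x"
      proof (cases "norm x \<le> R + M")
        case True
        then show ?thesis
          using B(1)[of x] B(1)[of "X n + x"] norm_triangle_ineq4[of "F x" "F (X n + x)"] by simp
      next
        case False
        then have "norm (X n + x) > R" using norm_triangle_ineq4[of "X n + x" "X n"] M[of n] by simp
        moreover have "norm x > R" using False M[of n] norm_ge_zero[of "X n"] by linarith
        ultimately show ?thesis using R B(2) by simp
      qed
    qed simp_all
  qed
  then have \<omega>: "(\<omega> \<longlongrightarrow> 0) (at 0)" by (simp add: tendsto_at_iff_sequentially o_def)
  have d: "filterlim d (at 0) at_infinity"
    unfolding filterlim_at
  proof
    have "((\<lambda>\<xi>::'a. pi * inverse (norm \<xi>)) \<longlongrightarrow> 0) at_infinity"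
      by (intro tendsto_mult_right_zero tendsto_inverse_0_at_top filterlim_norm_at_top)
    moreover have "norm (d \<xi>) = pi * inverse (norm \<xi>)" for \<xi>
      by (simp add: d_def power2_eq_square field_simps)
    ultimately show "(d \<longlongrightarrow> 0) at_infinity" by (subst tendsto_norm_zero_iff[symmetric]) simp
    show "\<forall>\<^sub>F \<xi> in at_infinity. d \<xi> \<in> UNIV \<and> d \<xi> \<noteq> 0"
      by (auto simp: eventually_at_infinity d_def intro!: exI[of _ 1])
  qed
  have "norm (fourier F \<xi>) \<le> \<omega> (d \<xi>)" if "\<xi> \<noteq> 0" for \<xi>
  proof -
    have cis: "cis (\<xi> \<bullet> (d \<xi> + x)) = - cis (\<xi> \<bullet> x)" for x
      using that by (simp add: d_def inner_add_right power2_norm_eq_inner flip: cis_mult)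
    have i: "integrable lborel (\<lambda>x. F x * cis (\<xi> \<bullet> x))" "integrable lborel (\<lambda>x. F (d \<xi> + x) * cis (\<xi> \<bullet> x))"
    proof -
      have "integrable lborel (\<lambda>x. F (d \<xi> + x))"
        using F by (subst (asm) lborel_distr_plus[of "d \<xi>", symmetric]) (simp add: integrable_distr_eq)
      with F show "integrable lborel (\<lambda>x. F x * cis (\<xi> \<bullet> x))" "integrable lborel (\<lambda>x. F (d \<xi> + x) * cis (\<xi> \<bullet> x))"
        by (auto intro!: integrable_mult_bounded[where C = 1])
    qed
    have "fourier F \<xi> = (\<integral>x. F (d \<xi> + x) * cis (\<xi> \<bullet> (d \<xi> + x)) \<partial>lborel)"
      unfolding fourier_def by (rule integral_lborel_translate[symmetric]) simp
    then have "2 * fourier F \<xi> = (\<integral>x. (F x - F (d \<xi> + x)) * cis (\<xi> \<bullet> x) \<partial>lborel)"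
      using i by (simp add: cis left_diff_distrib fourier_def)
    also have "norm \<dots> \<le> (\<integral>x. norm ((F x - F (d \<xi> + x)) * cis (\<xi> \<bullet> x)) \<partial>lborel)"
      by (rule integral_norm_bound)
    also have "\<dots> = \<omega> (d \<xi>)" by (simp add: \<omega>_def norm_mult)
    finally have "2 * norm (fourier F \<xi>) \<le> \<omega> (d \<xi>)" by (simp add: norm_mult)
    then show ?thesis using norm_ge_zero[of "fourier F \<xi>"] by linarith
  qed
  then have "\<forall>\<^sub>F \<xi> in at_infinity. norm (fourier F \<xi>) \<le> \<omega> (d \<xi>)"
    unfolding eventually_at_infinity by (metis norm_zero not_one_le_zero)
  then show ?thesis
    using filterlim_compose[OF \<omega> d] by (rule Lim_null_comparison)
qed

section \<open>Compactly supported bumps with integrable Fourier transform\<close>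

lemma integrable_lborel_product:
  fixes h :: "'a::euclidean_space \<Rightarrow> real \<Rightarrow> complex"
  assumes h: "\<And>b. b \<in> Basis \<Longrightarrow> integrable lborel (h b)"
  shows "integrable lborel (\<lambda>x::'a. \<Prod>b\<in>Basis. h b (x \<bullet> b))" (is ?int)
    and "(\<integral>x. (\<Prod>b\<in>Basis. h b (x \<bullet> b)) \<partial>(lborel::'a measure)) = (\<Prod>b\<in>Basis. \<integral>t. h b t \<partial>lborel)" (is ?eq)
proof -
  interpret product_sigma_finite "\<lambda>_. lborel :: real measure" by unfold_locales
  let ?M = "\<Pi>\<^sub>M b\<in>(Basis::'a set). (lborel :: real measure)"
  let ?e = "\<lambda>f. \<Sum>b\<in>Basis. f b *\<^sub>R b :: 'a"
  have lb: "(lborel :: 'a measure) = distr ?M borel ?e"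
    by (subst lborel_def) (simp add: lborel_eq_real)
  have [measurable]: "?e \<in> ?M \<rightarrow>\<^sub>M borel" by measurable
  have [measurable]: "h b \<in> borel_measurable borel" if "b \<in> Basis" for b using h[OF that] by simp
  have m: "(\<lambda>x::'a. \<Prod>b\<in>Basis. h b (x \<bullet> b)) \<in> borel_measurable borel"
    by (intro borel_measurable_prod) measurable
  have e: "(\<Prod>b\<in>Basis. h b (?e f \<bullet> b)) = (\<Prod>b\<in>Basis. h b (f b))" for f
    by (intro prod.cong) (simp_all add: inner_sum_left_Basis)
  show ?int
    unfolding lb using m h by (subst integrable_distr_eq) (auto simp: e intro!: product_integrable_prod)
  show ?eq
    unfolding lb using m h by (subst integral_distr) (auto simp: e intro!: product_integral_prod)
qed

text \<open>Triangles are chosen because their transform, the Fejer kernel, has a closed form and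
  decays like x^-2. This yields an integrable function whose spectrum lies in a prescribed small
  cube.\<close>

definition tent :: "real \<Rightarrow> real \<Rightarrow> real" where
  "tent d t = max 0 (d - \<bar>t\<bar>)"

lemma continuous_tent [continuous_intros]:
  "continuous_on S f \<Longrightarrow> continuous_on S (\<lambda>x. tent d (f x))"
  unfolding tent_def by (intro continuous_intros)

lemma tent_measurable [measurable]: "tent d \<in> borel_measurable borel"
  unfolding tent_def[abs_def] by measurable

definition fejer :: "real \<Rightarrow> real \<Rightarrow> complex" where
  "fejer d x = (\<integral>t. complex_of_real (tent d t) * cis (x * t) \<partial>lborel)"

lemma integrable_tent: "integrable lborel (\<lambda>t. complex_of_real (tent d t))"
  by (rule integrable_compact_support[of _ "cball 0 \<bar>d\<bar>"]) (auto intro!: continuous_intros simp: tent_def)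

lemma integrable_tent_cis: "integrable lborel (\<lambda>t. complex_of_real (tent d t) * cis (x * t))"
  by (rule integrable_mult_bounded[OF integrable_tent, where C = 1]) simp_all

lemma fejer_eq:
  assumes x: "x \<noteq> 0" and d: "d > 0"
  shows "fejer d x = (2 - cis (d * x) - cis (- d * x)) / (complex_of_real x)\<^sup>2"
proof -
  let ?x = "complex_of_real x" and ?d = "complex_of_real d"
  \<comment> \<open>Antiderivative of \<open>(d - \<sigma> * t) * cis (x * t)\<close>, found by
    parts; \<sigma> = 1 and \<sigma> = - 1 serve the two halves of the tent.\<close>
  let ?G = "\<lambda>\<sigma> z. (?d - \<sigma> * z) * exp (\<i> * ?x * z) / (\<i> * ?x) - \<sigma> * exp (\<i> * ?x * z) / ?x\<^sup>2"
  have G: "((\<lambda>t. ?G \<sigma> (complex_of_real t)) has_vector_derivative (?d - \<sigma> * complex_of_real t) * cis (x * t)) (at t within S)"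
    for \<sigma> t S
  proof (rule has_vector_derivative_real_field)
    show "(?G \<sigma> has_field_derivative (?d - \<sigma> * complex_of_real t) * cis (x * t)) (at (complex_of_real t))"
      using x by (auto intro!: derivative_eq_intros simp: cis_conv_exp field_simps power2_eq_square)
  qed
  have c: "continuous_on S (\<lambda>t. (?d - \<sigma> * complex_of_real t) * cis (x * t))" for \<sigma> S
    by (intro continuous_intros)
  have eq1: "(\<integral>t. indicator {0..d} t *\<^sub>R ((?d - 1 * complex_of_real t) * cis (x * t)) \<partial>lborel) =
      ?G 1 (complex_of_real d) - ?G 1 (complex_of_real 0)"
    using d by (intro integral_FTC_Icc G c) simp
  have eq2: "(\<integral>t. indicator {-d..0} t *\<^sub>R ((?d - (-1) * complex_of_real t) * cis (x * t)) \<partial>lborel) =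
      ?G (-1) (complex_of_real 0) - ?G (-1) (complex_of_real (- d))"
    using d by (intro integral_FTC_Icc G c) simp
  have i: "integrable lborel (\<lambda>t. indicator {a..b} t *\<^sub>R ((?d - \<sigma> * complex_of_real t) * cis (x * t)))" for \<sigma> a b
    by (intro borel_integrable_compact c) auto
  have "fejer d x = (\<integral>t. indicator {0..d} t *\<^sub>R ((?d - 1 * complex_of_real t) * cis (x * t)) +
      indicator {-d..0} t *\<^sub>R ((?d - (-1) * complex_of_real t) * cis (x * t)) \<partial>lborel)"
    unfolding fejer_def
  proof (rule integral_cong_AE)
    \<comment> \<open>At t = 0 both indicators are 1, so the decomposition holds only off that
      point.\<close>
    show "AE t in lborel. complex_of_real (tent d t) * cis (x * t) =
      indicator {0..d} t *\<^sub>R ((?d - 1 * complex_of_real t) * cis (x * t)) +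
      indicator {-d..0} t *\<^sub>R ((?d - (-1) * complex_of_real t) * cis (x * t))"
      using AE_lborel_singleton[of "0::real"]
    proof eventually_elim
      case (elim t)
      then show ?case by (cases "t > 0") (auto simp: tent_def indicator_def max_def)
    qed
  qed measurable
  also have "\<dots> = ?G 1 (complex_of_real d) - ?G 1 (complex_of_real 0) +
      (?G (-1) (complex_of_real 0) - ?G (-1) (complex_of_real (- d)))"
    by (subst Bochner_Integration.integral_add[OF i i]) (simp only: eq1 eq2)
  also have "\<dots> = (2 - cis (d * x) - cis (- d * x)) / ?x\<^sup>2"
    using x by (simp add: cis_conv_exp field_simps)
  finally show ?thesis .
qed

lemma integrable_fejer:
  assumes d: "d > 0" shows "integrable lborel (fejer d)"
proof (rule Bochner_Integration.integrable_bound)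
  have [measurable]: "fejer d \<in> borel_measurable borel"
    unfolding fejer_def[abs_def] by measurable
  show "fejer d \<in> borel_measurable lborel" by simp
  \<comment> \<open>The constant bounds the kernel near 0 and 4 / x^2 bounds it far away; added up,
    they give one bound by a multiple of 1 / (1 + x^2).\<close>
  let ?C = "(\<integral>t. norm (complex_of_real (tent d t)) \<partial>lborel)"
  show "integrable lborel (\<lambda>x. (?C + 4) * inverse (1 + x\<^sup>2))"
    using integrable_inverse_1_plus_square by (simp add: set_integrable_def)
  show "AE x in lborel. norm (fejer d x) \<le> norm ((?C + 4) * inverse (1 + x\<^sup>2))"
    using AE_lborel_singleton[of "0::real"]
  proof eventually_elim
    case (elim x)
    have "norm (fejer d x) \<le> (\<integral>t. norm (complex_of_real (tent d t) * cis (x * t)) \<partial>lborel)"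
      unfolding fejer_def by (rule integral_norm_bound)
    then have 1: "norm (fejer d x) \<le> ?C" by (simp add: norm_mult)
    have "norm (2 - cis (d * x) - cis (- d * x)) \<le> 2 + 1 + 1"
      by (intro order_trans[OF norm_triangle_ineq4] add_mono) simp_all
    then have 2: "x\<^sup>2 * norm (fejer d x) \<le> 4"
      using elim d by (simp add: fejer_eq norm_divide norm_power)
    have "(1 + x\<^sup>2) * norm (fejer d x) \<le> ?C + 4" using 1 2 by (simp add: distrib_right)
    moreover have "1 + x\<^sup>2 > 0" by (smt (verit) zero_le_power2)
    ultimately have "norm (fejer d x) \<le> (?C + 4) * inverse (1 + x\<^sup>2)"
      by (simp add: field_simps)
    then show ?case by (simp add: order_trans[OF _ abs_ge_self])
  qed
qed


definition bump :: "real \<Rightarrow> 'a::euclidean_space \<Rightarrow> 'a \<Rightarrow> real" where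
  "bump d \<mu> \<xi> = (\<Prod>b\<in>Basis. tent d (\<xi> \<bullet> b - \<mu> \<bullet> b))"

lemma bump_eq_0: "b \<in> Basis \<Longrightarrow> d \<le> \<bar>\<xi> \<bullet> b - \<mu> \<bullet> b\<bar> \<Longrightarrow> bump d \<mu> \<xi> = 0"
  unfolding bump_def by (intro prod_zero bexI[of _ b]) (auto simp: tent_def)

lemma continuous_bump: "continuous_on S (bump d \<mu>)"
  unfolding bump_def[abs_def] by (intro continuous_intros)

lemma fourier_bump:
  "fourier (\<lambda>\<xi>. complex_of_real (bump d \<mu> \<xi>)) g = (\<Prod>b\<in>Basis. cis ((g \<bullet> b) * (\<mu> \<bullet> b)) * fejer d (g \<bullet> b))"
proof -
  let ?h = "\<lambda>b t. complex_of_real (tent d (t - \<mu> \<bullet> b)) * cis ((g \<bullet> b) * t)"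
  have eq: "?h b (\<mu> \<bullet> b + t) = cis ((g \<bullet> b) * (\<mu> \<bullet> b)) * (complex_of_real (tent d t) * cis ((g \<bullet> b) * t))" for b t
    by (simp add: distrib_left mult_ac flip: cis_mult)
  have int: "integrable lborel (?h b)" for b
  proof -
    have "integrable lborel (\<lambda>t. ?h b (\<mu> \<bullet> b + t))"
      unfolding eq by (intro integrable_mult_right integrable_tent_cis)
    then have "integrable (distr lborel borel ((+) (\<mu> \<bullet> b))) (?h b)"
      by (subst integrable_distr_eq) simp_all
    then show ?thesis by (simp only: lborel_distr_plus)
  qed
  have "(\<integral>t. ?h b t \<partial>lborel) = cis ((g \<bullet> b) * (\<mu> \<bullet> b)) * fejer d (g \<bullet> b)" for b
    by (subst integral_lborel_translate[where a = "\<mu> \<bullet> b", symmetric])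
      (simp_all only: eq fejer_def integral_mult_right_zero, simp_all)
  moreover have "complex_of_real (bump d \<mu> \<xi>) * cis (g \<bullet> \<xi>) = (\<Prod>b\<in>Basis. ?h b (\<xi> \<bullet> b))" for \<xi>
  proof -
    have "cis (sum u B) = (\<Prod>b\<in>B. cis (u b))" if "finite B" for u :: "'a \<Rightarrow> real" and B
      using that by induction (simp_all flip: cis_mult)
    then have "cis (g \<bullet> \<xi>) = (\<Prod>b\<in>Basis. cis ((g \<bullet> b) * (\<xi> \<bullet> b)))"
      by (simp add: euclidean_inner[of g \<xi>])
    then show ?thesis by (simp add: bump_def prod.distrib)
  qed
  ultimately show ?thesis
    unfolding fourier_def using integrable_lborel_product(2)[of ?h, OF int] by simp
qed

lemma integrable_fourier_bump:
  assumes "d > 0"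
  shows "integrable lborel (fourier (\<lambda>\<xi>::'a::euclidean_space. complex_of_real (bump d \<mu> \<xi>)))"
proof -
  have "integrable lborel (\<lambda>x. cis (x * m) * fejer d x)" for m
    using integrable_mult_bounded[OF integrable_fejer[OF assms], of "\<lambda>x. cis (x * m)" 1]
    by (simp add: mult.commute)
  then have "integrable lborel (\<lambda>g::'a. \<Prod>b\<in>Basis. cis ((g \<bullet> b) * (\<mu> \<bullet> b)) * fejer d (g \<bullet> b))"
    by (intro integrable_lborel_product(1))
  then show ?thesis by (simp add: fourier_bump[abs_def])
qed

text \<open>At coordinates \<pi> / d both exponentials in the closed form of the Fejer kernel equal
  - 1, so every factor has numerator 4.\<close>

lemma fourier_bump_nonzero:
  assumes "d > 0"
  shows "fourier (\<lambda>\<xi>. complex_of_real (bump d \<mu> \<xi>)) (\<Sum>b\<in>Basis. (pi / d) *\<^sub>R b) \<noteq> 0"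
proof -
  have "cis (- pi) = - 1" by (simp add: complex_eq_iff)
  then show ?thesis using assms by (simp add: fourier_bump inner_sum_left_Basis fejer_eq)
qed

section \<open>Failure of injectivity\<close>

lemma subspace_center: "H_type br \<Longrightarrow> subspace (center br)"
  using H_type_bilinear[of br]
  by (auto simp: subspace_def center_def bilinear_ladd bilinear_lmul bilinear_lzero)

lemma br_in_center: "H_type br \<Longrightarrow> br x y \<in> center br"
  using br_skew[of br "br x y"] by (auto simp: center_def H_type_def)

lemma hor_center_inner: "V \<in> hor br \<Longrightarrow> u \<in> center br \<Longrightarrow> V \<bullet> u = 0"
  by (auto simp: hor_def orthogonal_comp_def orthogonal_def inner_commute)

lemma linear_br:
  assumes "H_type br" shows "linear (br x)" "linear (\<lambda>x. br x y)"
  using H_type_bilinear[OF assms] by (auto simp: bilinear_def)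

lemma gmul_add_center:
  assumes "H_type br" "u \<in> center br"
  shows "gmul br g (h + u) = gmul br g h + u" "gmul br (g + u) h = gmul br g h + u"
  using br_center_right[OF assms] br_center_left[OF assms(2)]
  by (simp_all add: gmul_def linear_add[OF linear_br(1)[OF assms(1)]] linear_add[OF linear_br(2)[OF assms(1)]])

section \<open>Coordinates along a single geodesic\<close>

locale charged_geodesic =
  fixes br :: "'g::euclidean_space \<Rightarrow> 'g \<Rightarrow> 'g" and lam \<nu> :: 'g
  assumes H: "H_type br" and lam: "lam \<in> center br" "lam \<noteq> 0"
    and \<nu>: "\<nu> \<in> hor br" "norm \<nu> = 1"
begin

abbreviation "c \<equiv> norm lam"

abbreviation "\<omega> \<equiv> sgn lam"

abbreviation "\<gamma> \<equiv> geodesic br \<nu> lam"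

text \<open>Normalised so that \<open>J br lam e1 = c *\<^sub>R \<nu>\<close> and J maps \<nu> to -
  c e1: then e1 / c is the preimage of \<nu> that occurs in the geodesic, and e1 is again a unit
  vector.\<close>

definition e1 :: 'g where "e1 = (- 1 / c) *\<^sub>R J br lam \<nu>"

definition circ :: "real \<Rightarrow> 'g" where "circ \<theta> = (1 / c) *\<^sub>R (cos \<theta> *\<^sub>R e1 + sin \<theta> *\<^sub>R \<nu>)"

lemma c_pos: "c > 0" using lam by simp

lemma \<omega>_center: "a *\<^sub>R \<omega> \<in> center br"
  using lam H by (simp add: sgn_div_norm center_scale)

lemma \<omega>_inner [simp]: "\<omega> \<bullet> \<omega> = 1"
  using lam by (simp add: sgn_div_norm power2_eq_square flip: power2_norm_eq_inner)

lemma inner_\<omega>: "x \<bullet> \<omega> = x \<bullet> lam / c"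
  by (simp add: sgn_div_norm divide_inverse)

lemma e1_hor: "e1 \<in> hor br"
  unfolding e1_def by (intro subspace_scale hor_subspace J_hor H)

lemma circ_hor: "circ \<theta> \<in> hor br"
  unfolding circ_def by (intro subspace_scale subspace_add hor_subspace e1_hor \<nu>)

lemma J_e1: "J br lam e1 = c *\<^sub>R \<nu>"
  using J_linear[OF H, of lam "- 1 / c" "J br lam \<nu>" 0 0] H lam \<nu> c_pos
  by (simp add: e1_def H_type_def power2_eq_square)

lemma geodesic_eq: "\<gamma> s = circ (s * c) + (s / (2 * c)) *\<^sub>R \<omega>"
proof -
  let ?x = "inv_into (hor br) (J br lam) \<nu>"
  have x: "?x \<in> hor br" by (rule inv_J_hor[OF H lam \<nu>(1)])
  have "J br lam ((1 / c) *\<^sub>R e1) = \<nu>"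
    using J_linear[OF H, of lam "1 / c" e1 0 0] J_e1 c_pos by simp
  moreover have "(1 / c) *\<^sub>R e1 \<in> hor br" by (intro subspace_scale hor_subspace e1_hor)
  ultimately have "\<nu> \<in> J br lam ` hor br" by (metis imageI)
  then have Jx: "J br lam ?x = \<nu>" by (rule f_inv_into_f)
  have "J br lam (J br lam ?x) = - c\<^sup>2 *\<^sub>R ?x" using H x lam by (simp add: H_type_def)
  then have "?x = (1 / c) *\<^sub>R e1" using c_pos by (simp add: Jx e1_def power2_eq_square)
  then show ?thesis
    unfolding geodesic_def op_exp_J[OF H lam x] Jx by (simp add: circ_def scaleR_add_right)
qed

lemma continuous_circ: "continuous_on S circ"
  unfolding circ_def[abs_def] by (intro continuous_intros)

lemma continuous_\<gamma>: "continuous_on S \<gamma>"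
proof -
  have "continuous_on S (\<lambda>s. circ (s * c) + (s / (2 * c)) *\<^sub>R \<omega>)"
    using c_pos by (intro continuous_intros continuous_on_compose2[OF continuous_circ[of UNIV]]) auto
  then show ?thesis by (simp add: geodesic_eq[abs_def])
qed

lemma continuous_gmul_right: "continuous_on S (gmul br g)"
  unfolding gmul_def[abs_def] using linear_br(1)[OF H, of g]
  by (intro continuous_intros linear_continuous_on) (simp add: linear_conv_bounded_linear)

lemma gmul_\<gamma>_shift: "gmul br g (\<gamma> (s + 2 * pi / c)) = gmul br g (\<gamma> s) + (pi / c\<^sup>2) *\<^sub>R \<omega>"
  using geodesic_shift[OF H lam \<nu>(1), of s 1] gmul_add_center(1)[OF H \<omega>_center] by simp

text \<open>The component along \<omega> is s / (2 c) plus a term bounded in s. The curve thus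
  leaves every bounded set, which makes decay of a function at infinity usable along it.\<close>

lemma norm_gmul_\<gamma>_lower: "\<exists>C. \<forall>s. norm (gmul br g (\<gamma> s)) \<ge> \<bar>s\<bar> / (2 * c) - C"
proof -
  let ?u = "\<lambda>\<theta>. g \<bullet> \<omega> + (cos \<theta> * (br g e1 \<bullet> \<omega>) + sin \<theta> * (br g \<nu> \<bullet> \<omega>)) / (2 * c)"
  let ?C = "\<bar>g \<bullet> \<omega>\<bar> + (\<bar>br g e1 \<bullet> \<omega>\<bar> + \<bar>br g \<nu> \<bullet> \<omega>\<bar>) / (2 * c)"
  note lin = linear_br(1)[OF H, of g]
  have circ0: "circ \<theta> \<bullet> \<omega> = 0" for \<theta>
    using hor_center_inner[OF circ_hor \<omega>_center[of 1]] by simp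
  have u: "gmul br g (\<gamma> s) \<bullet> \<omega> = ?u (s * c) + s / (2 * c)" for s
    unfolding geodesic_eq gmul_add_center(1)[OF H \<omega>_center]
    by (simp add: gmul_def inner_add_left circ0)
      (simp add: circ_def linear_add[OF lin] linear_scale[OF lin] inner_add_left add_divide_distrib)
  have ub: "\<bar>?u \<theta>\<bar> \<le> ?C" for \<theta>
  proof -
    have "\<bar>cos \<theta> * a + sin \<theta> * b\<bar> \<le> \<bar>a\<bar> + \<bar>b\<bar>" for a b
      by (intro order_trans[OF abs_triangle_ineq] add_mono) (simp_all add: abs_mult mult_left_le_one_le)
    then have "\<bar>(cos \<theta> * (br g e1 \<bullet> \<omega>) + sin \<theta> * (br g \<nu> \<bullet> \<omega>)) / (2 * c)\<bar> \<le> (\<bar>br g e1 \<bullet> \<omega>\<bar> + \<bar>br g \<nu> \<bullet> \<omega>\<bar>) / (2 * c)"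
      using c_pos by (simp add: abs_divide divide_right_mono)
    then show ?thesis by linarith
  qed
  have "norm (gmul br g (\<gamma> s)) \<ge> \<bar>s\<bar> / (2 * c) - ?C" for s
  proof -
    have "\<bar>gmul br g (\<gamma> s) \<bullet> \<omega>\<bar> \<le> norm (gmul br g (\<gamma> s)) * norm \<omega>" by (rule Cauchy_Schwarz_ineq2)
    moreover have "norm \<omega> = 1" using lam by (simp add: norm_sgn)
    moreover have "\<bar>s / (2 * c)\<bar> = \<bar>s\<bar> / (2 * c)" using c_pos by (simp add: abs_divide)
    ultimately show ?thesis using ub[of "s * c"] u[of s] by (simp only: mult_1_right) linarith
  qed
  then show ?thesis by blast
qed

lemma gmul_\<gamma>_at_infinity:
  "filterlim (\<lambda>s. gmul br g (\<gamma> s)) at_infinity at_top"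
  "filterlim (\<lambda>s. gmul br g (\<gamma> s)) at_infinity at_bot"
proof -
  obtain C where C: "\<And>s. norm (gmul br g (\<gamma> s)) \<ge> \<bar>s\<bar> / (2 * c) - C" using norm_gmul_\<gamma>_lower by blast
  have "filterlim (\<lambda>s. norm (gmul br g (\<gamma> s))) at_top F" if "filterlim (\<lambda>s::real. \<bar>s\<bar>) at_top F" for F
  proof (rule filterlim_at_top_mono)
    have "filterlim (\<lambda>s. - C + 1 / (2 * c) * \<bar>s\<bar>) at_top F"
      using c_pos by (intro filterlim_tendsto_add_at_top[OF tendsto_const]
          filterlim_tendsto_pos_mult_at_top[OF tendsto_const _ that]) simp
    then show "filterlim (\<lambda>s. \<bar>s\<bar> / (2 * c) - C) at_top F" by (simp add: add.commute)
    show "\<forall>\<^sub>F s in F. \<bar>s\<bar> / (2 * c) - C \<le> norm (gmul br g (\<gamma> s))" using C by simp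
  qed
  then show "filterlim (\<lambda>s. gmul br g (\<gamma> s)) at_infinity at_top" "filterlim (\<lambda>s. gmul br g (\<gamma> s)) at_infinity at_bot"
    using filterlim_abs_real filterlim_at_infinity_imp_norm_at_top[OF filterlim_at_bot_imp_at_infinity[OF filterlim_ident]]
    by (auto intro!: filterlim_norm_at_top_imp_at_infinity simp: real_norm_def)
qed

lemma xray_difference_eq_0:
  assumes cont: "continuous_on UNIV h" and h: "(h \<longlongrightarrow> 0) at_infinity"
    and f: "\<And>g. f g = h (g + (pi / c\<^sup>2) *\<^sub>R \<omega>) - h g"
  shows "xray br \<nu> lam f (lcoset br lam g) = 0"
proof -
  have "(\<integral>s. h (gmul br g (\<gamma> (s + 2 * pi / c))) - h (gmul br g (\<gamma> s)) \<partial>lborel) = 0"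
    using c_pos by (intro integral_shift_difference_eq_0 filterlim_compose[OF h] gmul_\<gamma>_at_infinity
        continuous_on_compose2[OF cont continuous_on_compose2[OF continuous_gmul_right[of UNIV] continuous_\<gamma>]]) auto
  then show ?thesis
    by (simp add: xray_lcoset[OF H lam \<nu>(1)] f gmul_\<gamma>_shift)
qed

end

lemma not_injectivity_set_if_not_dense:
  assumes H: "H_type br" and Z: "Z \<subseteq> center br - {0}"
    and \<mu>: "\<mu> \<in> center br" "\<mu> \<notin> closure (\<Union>lam\<in>Z. visible br lam)"
  shows "\<not> injectivity_set br Z"
proof -
  obtain e where e: "e > 0" "\<And>lam x. lam \<in> Z \<Longrightarrow> x \<in> visible br lam \<Longrightarrow> dist x \<mu> \<ge> e"
    using \<mu>(2) unfolding closure_approachable by (auto simp: not_less)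
  \<comment> \<open>A cube of half-side d has l^1 radius DIM * d = e / 2, hence lies in the ball of
    radius e about \<mu>.\<close>
  define d where "d = e / (2 * real DIM('a))"
  have d: "d > 0" using e by (simp add: d_def)
  define \<psi> where "\<psi> = (\<lambda>\<xi>. complex_of_real (bump d \<mu> \<xi>))"
  define f where "f = fourier \<psi>"
  have fint: "integrable lborel f" unfolding f_def \<psi>_def by (rule integrable_fourier_bump[OF d])
  \<comment> \<open>The spectrum of an integrable function on G cannot be confined to the center, so
    K is a cube in all directions, and visibility is tested on the projection P to the
    center.\<close>
  define K where "K = cbox (\<Sum>b\<in>Basis. (\<mu> \<bullet> b - d) *\<^sub>R b) (\<Sum>b\<in>Basis. (\<mu> \<bullet> b + d) *\<^sub>R b)"
  have K: "x \<in> K \<longleftrightarrow> (\<forall>b\<in>Basis. \<bar>x \<bullet> b - \<mu> \<bullet> b\<bar> \<le> d)" for x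
    by (force simp: K_def mem_box inner_sum_left_Basis abs_le_iff)
  have \<psi>K: "\<psi> x = 0" if "x \<notin> K" for x
    using that by (auto simp: K \<psi>_def not_le intro!: bump_eq_0)
  have c\<psi>: "continuous_on UNIV \<psi>" unfolding \<psi>_def by (intro continuous_intros continuous_bump)
  have i\<psi>: "integrable lborel \<psi>"
    by (rule integrable_compact_support[of _ K]) (auto intro!: c\<psi> \<psi>K simp: K_def)
  have dist_K: "norm (x - \<mu>) < e" if "x \<in> K" for x
  proof -
    have "norm (x - \<mu>) \<le> (\<Sum>b\<in>Basis. \<bar>(x - \<mu>) \<bullet> b\<bar>)" by (rule norm_le_l1)
    also have "\<dots> \<le> (\<Sum>b\<in>(Basis :: 'a set). d)"
      using that by (intro sum_mono) (auto simp: K inner_diff_left)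
    also have "\<dots> < e" using e by (simp add: d_def)
    finally show ?thesis .
  qed
  obtain P where P: "linear P" "\<And>x. P x \<in> center br" "\<And>x y. y \<in> center br \<Longrightarrow> (x - P x) \<bullet> y = 0"
    "\<And>x. x \<in> center br \<Longrightarrow> P x = x"
    using linear_orthogonal_projection[OF subspace_center[OF H]] by metis
  have Pnorm: "norm (P x) \<le> norm x" for x
  proof -
    have "P x \<bullet> P x = x \<bullet> P x" using P(3)[OF P(2), of x x] by (simp add: inner_diff_left)
    also have "\<dots> \<le> norm x * norm (P x)" by (rule norm_cauchy_schwarz)
    finally have "norm (P x) * norm (P x) \<le> norm x * norm (P x)"
      by (simp add: power2_norm_eq_inner[symmetric] power2_eq_square)
    then show ?thesis by (cases "P x = 0") auto
  qed
  have zs: "zero_set br f Z"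
    unfolding zero_set_def
  proof
    fix lam assume lamZ: "lam \<in> Z"
    then have lam: "lam \<in> center br" "lam \<noteq> 0" using Z by auto
    obtain v where v: "v \<in> hor br" "v \<noteq> 0"
      using H hor_subspace[of br] by (auto simp: H_type_def dest: subspace_0)
    define \<nu> where "\<nu> = sgn v"
    have \<nu>: "\<nu> \<in> hor br" "norm \<nu> = 1"
      using v hor_subspace[of br] by (auto simp: \<nu>_def sgn_div_norm norm_sgn intro: subspace_scale)
    interpret charged_geodesic br lam \<nu> by unfold_locales (fact H lam \<nu>)+
    let ?q = "\<lambda>\<xi>. cis ((pi / c\<^sup>2) * (\<xi> \<bullet> \<omega>)) - 1"
    \<comment> \<open>A zero of \<open>?q\<close> means that \<xi> \<bullet> lam is a multiple of 2
      c^3, so the projection of \<xi> is visible. Projecting does not increase the distance to the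
      central \<mu>, so a visible frequency would lie within e of \<mu>.\<close>
    have nz: "?q \<xi> \<noteq> 0" if "\<xi> \<in> K" for \<xi>
    proof
      assume "?q \<xi> = 0"
      then have "cos ((pi / c\<^sup>2) * (\<xi> \<bullet> \<omega>)) = 1" by (simp add: complex_eq_iff)
      then obtain n :: int where "(pi / c\<^sup>2) * (\<xi> \<bullet> \<omega>) = n * 2 * pi"
        by (auto simp: cos_one_2pi_int)
      then have "pi * (\<xi> \<bullet> lam) = pi * (2 * c ^ 3 * n)"
        using c_pos by (simp add: inner_\<omega> field_simps power2_eq_square power3_eq_cube)
      then have "\<xi> \<bullet> lam = 2 * c ^ 3 * n" by (simp only: mult_cancel_left pi_neq_zero simp_thms)
      then have "P \<xi> \<bullet> lam = 2 * c ^ 3 * n" using P(3)[OF lam(1), of \<xi>] by (simp add: inner_diff_left)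
      then have "P \<xi> \<in> visible br lam" using P(2) by (auto simp: visible_def)
      then have "e \<le> dist (P \<xi>) \<mu>" by (rule e(2)[OF lamZ])
      also have "\<dots> = norm (P (\<xi> - \<mu>))" by (simp add: dist_norm linear_diff[OF P(1)] P(4)[OF \<mu>(1)])
      also have "\<dots> \<le> norm (\<xi> - \<mu>)" by (rule Pnorm)
      also have "\<dots> < e" by (rule dist_K[OF that])
      finally show False by simp
    qed
    \<comment> \<open>On the Fourier side the shift by the generator of \<open>Gam lam\<close>
      multiplies by \<open>?q + 1\<close>; dividing by \<open>?q\<close> solves the difference
      equation.\<close>
    define F where "F \<xi> = \<psi> \<xi> / ?q \<xi>" for \<xi>
    have FK: "F \<xi> = 0" if "\<xi> \<notin> K" for \<xi> using \<psi>K[OF that] by (simp add: F_def)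
    have cq: "continuous_on UNIV ?q" by (intro continuous_intros)
    let ?U = "{\<xi>. ?q \<xi> \<noteq> 0}"
    have "open ?U"
      using cq by (intro open_Collect_neq) (auto intro: continuous_intros)
    moreover have "open (- K)" by (simp add: K_def open_Compl closed_cbox)
    moreover have "continuous_on ?U F"
      unfolding F_def by (intro continuous_intros continuous_on_subset[OF c\<psi>]) auto
    moreover have "continuous_on (- K) F"
      using FK by (subst continuous_on_cong[where g = "\<lambda>_. 0"]) auto
    ultimately have "continuous_on (?U \<union> - K) F" by (rule continuous_on_open_Un)
    moreover have "?U \<union> - K = UNIV" using nz by auto
    ultimately have cF: "continuous_on UNIV F" by simp
    have iF: "integrable lborel F"
      by (rule integrable_compact_support[of _ K]) (auto intro!: cF FK simp: K_def)
    obtain R where R: "\<And>x. x \<in> K \<Longrightarrow> norm x \<le> R"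
      using bounded_cbox[of "\<Sum>b\<in>Basis. (\<mu> \<bullet> b - d) *\<^sub>R b" "\<Sum>b\<in>Basis. (\<mu> \<bullet> b + d) *\<^sub>R b"]
      by (auto simp: bounded_iff K_def)
    have lim: "(fourier F \<longlongrightarrow> 0) at_infinity"
      by (rule riemann_lebesgue[OF cF, of R]) (use R FK in \<open>meson not_le\<close>)
    have diff: "f g = fourier F (g + (pi / c\<^sup>2) *\<^sub>R \<omega>) - fourier F g" for g
    proof -
      have i: "integrable lborel (\<lambda>\<xi>. F \<xi> * cis (a \<bullet> \<xi>))" for a
        by (rule integrable_mult_bounded[OF iF, where C = 1]) simp_all
      have "F \<xi> * cis ((g + (pi / c\<^sup>2) *\<^sub>R \<omega>) \<bullet> \<xi>) - F \<xi> * cis (g \<bullet> \<xi>) = \<psi> \<xi> * cis (g \<bullet> \<xi>)" for \<xi>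
      proof -
        have A: "\<psi> \<xi> = F \<xi> * ?q \<xi>" using nz[of \<xi>] \<psi>K[of \<xi>] by (auto simp: F_def)
        have E: "cis ((g + (pi / c\<^sup>2) *\<^sub>R \<omega>) \<bullet> \<xi>) = cis (g \<bullet> \<xi>) * cis ((pi / c\<^sup>2) * (\<xi> \<bullet> \<omega>))"
          by (simp add: inner_add_left inner_add_right inner_commute cis_mult)
        show ?thesis unfolding E A by (simp only: algebra_simps mult_1_left)
      qed
      then show ?thesis
        unfolding f_def fourier_def by (subst Bochner_Integration.integral_diff[OF i i, symmetric]) simp
    qed
    have "xray br \<nu> lam f q = 0" if "q \<in> space (quot_haar br lam)" for q
    proof -
      have "q \<in> range (lcoset br lam)"
        using that by (simp add: quot_haar_def space_measure_of_conv)
      then show ?thesis using xray_difference_eq_0[OF continuous_fourier[OF iF] lim diff] by auto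
    qed
    then have "AE q in quot_haar br lam. xray br \<nu> lam f q = 0" by (rule AE_I2)
    then show "\<exists>\<nu>\<in>hor br. norm \<nu> = 1 \<and> (AE q in quot_haar br lam. xray br \<nu> lam f q = 0)"
      using \<nu> by blast
  qed
  have "\<not> (AE x in lborel. f x = 0)"
  proof
    assume AE: "AE x in lborel. f x = 0"
    have "closed {x. f x = 0}"
      using continuous_fourier[OF i\<psi>] by (intro closed_Collect_eq) (auto simp: f_def intro: continuous_intros)
    moreover have "AE x in lebesgue. x \<in> {x. f x = 0}" using AE_completion[OF AE] by simp
    ultimately have "f x = 0" for x using mem_closed_if_AE_lebesgue by blast
    then show False using fourier_bump_nonzero[OF d, of \<mu>] by (simp add: f_def \<psi>_def)
  qed
  then show ?thesis using fint zs by (auto simp: injectivity_set_def)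
qed

section \<open>Duality with means over geodesic arcs\<close>

lemma nn_integral_int_translates:
  fixes a x :: real
  assumes a: "a > 0"
  shows "(\<integral>\<^sup>+j. indicator {0..<a} (x + real_of_int j * a) \<partial>count_space UNIV) = 1"
proof -
  have "0 \<le> x + real_of_int j * a \<and> x + real_of_int j * a < a \<longleftrightarrow> - j = \<lfloor>x / a\<rfloor>" for j
  proof -
    have "- j = \<lfloor>x / a\<rfloor> \<longleftrightarrow> real_of_int (- j) \<le> x / a \<and> x / a < real_of_int (- j) + 1"
      using floor_eq_iff[of "x / a" "- j"] by auto
    also have "\<dots> \<longleftrightarrow> 0 \<le> x + real_of_int j * a \<and> x + real_of_int j * a < a"
      using a by (auto simp: field_simps)
    finally show ?thesis by simp
  qed
  then have "indicator {0..<a} (x + real_of_int j * a) = (indicator {- \<lfloor>x / a\<rfloor>} j :: ennreal)" for j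
    by (auto simp: indicator_def)
  then show ?thesis by simp
qed

text \<open>Each \<open>\<Gamma>\<^sub>\<lambda>\<close>-orbit meets the slab \<open>0 \<le> t < \<tau>\<close> once; so integrating a periodic function over the
  part of a helix inside the slab amounts to integrating over one period.\<close>

lemma nn_integral_helical_tiling:
  fixes \<phi> :: "real \<Rightarrow> ennreal" and t :: "real \<Rightarrow> real"
  assumes T: "T > 0" and \<tau>: "\<tau> > 0"
    and [measurable]: "\<phi> \<in> borel_measurable borel" "t \<in> borel_measurable borel"
    and per: "\<And>s. \<phi> (s + T) = \<phi> s" and t: "\<And>s. t (s + T) = t s - \<tau>"
  shows "(\<integral>\<^sup>+s. indicator {0..<\<tau>} (t s) * \<phi> s \<partial>lborel) = (\<integral>\<^sup>+s. indicator {0..<T} s * \<phi> s \<partial>lborel)"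
proof -
  have shift: "\<phi> (s - real_of_int j * T) = \<phi> s \<and> t (s - real_of_int j * T) = t s + real_of_int j * \<tau>" for s j
  proof (induction j rule: int_induct[of _ 0])
    case (step1 j)
    have "s - real_of_int (j + 1) * T + T = s - real_of_int j * T" by (simp add: algebra_simps)
    then show ?case using step1 per[of "s - real_of_int (j + 1) * T"] t[of "s - real_of_int (j + 1) * T"]
      by (simp add: algebra_simps)
  next
    case (step2 j)
    have "s - real_of_int (j - 1) * T = s - real_of_int j * T + T" by (simp add: algebra_simps)
    then show ?case using step2 per[of "s - real_of_int j * T"] t[of "s - real_of_int j * T"]
      by (simp add: algebra_simps)
  qed simp
  let ?X = "\<lambda>s. indicator {0..<\<tau>} (t s) * \<phi> s"
  \<comment> \<open>Unfolding: the line is cut into translates of [0, T), each piece is moved back,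
    and the slab indicators summed over j are then a partition of unity.\<close>
  have "(\<integral>\<^sup>+s. ?X s \<partial>lborel) =
      (\<integral>\<^sup>+s. \<integral>\<^sup>+j. indicator {0..<T} (s + real_of_int j * T) * ?X s \<partial>count_space UNIV \<partial>lborel)"
    by (simp add: nn_integral_multc nn_integral_int_translates[OF T])
  also have "\<dots> = (\<integral>\<^sup>+j. \<integral>\<^sup>+s. indicator {0..<T} (s + real_of_int j * T) * ?X s \<partial>lborel \<partial>count_space UNIV)"
    by (rule nn_integral_count_space_nn_integral) auto
  also have "\<dots> = (\<integral>\<^sup>+j. \<integral>\<^sup>+s. indicator {0..<T} s * (indicator {0..<\<tau>} (t s + real_of_int j * \<tau>) * \<phi> s)
      \<partial>lborel \<partial>count_space UNIV)"
  proof (rule nn_integral_cong)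
    fix j :: int
    have "(\<integral>\<^sup>+s. indicator {0..<T} (s + real_of_int j * T) * ?X s \<partial>lborel) =
        (\<integral>\<^sup>+s. indicator {0..<T} (- (real_of_int j * T) + s + real_of_int j * T) * ?X (- (real_of_int j * T) + s) \<partial>lborel)"
      by (rule nn_integral_lborel_translate[symmetric]) simp
    also have "\<dots> = (\<integral>\<^sup>+s. indicator {0..<T} s * (indicator {0..<\<tau>} (t s + real_of_int j * \<tau>) * \<phi> s) \<partial>lborel)"
      using shift[of _ j] by (simp add: algebra_simps)
    finally show "(\<integral>\<^sup>+s. indicator {0..<T} (s + real_of_int j * T) * ?X s \<partial>lborel) =
        (\<integral>\<^sup>+s. indicator {0..<T} s * (indicator {0..<\<tau>} (t s + real_of_int j * \<tau>) * \<phi> s) \<partial>lborel)" .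
  qed
  also have "\<dots> = (\<integral>\<^sup>+s. \<integral>\<^sup>+j. indicator {0..<T} s * (indicator {0..<\<tau>} (t s + real_of_int j * \<tau>) * \<phi> s)
      \<partial>count_space UNIV \<partial>lborel)"
    by (rule nn_integral_count_space_nn_integral[symmetric]) auto
  also have "\<dots> = (\<integral>\<^sup>+s. indicator {0..<T} s * \<phi> s \<partial>lborel)"
    by (simp add: nn_integral_cmult nn_integral_multc nn_integral_int_translates[OF \<tau>])
  finally show ?thesis .
qed

text \<open>Reduction to nonnegative integrands: r folds the line onto one period, the two weighted
  measures have the same image under r, and \<phi> factors through r.\<close>

lemma integral_helical_tiling:
  fixes \<phi> :: "real \<Rightarrow> complex" and t :: "real \<Rightarrow> real"
  assumes T: "T > 0" and \<tau>: "\<tau> > 0"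
    and [measurable]: "\<phi> \<in> borel_measurable borel" "t \<in> borel_measurable borel"
    and per: "\<And>s. \<phi> (s + T) = \<phi> s" and t: "\<And>s. t (s + T) = t s - \<tau>"
  shows "(\<integral>s. indicator {0..<\<tau>} (t s) *\<^sub>R \<phi> s \<partial>lborel) = (\<integral>s. indicator {0..<T} s *\<^sub>R \<phi> s \<partial>lborel)"
proof -
  define r where "r s = s - T * real_of_int \<lfloor>s / T\<rfloor>" for s
  have [measurable]: "r \<in> borel_measurable borel" unfolding r_def[abs_def] by measurable
  have r_per: "r (s + T) = r s" for s using T by (simp add: r_def add_divide_distrib algebra_simps)
  have \<phi>_per: "\<phi> (s - T * real_of_int j) = \<phi> s" for s j
  proof (induction j rule: int_induct[of _ 0])
    case (step1 j)
    then show ?case using per[of "s - T * real_of_int (j + 1)"] by (simp add: algebra_simps)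
  next
    case (step2 j)
    then show ?case using per[of "s - T * real_of_int j"] by (simp add: algebra_simps)
  qed simp
  have \<phi>r: "\<phi> (r s) = \<phi> s" for s unfolding r_def by (rule \<phi>_per)
  let ?M = "\<lambda>S u. distr (density lborel (\<lambda>s. ennreal (indicator S (u s)))) borel r"
  have meas: "emeasure (?M S u) A = (\<integral>\<^sup>+s. indicator S (u s) * indicator A (r s) \<partial>lborel)"
    if [measurable]: "A \<in> sets borel" "S \<in> sets borel" "u \<in> borel_measurable borel" for A S :: "real set" and u
    by (subst nn_integral_indicator[symmetric])
      (simp_all add: nn_integral_distr nn_integral_density ennreal_indicator del: nn_integral_indicator)
  have eq: "?M {0..<\<tau>} t = ?M {0..<T} (\<lambda>s. s)"
  proof (rule measure_eqI)
    fix A assume "A \<in> sets (?M {0..<\<tau>} t)"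
    then have [measurable]: "A \<in> sets borel" by simp
    show "emeasure (?M {0..<\<tau>} t) A = emeasure (?M {0..<T} (\<lambda>s. s)) A"
      by (simp add: meas) (rule nn_integral_helical_tiling[OF T \<tau>]; simp add: r_per t)
  qed simp
  have I: "(\<integral>x. \<phi> x \<partial>?M S u) = (\<integral>s. indicator S (u s) *\<^sub>R \<phi> s \<partial>lborel)"
    if [measurable]: "S \<in> sets borel" "u \<in> borel_measurable borel" for S :: "real set" and u
    by (simp add: integral_distr integral_density \<phi>r)
  have "(\<integral>s. indicator {0..<\<tau>} (t s) *\<^sub>R \<phi> s \<partial>lborel) = (\<integral>x. \<phi> x \<partial>?M {0..<\<tau>} t)"
    by (rule I[symmetric]) simp_all
  also have "\<dots> = (\<integral>s. indicator {0..<T} s *\<^sub>R \<phi> s \<partial>lborel)"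
    unfolding eq by (rule I) simp_all
  finally show ?thesis .
qed

section \<open>Group structure and invariance of Lebesgue measure\<close>

lemma gmul_measurable:
  assumes "H_type br" and [measurable]: "f \<in> borel_measurable M" "g \<in> borel_measurable M"
  shows "(\<lambda>x. gmul br (f x) (g x)) \<in> borel_measurable M"
proof -
  have "bounded_bilinear br" using H_type_bilinear[OF assms(1)] by (simp add: bilinear_conv_bounded_bilinear)
  then have "continuous_on UNIV (\<lambda>x. br (fst x) (snd x))"
    by (intro bounded_bilinear.continuous_on[of br] continuous_on_fst continuous_on_snd continuous_on_id)
  then have "(\<lambda>x. br (f x) (g x)) \<in> borel_measurable M"
    by (rule borel_measurable_continuous_Pair[OF assms(2,3), of br])
  then show ?thesis unfolding gmul_def by measurable
qed

text \<open>Brackets are central and the center brackets to 0, so left and right translations are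
  Euclidean translations composed with shears along the center.\<close>

lemma distr_lborel_gmul:
  assumes "H_type br"
  shows "distr lborel borel (gmul br g) = lborel" "distr lborel borel (\<lambda>x. gmul br x g) = lborel"
proof -
  note lin = linear_br[OF assms]
  have "distr lborel borel (\<lambda>x. g + (x + (1/2) *\<^sub>R br g x)) = lborel"
    by (rule distr_lborel_shear[OF _ subspace_center[OF assms]])
      (auto intro!: linearI center_scale br_in_center assms
        simp: linear_add[OF lin(1)] linear_scale[OF lin(1)] scaleR_add_right br_center_right[OF assms])
  then show "distr lborel borel (gmul br g) = lborel" by (simp add: gmul_def[abs_def] add.assoc)
  have "distr lborel borel (\<lambda>x. g + (x + (1/2) *\<^sub>R br x g)) = lborel"
    by (rule distr_lborel_shear[OF _ subspace_center[OF assms]])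
      (auto intro!: linearI center_scale br_in_center assms
        simp: linear_add[OF lin(2)] linear_scale[OF lin(2)] scaleR_add_right br_center_left)
  then show "distr lborel borel (\<lambda>x. gmul br x g) = lborel" by (simp add: gmul_def[abs_def] add_ac)
qed

lemma gmul_assoc:
  assumes "H_type br" shows "gmul br (gmul br x y) z = gmul br x (gmul br y z)"
  using assms
  by (simp add: gmul_def linear_add[OF linear_br(1)] linear_add[OF linear_br(2)] linear_scale[OF linear_br(1)]
      linear_scale[OF linear_br(2)] br_center_left[OF br_in_center] br_center_right[OF _ br_in_center] scaleR_add_right algebra_simps)

lemma gmul_inverse:
  assumes "H_type br" shows "gmul br x (- x) = 0" "gmul br (- x) x = 0"
  using assms by (auto simp: gmul_def linear_neg[OF linear_br(1)] linear_neg[OF linear_br(2)] H_type_def lie_bracket_def)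

lemma gmul_cancel:
  assumes "H_type br"
  shows "gmul br (gmul br x y) (- y) = x" "gmul br (gmul br x (- y)) y = x" "gmul br (- x) (gmul br x y) = y"
proof -
  have z: "gmul br x 0 = x" "gmul br 0 x = x" for x
    by (simp_all add: gmul_def linear_0[OF linear_br(1)[OF assms]] linear_0[OF linear_br(2)[OF assms]])
  show "gmul br (gmul br x y) (- y) = x" "gmul br (gmul br x (- y)) y = x"
    by (simp_all add: gmul_assoc[OF assms] gmul_inverse[OF assms] z)
  show "gmul br (- x) (gmul br x y) = y"
    by (simp add: gmul_assoc[OF assms, symmetric] gmul_inverse[OF assms] z)
qed

context charged_geodesic
begin

text \<open>An unnormalised mean over one period of the inverse curve, \<open>- \<gamma> s\<close>
  being the group inverse of \<open>\<gamma> s\<close>. It is the adjoint of the X-ray transform,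
  applied to periodic functions.\<close>

definition geodesic_mean :: "('g \<Rightarrow> complex) \<Rightarrow> 'g \<Rightarrow> complex" where
  "geodesic_mean \<phi> g = (\<integral>s. indicator {0..<2 * pi / c} s *\<^sub>R \<phi> (gmul br g (- \<gamma> s)) \<partial>lborel)"

lemma \<gamma>_measurable [measurable]: "\<gamma> \<in> borel_measurable borel"
  by (intro borel_measurable_continuous_onI continuous_\<gamma>)

lemmas gmul_meas [measurable (raw)] = gmul_measurable[OF H]

lemma gmul_\<gamma>_inverse_shift: "gmul br g (- \<gamma> (s + 2 * pi / c)) = gmul br g (- \<gamma> s) - (pi / c\<^sup>2) *\<^sub>R \<omega>"
  using geodesic_shift[OF H lam \<nu>(1), of s 1] gmul_add_center(1)[OF H \<omega>_center[of "- (pi / c\<^sup>2)"]] by simp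

lemma orthogonal_geodesic_mean:
  assumes f: "integrable lborel f" and ae: "AE q in quot_haar br lam. xray br \<nu> lam f q = 0"
    and [measurable]: "\<phi> \<in> borel_measurable borel" and B: "\<And>g. cmod (\<phi> g) \<le> B"
    and per: "\<And>g. \<phi> (g + (pi / c\<^sup>2) *\<^sub>R \<omega>) = \<phi> g"
  shows "(\<integral>g. f g * geodesic_mean \<phi> g \<partial>lborel) = 0"
proof -
  have [measurable]: "f \<in> borel_measurable borel" using f by simp
  \<comment> \<open>Restriction to one fundamental slab turns the pairing with the X-ray transform
    on the quotient into an integral over G; by the tiling, integrating w along the inverse curve
    still gives the mean of \<phi>.\<close>
  define w where "w g = indicator {0..<pi / c\<^sup>2} (g \<bullet> \<omega>) *\<^sub>R \<phi> g" for g
  have [measurable]: "w \<in> borel_measurable borel" unfolding w_def[abs_def] by measurable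
  have pos: "2 * pi / c > 0" "pi / c\<^sup>2 > 0" using c_pos by simp_all
  \<comment> \<open>Each inverse curve spends total time 2 \<pi> / c in the slab; this supplies the
    absolute integrability that Fubini requires.\<close>
  have tile: "(\<integral>\<^sup>+s. indicator {0..<pi / c\<^sup>2} (gmul br g (- \<gamma> s) \<bullet> \<omega>) \<partial>lborel) = ennreal (2 * pi / c)" for g
  proof -
    have "(\<integral>\<^sup>+s. indicator {0..<pi / c\<^sup>2} (gmul br g (- \<gamma> s) \<bullet> \<omega>) * 1 \<partial>lborel) =
        (\<integral>\<^sup>+s. indicator {0..<2 * pi / c} s * 1 \<partial>lborel)"
      by (rule nn_integral_helical_tiling[OF pos]) (simp_all add: gmul_\<gamma>_inverse_shift inner_diff_left)
    then show ?thesis using pos by simp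
  qed
  have per': "\<phi> (g - (pi / c\<^sup>2) *\<^sub>R \<omega>) = \<phi> g" for g using per[of "g - (pi / c\<^sup>2) *\<^sub>R \<omega>"] by simp
  have mean: "(\<integral>s. w (gmul br g (- \<gamma> s)) \<partial>lborel) = geodesic_mean \<phi> g" for g
    unfolding w_def geodesic_mean_def
    by (rule integral_helical_tiling[OF pos]) (simp_all add: gmul_\<gamma>_inverse_shift inner_diff_left per')
  have w_le: "ennreal (cmod (w g)) \<le> ennreal B * indicator {0..<pi / c\<^sup>2} (g \<bullet> \<omega>)" for g
    using B[of g] by (auto simp: w_def indicator_def intro!: ennreal_leI)
  let ?X = "\<lambda>(g, s). f g * w (gmul br g (- \<gamma> s))" and ?Y = "\<lambda>(g, s). f (gmul br g (\<gamma> s)) * w g"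
  have subst_nn: "(\<integral>\<^sup>+g. K (gmul br g h) \<partial>lborel) = (\<integral>\<^sup>+g. K g \<partial>lborel)"
    if [measurable]: "K \<in> borel_measurable borel" for K :: "'g \<Rightarrow> ennreal" and h
    by (subst (2) distr_lborel_gmul(2)[OF H, of h, symmetric]) (simp add: nn_integral_distr)
  have subst_int: "(\<integral>g. K (gmul br g h) \<partial>lborel) = (\<integral>g. K g \<partial>lborel)"
    if [measurable]: "K \<in> borel_measurable borel" for K :: "'g \<Rightarrow> complex" and h
    by (subst (2) distr_lborel_gmul(2)[OF H, of h, symmetric]) (simp add: integral_distr)
  have X_fin: "(\<integral>\<^sup>+g. \<integral>\<^sup>+s. ennreal (cmod (?X (g, s))) \<partial>lborel \<partial>lborel) < \<infinity>"
  proof -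
    have "(\<integral>\<^sup>+g. \<integral>\<^sup>+s. ennreal (cmod (?X (g, s))) \<partial>lborel \<partial>lborel) \<le>
        (\<integral>\<^sup>+g. \<integral>\<^sup>+s. ennreal (cmod (f g)) * (ennreal B * indicator {0..<pi / c\<^sup>2} (gmul br g (- \<gamma> s) \<bullet> \<omega>)) \<partial>lborel \<partial>lborel)"
      using w_le by (intro nn_integral_mono) (simp add: norm_mult ennreal_mult mult_left_mono)
    also have "\<dots> = (\<integral>\<^sup>+g. ennreal (cmod (f g)) * (ennreal B * ennreal (2 * pi / c)) \<partial>lborel)"
      by (simp add: nn_integral_cmult tile)
    also have "\<dots> = (\<integral>\<^sup>+g. ennreal (cmod (f g)) \<partial>lborel) * (ennreal B * ennreal (2 * pi / c))"
      by (rule nn_integral_multc) simp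
    also have "\<dots> < \<infinity>"
      using f by (simp add: integrable_iff_bounded ennreal_mult_less_top)
    finally show ?thesis .
  qed
  have Y_eq: "(\<integral>\<^sup>+s. \<integral>\<^sup>+g. ennreal (cmod (?Y (g, s))) \<partial>lborel \<partial>lborel) = (\<integral>\<^sup>+s. \<integral>\<^sup>+g. ennreal (cmod (?X (g, s))) \<partial>lborel \<partial>lborel)"
  proof (rule nn_integral_cong)
    fix s
    show "(\<integral>\<^sup>+g. ennreal (cmod (?Y (g, s))) \<partial>lborel) = (\<integral>\<^sup>+g. ennreal (cmod (?X (g, s))) \<partial>lborel)"
      using subst_nn[of "\<lambda>g. ennreal (cmod (?X (g, s)))" "\<gamma> s"] by (simp add: gmul_cancel[OF H])
  qed
  have X_meas: "?X \<in> borel_measurable (lborel \<Otimes>\<^sub>M lborel)" and Y_meas: "?Y \<in> borel_measurable (lborel \<Otimes>\<^sub>M lborel)"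
    by measurable
  have fin_imp_int: "integrable (lborel \<Otimes>\<^sub>M lborel) F"
    if m [measurable]: "F \<in> borel_measurable (lborel \<Otimes>\<^sub>M lborel)"
      and fin: "(\<integral>\<^sup>+g. \<integral>\<^sup>+s. ennreal (cmod (F (g, s))) \<partial>lborel \<partial>lborel) < \<infinity>" for F :: "'g \<times> real \<Rightarrow> complex"
  proof -
    have "(\<integral>\<^sup>+g. \<integral>\<^sup>+s. ennreal (cmod (F (g, s))) \<partial>lborel \<partial>lborel) = (\<integral>\<^sup>+p. ennreal (cmod (F p)) \<partial>(lborel \<Otimes>\<^sub>M lborel))"
      by (rule lborel.nn_integral_fst) measurable
    then show ?thesis using m fin by (simp add: integrable_iff_bounded)
  qed
  have swap: "(\<integral>\<^sup>+s. \<integral>\<^sup>+g. ennreal (cmod (F (g, s))) \<partial>lborel \<partial>lborel) = (\<integral>\<^sup>+g. \<integral>\<^sup>+s. ennreal (cmod (F (g, s))) \<partial>lborel \<partial>lborel)"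
    if [measurable]: "F \<in> borel_measurable (lborel \<Otimes>\<^sub>M lborel)" for F :: "'g \<times> real \<Rightarrow> complex"
    by (rule lborel_pair.Fubini') measurable
  have X_int: "integrable (lborel \<Otimes>\<^sub>M lborel) ?X"
    by (rule fin_imp_int[OF X_meas X_fin])
  have Y_int: "integrable (lborel \<Otimes>\<^sub>M lborel) ?Y"
    by (rule fin_imp_int[OF Y_meas]) (use X_fin Y_eq swap[OF X_meas] swap[OF Y_meas] in argo)
  have "(\<integral>g. f g * geodesic_mean \<phi> g \<partial>lborel) = (\<integral>g. \<integral>s. ?X (g, s) \<partial>lborel \<partial>lborel)"
    by (simp add: mean)
  also have "\<dots> = (\<integral>s. \<integral>g. ?X (g, s) \<partial>lborel \<partial>lborel)"
    using lborel_pair.Fubini_integral[OF X_int] by (simp only: prod.case)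
  also have "\<dots> = (\<integral>s. \<integral>g. ?Y (g, s) \<partial>lborel \<partial>lborel)"
  proof (rule Bochner_Integration.integral_cong)
    fix s
    show "(\<integral>g. ?X (g, s) \<partial>lborel) = (\<integral>g. ?Y (g, s) \<partial>lborel)"
      using subst_int[of "\<lambda>g. ?X (g, s)" "\<gamma> s"] by (simp add: gmul_cancel[OF H])
  qed simp
  also have "\<dots> = (\<integral>g. \<integral>s. ?Y (g, s) \<partial>lborel \<partial>lborel)"
    using lborel_pair.Fubini_integral[OF Y_int] by (simp only: prod.case)
  also have "\<dots> = (\<integral>g. 0 \<partial>(lborel :: 'g measure))"
  proof (rule integral_cong_AE)
    \<comment> \<open>On the fundamental domain the integral over s is the X-ray transform; outside
      it w vanishes.\<close>
    have "AE g in restrict_space lborel (fund_dom lam). xray br \<nu> lam f (lcoset br lam g) = 0"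
      using AE_distrD[OF lcoset_measurable ae[unfolded quot_haar_def]] .
    then have "AE g in lborel. g \<in> fund_dom lam \<longrightarrow> (\<integral>s. f (gmul br g (\<gamma> s)) \<partial>lborel) = 0"
      by (subst (asm) AE_restrict_space_iff) (simp_all add: xray_lcoset[OF H lam \<nu>(1)] fund_dom_def)
    then show "AE g in lborel. (\<integral>s. ?Y (g, s) \<partial>lborel) = 0"
      by eventually_elim (auto simp: w_def indicator_def fund_dom_def)
  qed simp_all
  finally show ?thesis by simp
qed

end

section \<open>Frequencies orthogonal to the charge\<close>

text \<open>By Fubini the pairs (t, x) with t x in N form a null set, so for almost every t the
  dilate of N by 1 / t is null. One such t suffices, by scaling.\<close>

lemma null_set_if_countable_on_rays:
  fixes N :: "'a::euclidean_space set"
  assumes N: "N \<in> sets borel" and count: "\<And>x. countable {t::real. t *\<^sub>R x \<in> N}"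
  shows "N \<in> null_sets lborel"
proof -
  note [measurable] = N
  \<comment> \<open>The interval keeps t away from 0, where dilation degenerates.\<close>
  let ?I = "{1..2::real}"
  have "(\<integral>\<^sup>+t. indicator ?I t * (\<integral>\<^sup>+x. indicator N (t *\<^sub>R x) \<partial>(lborel::'a measure)) \<partial>lborel) =
      (\<integral>\<^sup>+t. \<integral>\<^sup>+x. indicator ?I t * indicator N (t *\<^sub>R x) \<partial>(lborel::'a measure) \<partial>lborel)"
    by (simp add: nn_integral_cmult)
  also have "\<dots> = (\<integral>\<^sup>+x. \<integral>\<^sup>+t. indicator ?I t * indicator N (t *\<^sub>R x) \<partial>lborel \<partial>lborel)"
    by (rule lborel_pair.Fubini') measurable
  also have "\<dots> = (\<integral>\<^sup>+x. 0 \<partial>(lborel::'a measure))"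
  proof (rule nn_integral_cong)
    fix x :: 'a
    let ?C = "{t::real. t *\<^sub>R x \<in> N}"
    have "(\<integral>\<^sup>+t. indicator ?I t * indicator N (t *\<^sub>R x) \<partial>lborel) \<le> (\<integral>\<^sup>+t. indicator ?C t \<partial>lborel)"
      by (intro nn_integral_mono) (auto simp: indicator_def)
    also have "\<dots> = 0"
      using countable_imp_null_set_lborel[OF count[of x]] by (subst nn_integral_indicator) auto
    finally show "(\<integral>\<^sup>+t. indicator ?I t * indicator N (t *\<^sub>R x) \<partial>lborel) = 0" by simp
  qed
  also have "\<dots> = 0" by simp
  finally have ae: "AE t in lborel. indicator ?I t * (\<integral>\<^sup>+x. indicator N (t *\<^sub>R x) \<partial>(lborel::'a measure)) = 0"
    by (subst (asm) nn_integral_0_iff_AE) simp_all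
  have "\<exists>t. t \<in> ?I \<and> (\<integral>\<^sup>+x. indicator N (t *\<^sub>R x) \<partial>(lborel::'a measure)) = 0"
  proof (rule ccontr)
    assume n: "\<not> ?thesis"
    have "AE t in lborel. t \<notin> ?I"
      using ae by eventually_elim (use n in \<open>force simp: indicator_def\<close>)
    then have "emeasure lborel ?I = 0" by (subst (asm) AE_iff_measurable[of ?I]) auto
    then show False by simp
  qed
  then obtain t where t: "t \<in> ?I" "(\<integral>\<^sup>+x. indicator N (t *\<^sub>R x) \<partial>(lborel::'a measure)) = 0"
    by blast
  have "emeasure lborel N = (\<integral>\<^sup>+x. indicator N x \<partial>lborel)" by simp
  also have "\<dots> = ennreal (\<bar>t\<bar> ^ DIM('a)) * (\<integral>\<^sup>+x. indicator N (0 + t *\<^sub>R x) \<partial>(lborel::'a measure))"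
    using t(1) by (subst lborel_affine[of t 0]) (simp_all add: nn_integral_density nn_integral_distr nn_integral_cmult del: nn_integral_indicator)
  also have "\<dots> = 0" using t(2) by simp
  finally show ?thesis by auto
qed

text \<open>The integral extends to an entire function of t with value T > 0 at 0. It is not
  identically zero, so its zeros are isolated and countable.\<close>

lemma countable_zeros_oscillatory_integral:
  fixes \<beta> :: "real \<Rightarrow> real"
  assumes \<beta>: "continuous_on {0..T} \<beta>" and T: "T > 0"
  shows "countable {t::real. integral {0..T} (\<lambda>s. cis (t * \<beta> s)) = 0}"
proof -
  define M where "M z = integral (cbox 0 T) (\<lambda>s. exp (\<i> * z * complex_of_real (\<beta> s)))" for z
  have \<beta>2: "continuous_on (UNIV \<times> cbox 0 T) (\<lambda>p::complex \<times> real. \<beta> (snd p))"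
    by (rule continuous_on_compose2[OF \<beta>]) (auto intro: continuous_intros)
  have hol: "M holomorphic_on UNIV"
    unfolding M_def
  proof (rule leibniz_rule_holomorphic)
    fix z and s :: real
    show "((\<lambda>z. exp (\<i> * z * complex_of_real (\<beta> s))) has_field_derivative
        \<i> * complex_of_real (\<beta> s) * exp (\<i> * z * complex_of_real (\<beta> s))) (at z within UNIV)"
      by (auto intro!: derivative_eq_intros)
    show "(\<lambda>s. exp (\<i> * z * complex_of_real (\<beta> s))) integrable_on cbox 0 T"
      using \<beta> by (intro integrable_continuous continuous_intros) auto
  next
    show "continuous_on (UNIV \<times> cbox 0 T) (\<lambda>(z, s). \<i> * complex_of_real (\<beta> s) * exp (\<i> * z * complex_of_real (\<beta> s)))"
      unfolding case_prod_unfold by (intro continuous_intros \<beta>2)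
  qed simp
  have M_real: "M (complex_of_real t) = integral {0..T} (\<lambda>s. cis (t * \<beta> s))" for t
    by (simp add: M_def cis_conv_exp mult.assoc)
  have M0: "M 0 = complex_of_real T"
    using T by (simp add: M_def scaleR_conv_of_real)
  have "countable {z. M z = 0}"
  proof (cases "M constant_on UNIV")
    case True
    then have "M z = complex_of_real T" for z using M0 unfolding constant_on_def by (metis UNIV_I)
    then show ?thesis using T by simp
  next
    case False
    then show ?thesis using holomorphic_countable_zeros[OF hol] by (simp add: connected_UNIV)
  qed
  then have "countable (complex_of_real ` {t. M (complex_of_real t) = 0})"
    by (rule countable_subset[rotated]) auto
  then show ?thesis
    by (simp add: M_real) (metis countable_image_inj_on inj_on_def of_real_eq_iff countable_image_inj_eq)
qed

section \<open>The maps J and the action of left translations on frequencies\<close>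

lemma J_inner_all:
  assumes H: "H_type br"
  shows "J br \<mu> V \<bullet> W = \<mu> \<bullet> br V W"
proof -
  obtain P where P: "\<And>x. P x \<in> center br" "\<And>x y. y \<in> center br \<Longrightarrow> (x - P x) \<bullet> y = 0"
    using linear_orthogonal_projection[OF subspace_center[OF H]] by metis
  have "W - P W \<in> hor br"
    using P(2) by (auto simp: hor_def orthogonal_comp_def orthogonal_def inner_commute)
  then have "J br \<mu> V \<bullet> (W - P W) = \<mu> \<bullet> br V (W - P W)" by (rule J_inner[OF H])
  moreover have "J br \<mu> V \<bullet> P W = 0" by (rule hor_center_inner[OF J_hor[OF H] P(1)])
  ultimately show ?thesis
    by (simp add: linear_diff[OF linear_br(1)[OF H]] br_center_right[OF H P(1)] inner_diff_right)
qed

lemma J_norm: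
  assumes H: "H_type br" and \<mu>: "\<mu> \<in> center br" and V: "V \<in> hor br"
  shows "J br \<mu> V \<bullet> J br \<mu> V = (norm \<mu>)\<^sup>2 * (V \<bullet> V)"
proof -
  have "J br \<mu> V \<bullet> J br \<mu> V = - (J br \<mu> (J br \<mu> V) \<bullet> V)"
    using br_skew[OF H, of V "J br \<mu> V"] by (simp add: J_inner_all[OF H])
  then show ?thesis using H \<mu> V by (simp add: H_type_def)
qed

text \<open>Polarisation of \<open>J_norm\<close> in \<mu>. With \<mu>' the charge, it determines
  the brackets in the plane of a geodesic against every central \<mu>.\<close>

lemma J_polarisation:
  assumes H: "H_type br" and \<mu>: "\<mu> \<in> center br" "\<mu>' \<in> center br" and V: "V \<in> hor br"
  shows "J br \<mu> V \<bullet> J br \<mu>' V = (\<mu> \<bullet> \<mu>') * (V \<bullet> V)"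
proof -
  have add: "J br (\<mu> + \<mu>') V = J br \<mu> V + J br \<mu>' V"
    by (rule J_unique) (auto intro!: subspace_add hor_subspace J_hor H simp: J_inner_all[OF H] inner_add_left)
  have "J br (\<mu> + \<mu>') V \<bullet> J br (\<mu> + \<mu>') V = (norm (\<mu> + \<mu>'))\<^sup>2 * (V \<bullet> V)"
    using \<mu> by (intro J_norm H V subspace_add subspace_center)
  then show ?thesis
    using J_norm[OF H \<mu>(1) V] J_norm[OF H \<mu>(2) V]
      inner_commute[of "J br \<mu>' V" "J br \<mu> V"] inner_commute[of \<mu>' \<mu>]
    by (simp add: add inner_add_left inner_add_right power2_norm_eq_inner algebra_simps)
qed

text \<open>Evaluated on a product, \<mu> picks up half of the bracket, which is linear in the
  second factor; this adds \<open>(1/2) *\<^sub>R J br \<mu> g0\<close> to the frequency.\<close>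

lemma fourier_translate:
  assumes H: "H_type br" and [measurable]: "f \<in> borel_measurable borel"
  shows "fourier (\<lambda>g. f (gmul br g0 g)) (- \<mu>) = cis (\<mu> \<bullet> g0) * fourier f ((1/2) *\<^sub>R J br \<mu> g0 - \<mu>)"
proof -
  note [measurable (raw)] = gmul_measurable[OF H]
  let ?K = "\<lambda>h. f h * cis (- \<mu> \<bullet> gmul br (- g0) h)"
  have "fourier (\<lambda>g. f (gmul br g0 g)) (- \<mu>) = (\<integral>g. ?K (gmul br g0 g) \<partial>lborel)"
    by (simp add: fourier_def gmul_cancel[OF H])
  also have "\<dots> = (\<integral>h. ?K h \<partial>lborel)"
    by (subst (2) distr_lborel_gmul(1)[OF H, of g0, symmetric]) (simp add: integral_distr)
  also have "\<dots> = (\<integral>h. cis (\<mu> \<bullet> g0) * (f h * cis (((1/2) *\<^sub>R J br \<mu> g0 - \<mu>) \<bullet> h)) \<partial>lborel)"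
  proof (rule Bochner_Integration.integral_cong)
    fix h
    have "- \<mu> \<bullet> gmul br (- g0) h = \<mu> \<bullet> g0 + ((1/2) *\<^sub>R J br \<mu> g0 - \<mu>) \<bullet> h"
      by (simp add: gmul_def linear_neg[OF linear_br(2)[OF H]] inner_add_right inner_diff_right inner_diff_left J_inner_all[OF H])
    then show "?K h = cis (\<mu> \<bullet> g0) * (f h * cis (((1/2) *\<^sub>R J br \<mu> g0 - \<mu>) \<bullet> h))"
      by (simp only: cis_mult[symmetric] mult_ac)
  qed simp
  finally show ?thesis by (simp add: fourier_def)
qed

lemma fourier_eq_0_if_translates:
  assumes H: "H_type br" and f: "f \<in> borel_measurable borel" and \<mu>: "\<mu> \<in> center br" "\<mu> \<noteq> 0"
    and z: "\<And>g0. fourier (\<lambda>g. f (gmul br g0 g)) (- \<mu>) = 0" and \<eta>: "\<eta> \<in> hor br"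
  shows "fourier f (\<eta> - \<mu>) = 0"
proof -
  \<comment> \<open>Chosen to solve \<open>J br \<mu> g0 = 2 *\<^sub>R \<eta>\<close>, using J^2 = -
    |\<mu>|^2 on the horizontal space.\<close>
  define g0 where "g0 = (- 2 / (norm \<mu>)\<^sup>2) *\<^sub>R J br \<mu> \<eta>"
  have "J br \<mu> g0 = (- 2 / (norm \<mu>)\<^sup>2) *\<^sub>R J br \<mu> (J br \<mu> \<eta>)"
    unfolding g0_def using J_linear[OF H, of \<mu> "- 2 / (norm \<mu>)\<^sup>2" "J br \<mu> \<eta>" 0 0] by simp
  also have "J br \<mu> (J br \<mu> \<eta>) = - (norm \<mu>)\<^sup>2 *\<^sub>R \<eta>" using H \<mu> \<eta> by (simp add: H_type_def)
  finally have "J br \<mu> g0 = 2 *\<^sub>R \<eta>" using \<mu> by simp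
  then have "cis (\<mu> \<bullet> g0) * fourier f (\<eta> - \<mu>) = 0"
    using fourier_translate[OF H f, of g0 \<mu>] z[of g0] by simp
  then show ?thesis by simp
qed

context charged_geodesic
begin

text \<open>The only consequence of I f = 0 used for the vanishing of the transform. In this form it
  passes easily to left translates and to conjugates.\<close>

definition orth :: "('g \<Rightarrow> complex) \<Rightarrow> bool" where
  "orth f \<longleftrightarrow> (\<forall>\<phi>\<in>borel_measurable borel. (\<exists>B. \<forall>g. cmod (\<phi> g) \<le> B) \<longrightarrow>
     (\<forall>g. \<phi> (g + (pi / c\<^sup>2) *\<^sub>R \<omega>) = \<phi> g) \<longrightarrow> (\<integral>g. f g * geodesic_mean \<phi> g \<partial>lborel) = 0)"

lemma orthD:
  assumes "orth f" "\<phi> \<in> borel_measurable borel" "\<And>g. cmod (\<phi> g) \<le> B"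
    "\<And>g. \<phi> (g + (pi / c\<^sup>2) *\<^sub>R \<omega>) = \<phi> g"
  shows "(\<integral>g. f g * geodesic_mean \<phi> g \<partial>lborel) = 0"
  using assms unfolding orth_def by blast

lemma geodesic_mean_measurable [measurable]:
  assumes [measurable]: "\<phi> \<in> borel_measurable borel"
  shows "geodesic_mean \<phi> \<in> borel_measurable borel"
  unfolding geodesic_mean_def[abs_def] by measurable

text \<open>Means multiply on the right, so they commute with left translations, under which
  Lebesgue measure is invariant.\<close>

lemma orth_translate:
  assumes f [measurable]: "f \<in> borel_measurable borel" and o: "orth f"
  shows "orth (\<lambda>g. f (gmul br g0 g))"
  unfolding orth_def
proof (intro ballI impI)
  fix \<phi> :: "'g \<Rightarrow> complex"
  assume m [measurable]: "\<phi> \<in> borel_measurable borel" and b: "\<exists>B. \<forall>g. cmod (\<phi> g) \<le> B"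
    and per: "\<forall>g. \<phi> (g + (pi / c\<^sup>2) *\<^sub>R \<omega>) = \<phi> g"
  let ?\<phi> = "\<lambda>g. \<phi> (gmul br (- g0) g)"
  have mean: "geodesic_mean ?\<phi> (gmul br g0 g) = geodesic_mean \<phi> g" for g
    by (simp add: geodesic_mean_def gmul_assoc[OF H] gmul_cancel(3)[OF H])
  have "(\<integral>g. f (gmul br g0 g) * geodesic_mean \<phi> g \<partial>lborel) =
      (\<integral>g. (\<lambda>h. f h * geodesic_mean ?\<phi> h) (gmul br g0 g) \<partial>lborel)"
    by (simp add: mean)
  also have "\<dots> = (\<integral>h. f h * geodesic_mean ?\<phi> h \<partial>lborel)"
    by (subst (2) distr_lborel_gmul(1)[OF H, of g0, symmetric]) (simp add: integral_distr)
  also have "\<dots> = 0"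
  proof -
    have "?\<phi> \<in> borel_measurable borel" by measurable
    then show ?thesis
      using b per orthD[OF o, of ?\<phi>] by (auto simp: gmul_add_center(1)[OF H \<omega>_center])
  qed
  finally show "(\<integral>g. f (gmul br g0 g) * geodesic_mean \<phi> g \<partial>lborel) = 0" .
qed

text \<open>Conjugation reflects the spectrum; this reduces frequencies of negative index to those
  of positive index.\<close>

lemma orth_cnj:
  assumes o: "orth f" shows "orth (\<lambda>g. cnj (f g))"
  unfolding orth_def
proof (intro ballI impI)
  fix \<phi> :: "'g \<Rightarrow> complex"
  assume m [measurable]: "\<phi> \<in> borel_measurable borel" and b: "\<exists>B. \<forall>g. cmod (\<phi> g) \<le> B"
    and per: "\<forall>g. \<phi> (g + (pi / c\<^sup>2) *\<^sub>R \<omega>) = \<phi> g"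
  let ?\<phi> = "\<lambda>g. cnj (\<phi> g)"
  have mean: "geodesic_mean \<phi> g = cnj (geodesic_mean ?\<phi> g)" for g
    unfolding geodesic_mean_def Bochner_Integration.integral_cnj[symmetric]
    by (intro Bochner_Integration.integral_cong) (simp_all add: scaleR_conv_of_real)
  have "(\<integral>g. cnj (f g) * geodesic_mean \<phi> g \<partial>lborel) = cnj (\<integral>g. f g * geodesic_mean ?\<phi> g \<partial>lborel)"
    unfolding mean Bochner_Integration.integral_cnj[symmetric] by (intro Bochner_Integration.integral_cong) simp_all
  also have "(\<integral>g. f g * geodesic_mean ?\<phi> g \<partial>lborel) = 0"
  proof -
    have "?\<phi> \<in> borel_measurable borel"
      by (rule borel_measurable_continuous_on[OF _ m]) (intro continuous_intros)
    then show ?thesis using b per orthD[OF o, of ?\<phi>] by auto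
  qed
  finally show "(\<integral>g. cnj (f g) * geodesic_mean \<phi> g \<partial>lborel) = 0" by simp
qed

lemma norm_e1: "norm e1 = 1"
proof -
  have "e1 \<bullet> e1 = 1"
    using J_norm[OF H lam(1) \<nu>(1)] \<nu>(2) c_pos by (simp add: e1_def dot_square_norm power2_eq_square)
  then show ?thesis by (simp add: norm_eq_sqrt_inner)
qed

text \<open>As brackets are central, this identifies [e1, \<nu>] with \<omega>: the plane of the
  circle and \<omega> span a Heisenberg algebra, whatever the dimension of the center.\<close>

lemma br_e1_\<nu>: "\<mu> \<in> center br \<Longrightarrow> \<mu> \<bullet> br e1 \<nu> = \<mu> \<bullet> \<omega>"
  using J_polarisation[OF H _ lam(1) e1_hor, of \<mu>] c_pos norm_e1
  by (simp add: J_e1 J_inner_all[OF H] inner_\<omega> dot_square_norm field_simps)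

lemma br_\<nu>_e1: "\<mu> \<in> center br \<Longrightarrow> \<mu> \<bullet> br \<nu> e1 = - (\<mu> \<bullet> \<omega>)"
  using br_e1_\<nu> br_skew[OF H, of \<nu> e1] by simp

lemma br_circ: "br g (circ \<theta>) = (1 / c) *\<^sub>R (cos \<theta> *\<^sub>R br g e1 + sin \<theta> *\<^sub>R br g \<nu>)"
  using linear_br(1)[OF H, of g] by (simp add: circ_def linear_scale linear_add)

lemma br_gmul_\<gamma>: "br (gmul br g (- \<gamma> s)) h = br g h - br (circ (s * c)) h"
proof -
  note lin = linear_br(2)[OF H]
  show ?thesis
    unfolding gmul_def geodesic_eq
    by (simp add: linear_add[OF lin] linear_diff[OF lin] linear_scale[OF lin] linear_neg[OF lin]
        br_center_left[OF br_in_center[OF H]] br_center_left[OF \<omega>_center[of 1, simplified]])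
qed

lemma cis_gmul_\<gamma>:
  assumes \<mu>: "\<mu> \<in> center br"
  shows "cis (- (\<mu> \<bullet> gmul br g (- \<gamma> s))) =
    cis (- (\<mu> \<bullet> g)) * (cis (s * (\<mu> \<bullet> \<omega>) / (2 * c)) * cis ((\<mu> \<bullet> br g (circ (s * c))) / 2))"
proof -
  note lin = linear_br(1)[OF H, of g]
  have "br g (\<gamma> s) = br g (circ (s * c))"
    by (simp add: geodesic_eq linear_add[OF lin] br_center_right[OF H \<omega>_center])
  moreover have "\<mu> \<bullet> circ (s * c) = 0" using hor_center_inner[OF circ_hor \<mu>] by (simp add: inner_commute)
  ultimately have "- (\<mu> \<bullet> gmul br g (- \<gamma> s)) = - (\<mu> \<bullet> g) + (s * (\<mu> \<bullet> \<omega>) / (2 * c) + (\<mu> \<bullet> br g (circ (s * c))) / 2)"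
    by (simp add: gmul_def linear_neg[OF lin] inner_add_right inner_diff_right) (simp add: geodesic_eq inner_add_right)
  then show ?thesis by (simp only: cis_mult[symmetric])
qed

lemma geodesic_mean_character:
  assumes \<mu>: "\<mu> \<in> center br"
  shows "geodesic_mean (\<lambda>g. cis (- (\<mu> \<bullet> g)) * a g) g = cis (- (\<mu> \<bullet> g)) *
    (\<integral>s. indicator {0..<2 * pi / c} s *\<^sub>R (cis (s * (\<mu> \<bullet> \<omega>) / (2 * c)) *
      cis ((\<mu> \<bullet> br g (circ (s * c))) / 2) * a (gmul br g (- \<gamma> s))) \<partial>lborel)"
  unfolding geodesic_mean_def cis_gmul_\<gamma>[OF \<mu>] integral_mult_right_zero[symmetric]
  by (intro Bochner_Integration.integral_cong) (simp_all add: mult_ac)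

lemma fourier_eq_0_if_orthogonal_to_charge:
  assumes f: "integrable lborel f" and o: "orth f" and \<mu>: "\<mu> \<in> center br" "\<mu> \<bullet> lam = 0"
  shows "fourier f (- \<mu>) = 0"
proof -
  let ?T = "2 * pi / c"
  have T: "?T > 0" using c_pos by simp
  have \<mu>\<omega>: "\<mu> \<bullet> \<omega> = 0" using \<mu> by (simp add: inner_\<omega>)
  have [measurable]: "circ \<in> borel_measurable borel"
    by (intro borel_measurable_continuous_onI continuous_circ)
  have [measurable]: "f \<in> borel_measurable borel" using f by simp
  define \<beta> where "\<beta> g s = (\<mu> \<bullet> br g (circ (s * c))) / 2" for g s
  have \<beta>_eq: "\<beta> g s = (cos (s * c) * (\<mu> \<bullet> br g e1) + sin (s * c) * (\<mu> \<bullet> br g \<nu>)) / (2 * c)" for g s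
    by (simp add: \<beta>_def br_circ inner_add_right)
  have [measurable]: "(\<lambda>g. br g h) \<in> borel_measurable borel" for h by (rule linear_measurable[OF linear_br(2)[OF H]])
  define m where "m g = (\<integral>s. indicator {0..<?T} s *\<^sub>R cis (\<beta> g s) \<partial>lborel)" for g
  have [measurable]: "m \<in> borel_measurable borel" unfolding m_def[abs_def] \<beta>_eq by measurable
  \<comment> \<open>For \<mu> orthogonal to \<omega> the form \<mu> \<bullet> br vanishes on the
    plane of the circle, so moving along the inverse curve does not change the phase
    \<beta>.\<close>
  have m_inv: "m (gmul br g (- \<gamma> s)) = m g" for g s
  proof -
    have "br e1 e1 = 0" "br \<nu> \<nu> = 0" using H by (simp_all add: H_type_def lie_bracket_def)
    then have "\<mu> \<bullet> br (circ \<theta>) e1 = 0" "\<mu> \<bullet> br (circ \<theta>) \<nu> = 0" for \<theta>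
      using br_e1_\<nu>[OF \<mu>(1)] br_\<nu>_e1[OF \<mu>(1)] \<mu>\<omega>
      by (simp_all add: circ_def linear_scale[OF linear_br(2)[OF H]] linear_add[OF linear_br(2)[OF H]] inner_add_right)
    then show ?thesis by (simp add: m_def \<beta>_eq br_gmul_\<gamma> inner_diff_right)
  qed
  have m_eq: "m g = integral {0..?T} (\<lambda>s. cis (\<beta> g s))" for g
  proof -
    have cont: "continuous_on {0..?T} (\<lambda>s. cis (\<beta> g s))" unfolding \<beta>_eq using c_pos by (intro continuous_intros) auto
    have "m g = (\<integral>s. indicator {0..?T} s *\<^sub>R cis (\<beta> g s) \<partial>lborel)"
      unfolding m_def
    proof (rule integral_cong_AE)
      show "AE s in lborel. indicator {0..<?T} s *\<^sub>R cis (\<beta> g s) = indicator {0..?T} s *\<^sub>R cis (\<beta> g s)"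
        using AE_lborel_singleton[of ?T] by eventually_elim (auto simp: indicator_def)
    qed (unfold \<beta>_eq, measurable)
    also have "\<dots> = integral {0..?T} (\<lambda>s. cis (\<beta> g s))"
      using set_borel_integral_eq_integral(2)[of "{0..?T}" "\<lambda>s. cis (\<beta> g s)"] borel_integrable_compact[OF compact_Icc cont]
      by (simp add: set_integrable_def set_lebesgue_integral_def)
    finally show ?thesis .
  qed
  \<comment> \<open>The phase is linear in g, so along the line through g the scale t becomes the
    parameter of an oscillatory integral.\<close>
  have null: "{g. m g = 0} \<in> null_sets lborel"
  proof (rule null_set_if_countable_on_rays)
    fix g
    have "\<beta> (t *\<^sub>R g) s = t * \<beta> g s" for t s by (simp add: \<beta>_def linear_scale[OF linear_br(2)[OF H]])
    moreover have "continuous_on {0..?T} (\<beta> g)" unfolding \<beta>_eq[abs_def] using c_pos by (intro continuous_intros) auto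
    ultimately show "countable {t. t *\<^sub>R g \<in> {g. m g = 0}}"
      using countable_zeros_oscillatory_integral[OF _ T, of "\<beta> g"] by (simp add: m_eq)
  qed measurable
  \<comment> \<open>The mean multiplies by \<open>m\<close>, which is constant along the geodesic; test against \<open>1 / m\<close>, cut off.\<close>
  define a where "a n g = (if cmod (m g) > 1 / real (Suc n) then 1 / m g else 0)" for n g
  have [measurable]: "a n \<in> borel_measurable borel" for n unfolding a_def[abs_def] by measurable
  have a_bound: "cmod (a n g) \<le> real (Suc n)" for n g
  proof (cases "cmod (m g) > 1 / real (Suc n)")
    case True
    then have "0 < cmod (m g)" by (rule le_less_trans[rotated]) simp
    with True have "1 / cmod (m g) \<le> real (Suc n)" by (simp add: field_simps)
    then show ?thesis using True by (simp add: a_def norm_divide)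
  qed (simp add: a_def)
  have per: "cis (- (\<mu> \<bullet> (g + (pi / c\<^sup>2) *\<^sub>R \<omega>))) * a n (g + (pi / c\<^sup>2) *\<^sub>R \<omega>) = cis (- (\<mu> \<bullet> g)) * a n g" for n g
  proof -
    have "m (g + (pi / c\<^sup>2) *\<^sub>R \<omega>) = m g"
      by (simp add: m_def \<beta>_eq linear_add[OF linear_br(2)[OF H]] br_center_left[OF \<omega>_center])
    then show ?thesis using \<mu>\<omega> by (simp add: a_def inner_add_right)
  qed
  have mean: "geodesic_mean (\<lambda>g. cis (- (\<mu> \<bullet> g)) * a n g) g = cis (- (\<mu> \<bullet> g)) * (m g * a n g)" for n g
  proof -
    have "a n (gmul br g (- \<gamma> s)) = a n g" for s by (simp add: a_def m_inv)
    moreover have "m g * a n g = (\<integral>s. indicator {0..<?T} s *\<^sub>R (cis (\<beta> g s) * a n g) \<partial>lborel)"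
      by (simp only: m_def integral_mult_left_zero[symmetric] mult_scaleR_left)
    ultimately show ?thesis by (simp add: geodesic_mean_character[OF \<mu>(1)] \<mu>\<omega> \<beta>_def)
  qed
  have zero: "(\<integral>g. f g * (cis (- (\<mu> \<bullet> g)) * (m g * a n g)) \<partial>lborel) = 0" for n
  proof -
    have "(\<lambda>g. cis (- (\<mu> \<bullet> g)) * a n g) \<in> borel_measurable borel" by measurable
    from orthD[OF o this _ per, of "real (Suc n)"] show ?thesis using a_bound[of n] by (simp add: norm_mult mean)
  qed
  \<comment> \<open>The product m * a n stays bounded by 1 although 1 / m need not be bounded, and
    it tends to the indicator of m \<noteq> 0.\<close>
  have "(\<lambda>n. \<integral>g. f g * (cis (- (\<mu> \<bullet> g)) * (m g * a n g)) \<partial>lborel) \<longlonglongrightarrow>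
      (\<integral>g. f g * (cis (- (\<mu> \<bullet> g)) * (if m g = 0 then 0 else 1)) \<partial>lborel)"
  proof (rule integral_mult_bounded_limit[OF f, where C = 1])
    fix g
    have "(\<lambda>n. m g * a n g) \<longlonglongrightarrow> (if m g = 0 then 0 else 1)"
    proof (cases "m g = 0")
      case False
      then obtain N where N: "inverse (real (Suc N)) < cmod (m g)" using reals_Archimedean[of "cmod (m g)"] by auto
      have "m g * a n g = 1" if "n \<ge> N" for n
      proof -
        have "1 / real (Suc n) \<le> 1 / real (Suc N)" using that by (intro divide_left_mono) auto
        then show ?thesis using N False by (simp add: a_def inverse_eq_divide)
      qed
      then show ?thesis using False by (auto intro!: tendsto_eventually eventually_sequentiallyI)
    qed simp
    then show "(\<lambda>n. cis (- (\<mu> \<bullet> g)) * (m g * a n g)) \<longlonglongrightarrow> cis (- (\<mu> \<bullet> g)) * (if m g = 0 then 0 else 1)"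
      by (intro tendsto_mult tendsto_const)
    show "cmod (cis (- (\<mu> \<bullet> g)) * (m g * a n g)) \<le> 1" for n by (simp add: norm_mult a_def norm_divide)
  qed measurable
  then have "(\<integral>g. f g * (cis (- (\<mu> \<bullet> g)) * (if m g = 0 then 0 else 1)) \<partial>lborel) = 0"
    by (simp only: zero LIMSEQ_const_iff)
  moreover have "fourier f (- \<mu>) = (\<integral>g. f g * (cis (- (\<mu> \<bullet> g)) * (if m g = 0 then 0 else 1)) \<partial>lborel)"
    unfolding fourier_def
  proof (rule integral_cong_AE)
    show "AE g in lborel. f g * cis (- \<mu> \<bullet> g) = f g * (cis (- (\<mu> \<bullet> g)) * (if m g = 0 then 0 else 1))"
      using AE_not_in[OF null] by eventually_elim (simp add: inner_minus_left)
  qed measurable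
  ultimately show ?thesis by simp
qed

end

section \<open>Frequencies of positive index\<close>

lemma integral_cis_period:
  assumes c: "c > 0"
  shows "(\<integral>s. indicator {0..<2 * pi / c} s *\<^sub>R cis (real_of_int m * (s * c)) \<partial>lborel) =
    (if m = 0 then complex_of_real (2 * pi / c) else 0)"
proof (cases "m = 0")
  case True
  then show ?thesis using c by (simp add: scaleR_conv_of_real)
next
  case False
  let ?T = "2 * pi / c" and ?a = "real_of_int m * c"
  have a: "?a \<noteq> 0" using False c by simp
  let ?F = "\<lambda>s. cis (?a * s) / (\<i> * complex_of_real ?a)"
  have "(\<integral>s. indicator {0..<?T} s *\<^sub>R cis (real_of_int m * (s * c)) \<partial>lborel) =
      (\<integral>s. indicator {0..?T} s *\<^sub>R cis (?a * s) \<partial>lborel)"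
  proof (rule integral_cong_AE)
    show "AE s in lborel. indicator {0..<?T} s *\<^sub>R cis (real_of_int m * (s * c)) = indicator {0..?T} s *\<^sub>R cis (?a * s)"
      using AE_lborel_singleton[of ?T] by eventually_elim (auto simp: indicator_def mult_ac)
  qed measurable
  also have "\<dots> = ?F ?T - ?F 0"
  proof (rule integral_FTC_Icc)
    fix s
    have "((\<lambda>z. exp (\<i> * complex_of_real ?a * z) / (\<i> * complex_of_real ?a)) has_field_derivative
        exp (\<i> * complex_of_real ?a * complex_of_real s)) (at (complex_of_real s))"
      using a by (auto intro!: derivative_eq_intros)
    from has_vector_derivative_real_field[OF this]
    show "(?F has_vector_derivative cis (?a * s)) (at s within {0..?T})"
      by (simp add: cis_conv_exp mult.assoc)
  qed (use c in \<open>auto intro!: continuous_intros\<close>)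
  also have "?a * ?T = 2 * pi * real_of_int m" using c by simp
  also have "cis (2 * pi * real_of_int m) = 1"
    by (simp add: complex_eq_iff cos_int_2pin sin_int_2pin)
  finally show ?thesis using False by simp
qed

lemma integral_circle_monomial:
  assumes c: "c > 0"
  shows "(\<integral>s. indicator {0..<2 * pi / c} s *\<^sub>R ((x * cis (- (s * c))) ^ i * (cis (s * c) * y) ^ j) \<partial>lborel) =
    (if i = j then complex_of_real (2 * pi / c) * (x * y) ^ i else 0)"
proof -
  have "(x * cis (- (s * c))) ^ i * (cis (s * c) * y) ^ j = (x ^ i * y ^ j) * cis (real_of_int (int j - int i) * (s * c))" for s
  proof -
    have "cis (- (s * c)) ^ i * cis (s * c) ^ j = cis (real_of_int (int j - int i) * (s * c))"
      by (simp add: Complex.DeMoivre cis_mult algebra_simps)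
    then show ?thesis by (simp add: power_mult_distrib mult_ac)
  qed
  then have "(\<integral>s. indicator {0..<2 * pi / c} s *\<^sub>R ((x * cis (- (s * c))) ^ i * (cis (s * c) * y) ^ j) \<partial>lborel) =
      (x ^ i * y ^ j) * (\<integral>s. indicator {0..<2 * pi / c} s *\<^sub>R cis (real_of_int (int j - int i) * (s * c)) \<partial>lborel)"
    by (simp only: integral_mult_right_zero[symmetric] mult_scaleR_right)
  then show ?thesis unfolding integral_cis_period[OF c] by (auto simp: power_mult_distrib)
qed

lemma integrable_Ico_bounded:
  fixes h :: "real \<Rightarrow> complex"
  assumes [measurable]: "h \<in> borel_measurable borel" and B: "\<And>s. cmod (h s) \<le> B"
  shows "integrable lborel (\<lambda>s. indicator {0..<T::real} s *\<^sub>R h s)"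
proof (rule Bochner_Integration.integrable_bound)
  show "integrable lborel (\<lambda>s. B * indicat_real {0..<T} s)"
    by (cases "0 \<le> T") (auto intro!: integrable_mult_right integrable_real_indicator)
  show "AE s in lborel. norm (indicator {0..<T} s *\<^sub>R h s) \<le> norm (B * indicat_real {0..<T} s)"
    using B by (intro AE_I2) (auto simp: indicator_def intro: order_trans[OF _ abs_ge_self])
qed measurable

text \<open>Expand the exponential: orthogonality of the characters of the circle leaves the single
  term of order i - l, which exists only for l \<le> i.\<close>

lemma integral_circle_exp:
  fixes k :: nat
  assumes c: "c > 0"
  shows "(\<integral>s. indicator {0..<2 * pi / c} s *\<^sub>R ((x * cis (- (s * c))) ^ i * (cis (s * c) * y) ^ l *
      exp (of_nat k * (cis (s * c) * y))) \<partial>lborel) =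
    (if l \<le> i then complex_of_real (2 * pi / c) * (x * y) ^ i * (of_nat k ^ (i - l) / fact (i - l)) else 0)"
proof -
  let ?T = "2 * pi / c"
  have T: "?T > 0" using c by simp
  let ?t = "\<lambda>m s. indicator {0..<?T} s *\<^sub>R ((x * cis (- (s * c))) ^ i * (cis (s * c) * y) ^ (l + m) * (of_nat k ^ m / fact m))"
  have norm_t: "norm (?t m s) = indicator {0..<?T} s * (cmod x ^ i * cmod y ^ l) * ((real k * cmod y) ^ m / fact m)" for m s
    by (simp add: norm_mult norm_divide norm_power power_add power_mult_distrib)
  have int: "integrable lborel (?t m)" for m
    by (rule integrable_Ico_bounded[where B = "cmod x ^ i * cmod y ^ (l + m) * (real k ^ m / fact m)"])
      (simp_all add: norm_mult norm_divide norm_power)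
  have sum_exp: "summable (\<lambda>m. C * ((real k * cmod y) ^ m / fact m))" for C
    using summable_exp[of "real k * cmod y"] by (intro summable_mult) (simp add: divide_inverse mult.commute)
  have "(\<lambda>m. \<integral>s. ?t m s \<partial>lborel) sums (\<integral>s. (\<Sum>m. ?t m s) \<partial>lborel)"
  proof (rule sums_integral[OF int])
    show "AE s in lborel. summable (\<lambda>m. norm (?t m s))" unfolding norm_t by (intro AE_I2 sum_exp)
    have "(\<integral>s. norm (?t m s) \<partial>lborel) = (?T * (cmod x ^ i * cmod y ^ l)) * ((real k * cmod y) ^ m / fact m)" for m
      unfolding norm_t using T by simp
    then show "summable (\<lambda>m. \<integral>s. norm (?t m s) \<partial>lborel)" by (simp only: sum_exp)
  qed
  moreover have "(\<Sum>m. ?t m s) = indicator {0..<?T} s *\<^sub>R ((x * cis (- (s * c))) ^ i * (cis (s * c) * y) ^ l *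
      exp (of_nat k * (cis (s * c) * y)))" for s
  proof -
    have "(\<lambda>m. (of_nat k * (cis (s * c) * y)) ^ m /\<^sub>R fact m) sums exp (of_nat k * (cis (s * c) * y))" by (rule exp_converges)
    then have "(\<lambda>m. indicator {0..<?T} s *\<^sub>R ((x * cis (- (s * c))) ^ i * (cis (s * c) * y) ^ l *
        ((of_nat k * (cis (s * c) * y)) ^ m /\<^sub>R fact m))) sums
        (indicator {0..<?T} s *\<^sub>R ((x * cis (- (s * c))) ^ i * (cis (s * c) * y) ^ l * exp (of_nat k * (cis (s * c) * y))))"
      by (intro sums_scaleR_right sums_mult)
    moreover have "indicator {0..<?T} s *\<^sub>R ((x * cis (- (s * c))) ^ i * (cis (s * c) * y) ^ l *
        ((of_nat k * (cis (s * c) * y)) ^ m /\<^sub>R fact m)) = ?t m s" for m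
      by (simp add: scaleR_conv_of_real power_add power_mult_distrib divide_inverse mult_ac)
    ultimately show ?thesis by (simp only: sums_iff)
  qed
  moreover have "(\<integral>s. ?t m s \<partial>lborel) = (if i = l + m then complex_of_real ?T * (x * y) ^ i * (of_nat k ^ m / fact m) else 0)" for m
  proof -
    have "(\<integral>s. ?t m s \<partial>lborel) = (\<integral>s. indicator {0..<?T} s *\<^sub>R ((x * cis (- (s * c))) ^ i * (cis (s * c) * y) ^ (l + m)) \<partial>lborel) *
        (of_nat k ^ m / fact m)"
      by (simp only: integral_mult_left_zero[symmetric] mult_scaleR_left)
    then show ?thesis by (simp add: integral_circle_monomial[OF c])
  qed
  ultimately have sums: "(\<lambda>m. if i = l + m then complex_of_real ?T * (x * y) ^ i * (of_nat k ^ m / fact m) else 0) sums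
      (\<integral>s. indicator {0..<?T} s *\<^sub>R ((x * cis (- (s * c))) ^ i * (cis (s * c) * y) ^ l * exp (of_nat k * (cis (s * c) * y))) \<partial>lborel)"
    by simp
  have "(\<lambda>m. if i = l + m then complex_of_real ?T * (x * y) ^ i * (of_nat k ^ m / fact m) else 0) sums
      (if l \<le> i then complex_of_real ?T * (x * y) ^ i * (of_nat k ^ (i - l) / fact (i - l)) else 0)"
  proof (cases "l \<le> i")
    case True
    have "(\<lambda>m. if m = i - l then complex_of_real ?T * (x * y) ^ i * (of_nat k ^ m / fact m) else 0) sums
      (complex_of_real ?T * (x * y) ^ i * (of_nat k ^ (i - l) / fact (i - l)))" by (rule sums_single)
    moreover have "i = l + m \<longleftrightarrow> m = i - l" for m using True by auto
    ultimately show ?thesis using True by simp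
  next
    case False
    then have "(\<lambda>m. if i = l + m then complex_of_real ?T * (x * y) ^ i * (of_nat k ^ m / fact m) else 0) = (\<lambda>m. 0)" by auto
    then show ?thesis using False by simp
  qed
  with sums show ?thesis by (rule sums_unique2)
qed

text \<open>The Taylor coefficients of \<open>(1 - u)\<^sup>n\<^sup>+\<^sup>k e\<^sup>k\<^sup>u\<close>; for \<open>i = n\<close> this is, up to sign, the value at \<open>k\<close>
  of the Laguerre polynomial of degree \<open>n\<close> and parameter \<open>k\<close>.\<close>

definition laguerre_coeff :: "nat \<Rightarrow> nat \<Rightarrow> nat \<Rightarrow> real" where
  "laguerre_coeff n k i = (\<Sum>l\<le>i. (- 1) ^ l * real (n + k choose l) * (real k ^ (i - l) / fact (i - l)))"

text \<open>After binomial expansion only products (x y)^i survive, and i \<le> n because x occurs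
  only in the factor of degree n. This is the origin of the triangular shape.\<close>

lemma integral_circle_laguerre:
  assumes c: "c > 0"
  shows "(\<integral>s. indicator {0..<2 * pi / c} s *\<^sub>R ((1 - x * cis (- (s * c))) ^ n * (1 - cis (s * c) * y) ^ (n + k) *
      exp (of_nat k * (cis (s * c) * y))) \<partial>lborel) =
    complex_of_real (2 * pi / c) * (\<Sum>i\<le>n. (- 1) ^ i * of_nat (n choose i) * complex_of_real (laguerre_coeff n k i) * (x * y) ^ i)"
proof -
  let ?I = "indicator {0..<2 * pi / c}" and ?T = "complex_of_real (2 * pi / c)"
  let ?b = "\<lambda>i l s. (x * cis (- (s * c))) ^ i * (cis (s * c) * y) ^ l * exp (of_nat k * (cis (s * c) * y))"
  let ?a = "\<lambda>i l. ((- 1) ^ i * of_nat (n choose i)) * ((- 1) ^ l * of_nat (n + k choose l)) :: complex"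
  have expand: "(1 - u) ^ p = (\<Sum>i\<le>p. ((- 1) ^ i * of_nat (p choose i)) * u ^ i)" for u :: complex and p
    using binomial_ring[of "- u" 1 p] by (simp add: power_minus[of u] mult_ac)
  have e: "?I s *\<^sub>R ((1 - x * cis (- (s * c))) ^ n * (1 - cis (s * c) * y) ^ (n + k) * exp (of_nat k * (cis (s * c) * y))) =
      (\<Sum>i\<le>n. \<Sum>l\<le>n + k. ?a i l * (?I s *\<^sub>R ?b i l s))" for s
    unfolding expand sum_product
    by (simp only: sum_distrib_right scaleR_sum_right)
      (intro sum.cong refl, simp add: scaleR_conv_of_real mult_ac)
  have int: "integrable lborel (\<lambda>s. ?a i l * (?I s *\<^sub>R ?b i l s))" for i l
  proof (intro integrable_mult_right integrable_Ico_bounded)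
    fix s
    have "cmod (exp (of_nat k * (cis (s * c) * y))) \<le> exp (cmod (of_nat k * (cis (s * c) * y)))" by (rule norm_exp)
    also have "\<dots> = exp (real k * cmod y)" by (simp add: norm_mult)
    finally have "cmod x ^ i * cmod y ^ l * cmod (exp (of_nat k * (cis (s * c) * y))) \<le> cmod x ^ i * cmod y ^ l * exp (real k * cmod y)"
      by (intro mult_left_mono) simp_all
    then show "cmod (?b i l s) \<le> cmod x ^ i * cmod y ^ l * exp (real k * cmod y)" by (simp add: norm_mult norm_power)
  qed measurable
  have inner: "(\<Sum>l\<le>n + k. ?a i l * (if l \<le> i then ?T * (x * y) ^ i * (of_nat k ^ (i - l) / fact (i - l)) else 0)) =
      ?T * ((- 1) ^ i * of_nat (n choose i) * complex_of_real (laguerre_coeff n k i) * (x * y) ^ i)" if i: "i \<le> n" for i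
  proof -
    have "(\<Sum>l\<le>n + k. ?a i l * (if l \<le> i then ?T * (x * y) ^ i * (of_nat k ^ (i - l) / fact (i - l)) else 0)) =
        (\<Sum>l\<le>i. ?a i l * (?T * (x * y) ^ i * (of_nat k ^ (i - l) / fact (i - l))))"
      using i by (intro sum.mono_neutral_cong_right) auto
    also have "\<dots> = ?T * ((- 1) ^ i * of_nat (n choose i) * complex_of_real (laguerre_coeff n k i) * (x * y) ^ i)"
      by (simp add: laguerre_coeff_def sum_distrib_left sum_distrib_right) (intro sum.cong refl, simp add: mult_ac)
    finally show ?thesis .
  qed
  have "(\<integral>s. (\<Sum>i\<le>n. \<Sum>l\<le>n + k. ?a i l * (?I s *\<^sub>R ?b i l s)) \<partial>lborel) =
      (\<Sum>i\<le>n. \<integral>s. (\<Sum>l\<le>n + k. ?a i l * (?I s *\<^sub>R ?b i l s)) \<partial>lborel)"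
    by (rule Bochner_Integration.integral_sum) (intro Bochner_Integration.integrable_sum int)
  also have "\<dots> = (\<Sum>i\<le>n. \<Sum>l\<le>n + k. \<integral>s. ?a i l * (?I s *\<^sub>R ?b i l s) \<partial>lborel)"
    by (intro sum.cong refl Bochner_Integration.integral_sum int)
  also have "\<dots> = (\<Sum>i\<le>n. \<Sum>l\<le>n + k. ?a i l * (if l \<le> i then ?T * (x * y) ^ i * (of_nat k ^ (i - l) / fact (i - l)) else 0))"
    by (simp only: integral_mult_right_zero integral_circle_exp[OF c])
  also have "\<dots> = (\<Sum>i\<le>n. ?T * ((- 1) ^ i * of_nat (n choose i) * complex_of_real (laguerre_coeff n k i) * (x * y) ^ i))"
    by (intro sum.cong refl inner) simp
  finally show ?thesis by (simp only: e sum_distrib_left)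
qed

text \<open>Individual values may vanish, for example \<open>laguerre_coeff 2 2 2 = 0\<close>.\<close>

lemma eventually_laguerre_coeff_nonzero: "\<forall>\<^sub>F k in sequentially. laguerre_coeff n k n \<noteq> 0"
proof -
  \<comment> \<open>The binomial coefficient is a product of l factors affine in k, divided by l!,
    so for fixed n the values are those of one polynomial in k.\<close>
  define p :: "real poly" where "p = (\<Sum>l\<le>n. smult ((- 1) ^ l / fact l / fact (n - l)) ((\<Prod>i<l. [:real n - real i, 1:]) * monom 1 (n - l)))"
  have p: "poly p (real k) = laguerre_coeff n k n" for k
  proof -
    have "real (n + k choose l) = (\<Prod>i<l. real n - real i + real k) / fact l" for l
      unfolding binomial_gbinomial gbinomial_prod_rev by (simp add: lessThan_atLeast0 algebra_simps)
    then show ?thesis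
      by (simp add: p_def laguerre_coeff_def poly_sum poly_prod poly_monom mult_ac add_ac)
  qed
  \<comment> \<open>At k = 0 each term with l < n contains a positive power of 0, and l = n leaves
    (- 1)^n.\<close>
  have "laguerre_coeff n 0 n = (\<Sum>l\<le>n. if l = n then (- 1) ^ n else 0)"
    unfolding laguerre_coeff_def by (intro sum.cong) auto
  then have "poly p 0 \<noteq> 0" using p[of 0] by simp
  then have "p \<noteq> 0" by auto
  then have "finite {x. poly p x = 0}" by (rule poly_roots_finite)
  then have "finite (real -` {x. poly p x = 0})" by (rule finite_vimageI) (simp add: inj_def)
  then obtain N where "\<forall>k\<in>real -` {x. poly p x = 0}. k < N" using finite_nat_set_iff_bounded by blast
  then show ?thesis using p by (intro eventually_sequentiallyI[of N]) force
qed


section \<open>Bounds for Gaussian and Poisson weights\<close>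

lemma exp_partial_sum_le:
  fixes x :: real
  assumes "x \<ge> 0" shows "(\<Sum>i<N. x ^ i / fact i) \<le> exp x"
proof -
  have s: "(\<lambda>i. x ^ i / fact i) sums exp x" using exp_converges[of x] by (simp add: divide_inverse mult.commute)
  then have "(\<Sum>i<N. x ^ i / fact i) \<le> (\<Sum>i. x ^ i / fact i)"
    using assms by (intro sum_le_suminf) (auto simp: sums_iff)
  then show ?thesis using s by (simp add: sums_iff)
qed

lemma power_le_fact_exp:
  fixes x :: real
  assumes "x \<ge> 0" shows "x ^ i / fact i \<le> exp x"
proof -
  have "x ^ i / fact i \<le> (\<Sum>i<Suc i. x ^ i / fact i)" using assms by (simp add: sum_nonneg)
  then show ?thesis using exp_partial_sum_le[OF assms, of "Suc i"] by linarith
qed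

lemma power_times_gaussian_le:
  fixes x q :: real
  assumes x: "x \<ge> 0" and q: "q > 0"
  shows "x ^ p * exp (- (q * x\<^sup>2)) \<le> fact p * exp (1 / (4 * q))"
proof -
  \<comment> \<open>Completing the square gives x \<le> q x^2 + 1 / (4 q); the power of x is
    absorbed by the exponential series.\<close>
  have "0 \<le> (2 * q * x - 1)\<^sup>2 / (4 * q)" using q by simp
  also have "(2 * q * x - 1)\<^sup>2 / (4 * q) = q * x\<^sup>2 - x + 1 / (4 * q)"
    using q by (simp add: power2_eq_square field_simps)
  finally have "x - q * x\<^sup>2 \<le> 1 / (4 * q)" by simp
  moreover have "x ^ p \<le> fact p * exp x" using power_le_fact_exp[OF x, of p] by (simp add: field_simps)
  then have "x ^ p * exp (- (q * x\<^sup>2)) \<le> fact p * exp x * exp (- (q * x\<^sup>2))" by (intro mult_right_mono) auto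
  then have "x ^ p * exp (- (q * x\<^sup>2)) \<le> fact p * exp (x - q * x\<^sup>2)" by (simp add: exp_diff exp_minus divide_inverse mult_ac)
  ultimately show ?thesis by (meson exp_le_cancel_iff fact_ge_zero mult_left_mono order_trans)
qed

lemma poisson_weight_le_1:
  fixes x :: real
  assumes "x \<ge> 0" shows "x ^ i / fact i * exp (- x) \<le> 1"
  using power_le_fact_exp[OF assms, of i] by (simp add: exp_minus field_simps)

section \<open>Gaussian moments at a visible frequency\<close>

context charged_geodesic
begin

text \<open>In the coordinate \<open>z\<close> of the plane of the geodesic, scaled so that the circle \<open>circ\<close> becomes the unit
  circle, \<open>Y \<mu> g = k |z g|\<^sup>2 / 2\<close>.\<close>

definition Y :: "'g \<Rightarrow> 'g \<Rightarrow> real" where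
  "Y \<mu> g = ((\<mu> \<bullet> br g \<nu>)\<^sup>2 + (\<mu> \<bullet> br g e1)\<^sup>2) / (4 * (\<mu> \<bullet> \<omega>))"

text \<open>The factor is a Poisson weight with parameter Y. These weights sum to 1 over i, so for Y
  \<ge> 0 the moments of an integrable f add up to \<open>fourier f (- \<mu>)\<close>.\<close>

definition moment :: "('g \<Rightarrow> complex) \<Rightarrow> 'g \<Rightarrow> nat \<Rightarrow> complex" where
  "moment f \<mu> i = (\<integral>g. f g * (cis (- (\<mu> \<bullet> g)) * complex_of_real (Y \<mu> g ^ i / fact i * exp (- Y \<mu> g))) \<partial>lborel)"

lemma Y_measurable [measurable]: "Y \<mu> \<in> borel_measurable borel"
proof -
  have [measurable]: "(\<lambda>g. br g h) \<in> borel_measurable borel" for h by (rule linear_measurable[OF linear_br(2)[OF H]])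
  show ?thesis unfolding Y_def[abs_def] by measurable
qed

text \<open>The test function has the polynomial part z^n (cnj z)^(n + k). The surplus of k
  conjugate factors compensates the rotation \<open>cis (s * c) ^ k\<close> coming from the
  character, so the mean is the character times a combination of Poisson weights of order at most
  n.\<close>

lemma moment_relation:
  assumes f: "integrable lborel f" and o: "orth f" and \<mu>: "\<mu> \<in> center br" and k: "k > 0"
    and \<mu>k: "\<mu> \<bullet> \<omega> = 2 * c\<^sup>2 * real k"
  shows "(\<Sum>i\<le>n. complex_of_real ((- 1) ^ i * real (n choose i) * laguerre_coeff n k i * ((2 / real k) ^ i * fact i)) * moment f \<mu> i) = 0"
proof -
  let ?h = "\<mu> \<bullet> \<omega>"
  have h: "?h > 0" using c_pos k by (simp add: \<mu>k)
  have [measurable]: "(\<lambda>g. br g h) \<in> borel_measurable borel" for h by (rule linear_measurable[OF linear_br(2)[OF H]])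
  have Y0: "Y \<mu> g \<ge> 0" for g using h by (simp add: Y_def)
  \<comment> \<open>Scaled by c / ?h so that right multiplication by the inverse geodesic becomes
    \<open>z g - cis (s * c)\<close>, a translation by the unit circle.\<close>
  define z where "z g = complex_of_real (c * (\<mu> \<bullet> br g \<nu>) / ?h) - \<i> * complex_of_real (c * (\<mu> \<bullet> br g e1) / ?h)" for g
  have Re_z: "Re (z g) = c * (\<mu> \<bullet> br g \<nu>) / ?h" and Im_z: "Im (z g) = - (c * (\<mu> \<bullet> br g e1) / ?h)" for g
    by (simp_all add: z_def)
  have [measurable]: "z \<in> borel_measurable borel" unfolding z_def[abs_def] by measurable
  have norm_z: "(cmod (z g))\<^sup>2 = 2 * Y \<mu> g / real k" for g
  proof -
    have "(cmod (z g))\<^sup>2 = c\<^sup>2 * (((\<mu> \<bullet> br g \<nu>)\<^sup>2 + (\<mu> \<bullet> br g e1)\<^sup>2) / ?h\<^sup>2)"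
      by (simp add: cmod_power2 Re_z Im_z power_mult_distrib power_divide add_divide_distrib distrib_left)
    also have "(((\<mu> \<bullet> br g \<nu>)\<^sup>2 + (\<mu> \<bullet> br g e1)\<^sup>2) / ?h\<^sup>2) = 4 * Y \<mu> g / ?h"
      using h by (simp add: Y_def power2_eq_square[of ?h] field_simps)
    also have "c\<^sup>2 * (4 * Y \<mu> g / ?h) = 2 * Y \<mu> g / real k" using lam k by (simp add: \<mu>k field_simps)
    finally show ?thesis .
  qed
  have z_cnj: "z g * cnj (z g) = complex_of_real (2 * Y \<mu> g / real k)" for g
    using complex_norm_square[of "z g"] by (simp only: norm_z)
  have self: "br e1 e1 = 0" "br \<nu> \<nu> = 0" using H by (simp_all add: H_type_def lie_bracket_def)
  have "\<mu> \<bullet> br (circ \<theta>) \<nu> = cos \<theta> * ?h / c" "\<mu> \<bullet> br (circ \<theta>) e1 = - (sin \<theta> * ?h / c)" for \<theta>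
    using br_e1_\<nu>[OF \<mu>] br_\<nu>_e1[OF \<mu>] self
    by (simp_all add: circ_def linear_scale[OF linear_br(2)[OF H]] linear_add[OF linear_br(2)[OF H]] inner_add_right)
  then have z_shift: "z (gmul br g (- \<gamma> s)) = z g - cis (s * c)" for g s
    using h c_pos by (simp add: complex_eq_iff Re_z Im_z br_gmul_\<gamma> inner_diff_right field_simps)
  \<comment> \<open>The Gaussian turns the twist of the mean into the holomorphic factor \<open>exp (k w cnj z)\<close>.\<close>
  define a where "a g = z g ^ n * cnj (z g) ^ (n + k) * complex_of_real (exp (- (real k / 2 * (cmod (z g))\<^sup>2)))" for g
  have "cnj \<in> borel_measurable borel"
    by (intro borel_measurable_continuous_onI continuous_intros)
  then have [measurable]: "(\<lambda>g. cnj (z g)) \<in> borel_measurable borel" by measurable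
  have [measurable]: "a \<in> borel_measurable borel" unfolding a_def[abs_def] by measurable
  have a_bound: "cmod (a g) \<le> fact (n + (n + k)) * exp (1 / (4 * (real k / 2)))" for g
    using power_times_gaussian_le[of "cmod (z g)" "real k / 2" "n + (n + k)"] k
    by (simp add: a_def norm_mult norm_power power_add)
  \<comment> \<open>Over one generator the character turns by exactly - 2 \<pi> k: this is the
    visibility of \<mu>.\<close>
  have per: "cis (- (\<mu> \<bullet> (g + (pi / c\<^sup>2) *\<^sub>R \<omega>))) * a (g + (pi / c\<^sup>2) *\<^sub>R \<omega>) = cis (- (\<mu> \<bullet> g)) * a g" for g
  proof -
    have "z (g + (pi / c\<^sup>2) *\<^sub>R \<omega>) = z g"
      by (simp add: z_def linear_add[OF linear_br(2)[OF H]] br_center_left[OF \<omega>_center])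
    moreover have "- (\<mu> \<bullet> (g + (pi / c\<^sup>2) *\<^sub>R \<omega>)) = - (\<mu> \<bullet> g) + 2 * pi * real_of_int (- int k)"
      using c_pos by (simp add: inner_add_right \<mu>k)
    moreover have "cis (2 * pi * real_of_int m) = 1" for m by (simp add: complex_eq_iff cos_int_2pin sin_int_2pin)
    ultimately show ?thesis by (simp only: a_def cis_mult[symmetric] mult_1_right)
  qed
  let ?\<phi> = "\<lambda>g. cis (- (\<mu> \<bullet> g)) * a g"
  let ?K = "(- 1) ^ k * complex_of_real (2 * pi / c * exp (- (real k / 2)))"
  let ?w = "\<lambda>i. complex_of_real ((- 1) ^ i * real (n choose i) * laguerre_coeff n k i * ((2 / real k) ^ i * fact i))"
  let ?b = "\<lambda>i g. cis (- (\<mu> \<bullet> g)) * complex_of_real (Y \<mu> g ^ i / fact i * exp (- Y \<mu> g))"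
  have integrand: "cis (s * (\<mu> \<bullet> \<omega>) / (2 * c)) * cis ((\<mu> \<bullet> br g (circ (s * c))) / 2) * a (gmul br g (- \<gamma> s)) =
      (- 1) ^ k * complex_of_real (exp (- (real k / 2)) * exp (- Y \<mu> g)) *
      ((1 - z g * cis (- (s * c))) ^ n * (1 - cis (s * c) * cnj (z g)) ^ (n + k) * exp (of_nat k * (cis (s * c) * cnj (z g))))" for g s
  proof -
    define w where "w = cis (s * c)"
    define Z where "Z = z g"
    have ww: "w * cnj w = 1" by (simp add: w_def cis_cnj cis_mult)
    have 1: "cis (s * (\<mu> \<bullet> \<omega>) / (2 * c)) = w ^ k"
      using c_pos by (simp add: w_def Complex.DeMoivre \<mu>k power2_eq_square mult_ac)
    have 2: "(\<mu> \<bullet> br g (circ (s * c))) / 2 = real k * Im (w * cnj Z)"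
    proof -
      have "real k * Im (w * cnj Z) = (real k * c / ?h) * (cos (s * c) * (\<mu> \<bullet> br g e1) + sin (s * c) * (\<mu> \<bullet> br g \<nu>))"
        by (simp add: w_def Z_def Re_z Im_z add_divide_distrib distrib_left mult_ac)
      also have "real k * c / ?h = 1 / (2 * c)" using c_pos k by (simp add: \<mu>k power2_eq_square)
      finally show ?thesis by (simp add: br_circ inner_add_right)
    qed
    have "(cmod (Z - w))\<^sup>2 = (cmod Z)\<^sup>2 + 1 - 2 * Re (w * cnj Z)"
    proof -
      have "(Re w)\<^sup>2 + (Im w)\<^sup>2 = 1" by (simp add: w_def)
      then show ?thesis by (simp add: cmod_power2 power2_diff algebra_simps)
    qed
    then have 3: "- (real k / 2 * (cmod (Z - w))\<^sup>2) = - (real k / 2) + (- Y \<mu> g + real k * Re (w * cnj Z))"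
      using k norm_z[of g] by (simp add: Z_def field_simps)
    have 4: "cis (real k * Im u) * complex_of_real (exp (real k * Re u)) = exp (of_nat k * u)" for u
      using exp_eq_polar[of "of_nat k * u"] by (simp add: mult.commute)
    \<comment> \<open>Extracting - w and - cnj w from the factors leaves (w cnj w)^n and (- w cnj
      w)^k, where w cnj w = 1.\<close>
    have 5: "w ^ k * ((Z - w) ^ n * cnj (Z - w) ^ (n + k)) = (- 1) ^ k * ((1 - Z * cnj w) ^ n * (1 - w * cnj Z) ^ (n + k))"
    proof -
      have "Z - w = - w * (1 - Z * cnj w)" "cnj (Z - w) = - cnj w * (1 - w * cnj Z)"
        using ww by (simp_all add: algebra_simps)
      then have "w ^ k * ((Z - w) ^ n * cnj (Z - w) ^ (n + k)) =
          w ^ k * (((- w) ^ n * (1 - Z * cnj w) ^ n) * ((- cnj w) ^ (n + k) * (1 - w * cnj Z) ^ (n + k)))"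
        by (simp only: power_mult_distrib)
      also have "\<dots> = (w ^ k * (- w) ^ n * (- cnj w) ^ (n + k)) * ((1 - Z * cnj w) ^ n * (1 - w * cnj Z) ^ (n + k))"
        by (simp only: mult_ac)
      also have "w ^ k * (- w) ^ n * (- cnj w) ^ (n + k) = ((- w) * (- cnj w)) ^ n * (w * (- cnj w)) ^ k"
        by (simp only: power_mult_distrib power_add mult_ac)
      also have "\<dots> = (- 1) ^ k" using ww by simp
      finally show ?thesis .
    qed
    have "cis (s * (\<mu> \<bullet> \<omega>) / (2 * c)) * cis ((\<mu> \<bullet> br g (circ (s * c))) / 2) * a (gmul br g (- \<gamma> s)) =
        w ^ k * cis (real k * Im (w * cnj Z)) * ((Z - w) ^ n * cnj (Z - w) ^ (n + k) *
        complex_of_real (exp (- (real k / 2)) * (exp (- Y \<mu> g) * exp (real k * Re (w * cnj Z)))))"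
      unfolding a_def z_shift 1 2 w_def[symmetric] Z_def[symmetric] 3 exp_add ..
    also have "\<dots> = complex_of_real (exp (- (real k / 2)) * exp (- Y \<mu> g)) *
        (w ^ k * ((Z - w) ^ n * cnj (Z - w) ^ (n + k))) * (cis (real k * Im (w * cnj Z)) * complex_of_real (exp (real k * Re (w * cnj Z))))"
      by (simp only: of_real_mult mult_ac)
    finally show ?thesis
      unfolding 4 5 by (simp only: w_def Z_def cis_cnj mult_ac)
  qed
  have mean: "geodesic_mean ?\<phi> g = ?K * (\<Sum>i\<le>n. ?w i * ?b i g)" for g
  proof -
    have "geodesic_mean ?\<phi> g = cis (- (\<mu> \<bullet> g)) * ((- 1) ^ k * complex_of_real (exp (- (real k / 2)) * exp (- Y \<mu> g)) *
        (complex_of_real (2 * pi / c) * (\<Sum>i\<le>n. (- 1) ^ i * of_nat (n choose i) * complex_of_real (laguerre_coeff n k i) * (z g * cnj (z g)) ^ i)))"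
      unfolding geodesic_mean_character[OF \<mu>] integrand integral_circle_laguerre[OF c_pos, symmetric]
        integral_mult_right_zero[symmetric] mult_scaleR_right ..
    also have "\<dots> = ?K * (\<Sum>i\<le>n. ?w i * ?b i g)"
      unfolding z_cnj
      by (simp add: sum_distrib_left power_divide power_mult_distrib) (intro sum.cong refl, simp add: field_simps)
    finally show ?thesis .
  qed
  have b_bound: "cmod (?b i g) \<le> 1" for i g
    using poisson_weight_le_1[OF Y0[of g], of i] Y0[of g]
    by (simp add: norm_mult norm_divide norm_power)
  have int: "integrable lborel (\<lambda>g. f g * ?b i g)" for i
    by (rule integrable_mult_bounded[OF f _ b_bound]) measurable
  have "0 = (\<integral>g. f g * geodesic_mean ?\<phi> g \<partial>lborel)"
  proof (rule orthD[OF o, where \<phi> = ?\<phi>, OF _ _ per, symmetric])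
    show "cmod (?\<phi> g) \<le> fact (n + (n + k)) * exp (1 / (4 * (real k / 2)))" for g
      by (simp only: norm_mult norm_cis mult_1_left a_bound)
  qed measurable
  also have "\<dots> = (\<integral>g. ?K * (\<Sum>i\<le>n. ?w i * (f g * ?b i g)) \<partial>lborel)"
    unfolding mean by (intro Bochner_Integration.integral_cong refl) (simp only: sum_distrib_left mult_ac)
  also have "\<dots> = ?K * (\<Sum>i\<le>n. ?w i * moment f \<mu> i)"
    unfolding moment_def integral_mult_right_zero
    by (subst Bochner_Integration.integral_sum) (use int in \<open>auto simp del: of_real_mult of_real_divide of_real_power\<close>)
  finally show ?thesis using c_pos by simp
qed

text \<open>Solves the triangular system: in the relation of order n the lower moments already
  vanish, and the last coefficient is a nonzero multiple of
  \<open>laguerre_coeff n k n\<close>.\<close>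

lemma moment_eq_0:
  assumes f: "integrable lborel f" and o: "orth f" and \<mu>: "\<mu> \<in> center br" and k: "k > 0"
    and \<mu>k: "\<mu> \<bullet> \<omega> = 2 * c\<^sup>2 * real k" and L: "\<And>i. i \<le> n \<Longrightarrow> laguerre_coeff i k i \<noteq> 0"
  shows "moment f \<mu> n = 0"
  using L
proof (induction n rule: less_induct)
  case (less n)
  let ?w = "\<lambda>i. complex_of_real ((- 1) ^ i * real (n choose i) * laguerre_coeff n k i * ((2 / real k) ^ i * fact i))"
  have "(\<Sum>i\<le>n. ?w i * moment f \<mu> i) = ?w n * moment f \<mu> n + (\<Sum>i\<in>{..n} - {n}. ?w i * moment f \<mu> i)"
    by (rule sum.remove) simp_all
  also have "(\<Sum>i\<in>{..n} - {n}. ?w i * moment f \<mu> i) = 0"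
    using less.IH less.prems by (intro sum.neutral) (auto simp: less_le)
  finally have "?w n * moment f \<mu> n = 0"
    using moment_relation[OF f o \<mu> k \<mu>k, of n] by simp
  then show ?case using less.prems[of n] k by simp
qed

end

text \<open>How large k must be depends on the order of the moment. Hence the limit along the
  charges is taken for each order separately, and the moments are summed only at the limit
  frequency.\<close>

lemma fourier_eq_0_if_charges_tend_to_0:
  fixes lam \<nu> :: "nat \<Rightarrow> 'g::euclidean_space"
  assumes H: "H_type br" and f: "integrable lborel f"
    and G: "\<And>n. charged_geodesic br (lam n) (\<nu> n)" and o: "\<And>n. charged_geodesic.orth br (lam n) (\<nu> n) f"
    and lim: "lam \<longlonglongrightarrow> 0" "(\<lambda>n. sgn (lam n)) \<longlonglongrightarrow> \<omega>" "\<nu> \<longlonglongrightarrow> E2" "(\<lambda>n. charged_geodesic.e1 br (lam n) (\<nu> n)) \<longlonglongrightarrow> E1"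
    and \<mu>: "\<mu> \<in> center br" "\<mu> \<bullet> \<omega> > 0"
  shows "fourier f (- \<mu>) = 0"
proof -
  define c where "c n = norm (lam n)" for n
  define w where "w n = sgn (lam n)" for n
  have c: "c n > 0" for n using G[of n] by (simp add: c_def charged_geodesic_def)
  have w1: "norm (w n) = 1" for n using c[of n] by (simp add: w_def c_def norm_sgn)
  have w_center: "a *\<^sub>R w n \<in> center br" for a n
    using charged_geodesic.\<omega>_center[OF G] by (simp add: w_def)
  have c0: "c \<longlonglongrightarrow> 0" using tendsto_norm[OF lim(1)] by (simp add: c_def[abs_def])
  have \<mu>w: "(\<lambda>n. \<mu> \<bullet> w n) \<longlonglongrightarrow> \<mu> \<bullet> \<omega>" unfolding w_def by (intro tendsto_intros lim)
  \<comment> \<open>The index of the visible hyperplane just below \<mu>; the truncation by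
    \<open>nat\<close> is harmless because \<mu> \<bullet> w n is eventually positive. Moving \<mu>
    along w n by \<delta> n, eventually at most one spacing 2 (c n)^2, makes it visible.\<close>
  define k where "k n = nat \<lfloor>\<mu> \<bullet> w n / (2 * (c n)\<^sup>2)\<rfloor>" for n
  define \<delta> where "\<delta> n = 2 * (c n)\<^sup>2 * real (k n) - \<mu> \<bullet> w n" for n
  define \<mu>' where "\<mu>' n = \<mu> + \<delta> n *\<^sub>R w n" for n
  have \<mu>'_center: "\<mu>' n \<in> center br" for n
    unfolding \<mu>'_def by (intro subspace_add subspace_center H \<mu> w_center)
  have \<mu>'w: "\<mu>' n \<bullet> w n = 2 * (c n)\<^sup>2 * real (k n)" for n
    using w1[of n] by (simp add: \<mu>'_def \<delta>_def inner_add_left dot_square_norm)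
  have half: "\<forall>\<^sub>F n in sequentially. \<mu> \<bullet> w n > (\<mu> \<bullet> \<omega>) / 2" using \<mu>(2) by (intro order_tendstoD(1)[OF \<mu>w]) simp
  have \<delta>_bound: "\<forall>\<^sub>F n in sequentially. \<bar>\<delta> n\<bar> \<le> 2 * (c n)\<^sup>2"
    using half
  proof eventually_elim
    case (elim n)
    let ?x = "\<mu> \<bullet> w n / (2 * (c n)\<^sup>2)"
    have "?x \<ge> 0" using elim \<mu>(2) by simp
    then have "real (k n) \<le> ?x" "?x \<le> real (k n) + 1" unfolding k_def by linarith+
    then show ?case using c[of n] by (simp add: \<delta>_def field_simps abs_le_iff)
  qed
  have "(\<lambda>n. 2 * (c n)\<^sup>2) \<longlonglongrightarrow> 2 * 0\<^sup>2" by (intro tendsto_intros c0)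
  then have "\<delta> \<longlonglongrightarrow> 0"
    using \<delta>_bound by (intro Lim_null_comparison[of \<delta> "\<lambda>n. 2 * (c n)\<^sup>2"]) auto
  then have "(\<lambda>n. \<mu> + \<delta> n *\<^sub>R w n) \<longlonglongrightarrow> \<mu> + 0 *\<^sub>R \<omega>"
    unfolding w_def by (intro tendsto_intros lim)
  then have \<mu>': "\<mu>' \<longlonglongrightarrow> \<mu>" by (simp add: \<mu>'_def[abs_def])
  have k_top: "filterlim k at_top sequentially"
    unfolding filterlim_at_top
  proof
    fix K :: nat
    have "((\<mu> \<bullet> \<omega>) / 2) / (2 * (real K + 1)) > 0" using \<mu>(2) by simp
    from order_tendstoD(2)[OF \<open>(\<lambda>n. 2 * (c n)\<^sup>2) \<longlonglongrightarrow> 2 * 0\<^sup>2\<close>, of "((\<mu> \<bullet> \<omega>) / 2) / (real K + 1)"] \<mu>(2)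
    have "\<forall>\<^sub>F n in sequentially. 2 * (c n)\<^sup>2 < ((\<mu> \<bullet> \<omega>) / 2) / (real K + 1)" by simp
    with half show "\<forall>\<^sub>F n in sequentially. K \<le> k n"
    proof eventually_elim
      case (elim n)
      have "real K + 1 \<le> \<mu> \<bullet> w n / (2 * (c n)\<^sup>2)" using elim c[of n] by (simp add: field_simps)
      then show ?case unfolding k_def by linarith
    qed
  qed
  define Yn where "Yn n = charged_geodesic.Y br (lam n) (\<nu> n) (\<mu>' n)" for n
  \<comment> \<open>Y involves the charge only through its direction and the frame e1, \<nu>, not
    through its length, so it converges although c n tends to 0.\<close>
  define Yl where "Yl g = ((\<mu> \<bullet> br g E2)\<^sup>2 + (\<mu> \<bullet> br g E1)\<^sup>2) / (4 * (\<mu> \<bullet> \<omega>))" for g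
  have Yn_eq: "Yn n g = ((\<mu>' n \<bullet> br g (\<nu> n))\<^sup>2 + (\<mu>' n \<bullet> br g (charged_geodesic.e1 br (lam n) (\<nu> n)))\<^sup>2) / (4 * (\<mu>' n \<bullet> w n))" for n g
    unfolding Yn_def charged_geodesic.Y_def[OF G] w_def ..
  have Yn0: "Yn n g \<ge> 0" for n g using c[of n] by (simp add: Yn_eq \<mu>'w)
  have Yl0: "Yl g \<ge> 0" for g using \<mu>(2) by (simp add: Yl_def)
  have Y_lim: "(\<lambda>n. Yn n g) \<longlonglongrightarrow> Yl g" for g
  proof -
    have bl: "bounded_linear (br g)" using linear_br(1)[OF H, of g] by (simp add: linear_conv_bounded_linear)
    have "(\<lambda>n. w n) \<longlonglongrightarrow> \<omega>" unfolding w_def by (rule lim)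
    then show ?thesis unfolding Yn_eq Yl_def using \<mu>(2)
      by (intro tendsto_intros \<mu>' bounded_linear.tendsto[OF bl] lim) auto
  qed
  have Yn_meas [measurable]: "Yn n \<in> borel_measurable borel" for n
    unfolding Yn_def by (rule charged_geodesic.Y_measurable[OF G])
  have [measurable]: "Yl \<in> borel_measurable borel"
    by (rule borel_measurable_LIMSEQ_metric[OF Yn_meas Y_lim])
  have moment: "\<forall>\<^sub>F n in sequentially. charged_geodesic.moment br (lam n) (\<nu> n) f (\<mu>' n) i = 0" for i
  proof -
    have "\<forall>\<^sub>F m in sequentially. \<forall>j\<in>{..i}. laguerre_coeff j m j \<noteq> 0"
      by (intro eventually_ball_finite ballI eventually_laguerre_coeff_nonzero) simp
    then have "\<forall>\<^sub>F n in sequentially. \<forall>j\<in>{..i}. laguerre_coeff j (k n) j \<noteq> 0"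
      using k_top by (rule eventually_compose_filterlim)
    moreover have "\<forall>\<^sub>F n in sequentially. 1 \<le> k n" using k_top by (simp add: filterlim_at_top)
    ultimately show ?thesis
    proof eventually_elim
      case (elim n)
      show ?case
        using charged_geodesic.moment_eq_0[OF G f o \<mu>'_center, of "k n" n n i] elim \<mu>'w[of n]
        by (simp add: w_def c_def)
    qed
  qed
  let ?b = "\<lambda>i g. cis (- (\<mu> \<bullet> g)) * complex_of_real (Yl g ^ i / fact i * exp (- Yl g))"
  have b_bound: "cmod (cis t * complex_of_real (y ^ i / fact i * exp (- y))) \<le> 1" if "y \<ge> 0" for t y i
    using poisson_weight_le_1[OF that, of i] that by (simp add: norm_mult norm_divide norm_power)
  have zero: "(\<integral>g. f g * ?b i g \<partial>lborel) = 0" for i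
  proof -
    have "(\<lambda>n. \<integral>g. f g * (cis (- (\<mu>' n \<bullet> g)) * complex_of_real (Yn n g ^ i / fact i * exp (- Yn n g))) \<partial>lborel)
        \<longlonglongrightarrow> (\<integral>g. f g * ?b i g \<partial>lborel)"
    proof (rule integral_mult_bounded_limit[OF f, where C = 1])
      show "(\<lambda>n. cis (- (\<mu>' n \<bullet> g)) * complex_of_real (Yn n g ^ i / fact i * exp (- Yn n g))) \<longlonglongrightarrow> ?b i g" for g
        by (intro tendsto_intros tendsto_cis \<mu>' Y_lim) simp
    qed (use b_bound[OF Yn0] in auto)
    moreover have "(\<lambda>n. \<integral>g. f g * (cis (- (\<mu>' n \<bullet> g)) * complex_of_real (Yn n g ^ i / fact i * exp (- Yn n g))) \<partial>lborel) \<longlonglongrightarrow> 0"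
      using moment[of i] unfolding charged_geodesic.moment_def[OF G] Yn_def by (rule tendsto_eventually)
    ultimately show ?thesis by (rule LIMSEQ_unique)
  qed
  have int: "integrable lborel (\<lambda>g. f g * ?b i g)" for i
    by (rule integrable_mult_bounded[OF f _ b_bound[OF Yl0]]) measurable
  \<comment> \<open>Partial sums of Poisson weights tend to 1 and never exceed it, so the norm of f
    is a dominating function.\<close>
  have "(\<lambda>N. \<integral>g. f g * (\<Sum>i<N. ?b i g) \<partial>lborel) \<longlonglongrightarrow> (\<integral>g. f g * cis (- (\<mu> \<bullet> g)) \<partial>lborel)"
  proof (rule integral_mult_bounded_limit[OF f, where C = 1])
    fix g
    have sum: "(\<Sum>i<N. ?b i g) = cis (- (\<mu> \<bullet> g)) * complex_of_real ((\<Sum>i<N. Yl g ^ i / fact i) * exp (- Yl g))" for N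
      by (simp only: sum_distrib_left sum_distrib_right of_real_sum)
    have "(\<lambda>i. Yl g ^ i / fact i) sums exp (Yl g)"
      using exp_converges[of "Yl g"] by (simp add: divide_inverse mult.commute)
    then have "(\<lambda>N. cis (- (\<mu> \<bullet> g)) * complex_of_real ((\<Sum>i<N. Yl g ^ i / fact i) * exp (- Yl g)))
        \<longlonglongrightarrow> cis (- (\<mu> \<bullet> g)) * complex_of_real (exp (Yl g) * exp (- Yl g))"
      unfolding sums_def by (intro tendsto_intros)
    then show "(\<lambda>N. \<Sum>i<N. ?b i g) \<longlonglongrightarrow> cis (- (\<mu> \<bullet> g))"
      unfolding sum by (simp flip: exp_add)
    fix N
    have "(\<Sum>i<N. Yl g ^ i / fact i) * exp (- Yl g) \<le> exp (Yl g) * exp (- Yl g)"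
      using exp_partial_sum_le[OF Yl0] by (intro mult_right_mono) auto
    also have "\<dots> = 1" by (simp flip: exp_add)
    finally show "cmod (\<Sum>i<N. ?b i g) \<le> 1"
      unfolding sum norm_mult norm_cis norm_of_real using Yl0[of g] by (simp add: sum_nonneg abs_mult)
  qed measurable
  moreover have "(\<integral>g. f g * (\<Sum>i<N. ?b i g) \<partial>lborel) = 0" for N
    unfolding sum_distrib_left by (subst Bochner_Integration.integral_sum[OF int]) (simp only: zero sum.neutral_const)
  ultimately show ?thesis by (simp add: LIMSEQ_const_iff fourier_def)
qed


section \<open>Injectivity\<close>

lemma fourier_cnj: "fourier (\<lambda>x. cnj (f x)) \<xi> = cnj (fourier f (- \<xi>))"
  unfolding fourier_def Bochner_Integration.integral_cnj[symmetric]
  by (intro Bochner_Integration.integral_cong) (simp_all add: cis_cnj inner_minus_left)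

lemma integrable_translate:
  fixes f :: "'g::euclidean_space \<Rightarrow> complex"
  assumes "H_type br" "integrable lborel f"
  shows "integrable lborel (\<lambda>g. f (gmul br g0 g))"
proof -
  note [measurable (raw)] = gmul_measurable[OF assms(1)]
  have "gmul br g0 \<in> lborel \<rightarrow>\<^sub>M borel" by measurable
  moreover have "f \<in> borel_measurable borel" using assms(2) by simp
  ultimately have "integrable (distr lborel borel (gmul br g0)) f \<longleftrightarrow> integrable lborel (\<lambda>g. f (gmul br g0 g))"
    by (rule integrable_distr_eq)
  then show ?thesis using assms by (simp add: distr_lborel_gmul)
qed

lemma injectivity_set_if_dense:
  fixes Z :: "'g::euclidean_space set"
  assumes H: "H_type br" and Z: "Z \<subseteq> center br - {0}"
    and dense: "center br \<subseteq> closure (\<Union>lam\<in>Z. visible br lam)"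
  shows "injectivity_set br Z"
  unfolding injectivity_set_def
proof (intro allI impI)
  fix f :: "'g \<Rightarrow> complex"
  assume "integrable lborel f \<and> zero_set br f Z"
  then have f: "integrable lborel f" and zs: "zero_set br f Z" by auto
  have fm: "f \<in> borel_measurable borel" using f by simp
  have "\<exists>\<nu>. charged_geodesic br lam \<nu> \<and> charged_geodesic.orth br lam \<nu> f" if "lam \<in> Z" for lam
  proof -
    have "\<exists>\<nu>\<in>hor br. norm \<nu> = 1 \<and> (AE q in quot_haar br lam. xray br \<nu> lam f q = 0)"
      using zs that unfolding zero_set_def by (rule bspec)
    then obtain \<nu> where nu: "\<nu> \<in> hor br" "norm \<nu> = 1" "AE q in quot_haar br lam. xray br \<nu> lam f q = 0"
      by (elim bexE conjE)
    have lam: "lam \<in> center br" "lam \<noteq> 0" using Z that by auto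
    interpret charged_geodesic br lam \<nu> by unfold_locales (fact H lam nu)+
    have "orth f"
      unfolding orth_def
    proof (intro ballI impI)
      fix \<phi> :: "'g \<Rightarrow> complex"
      assume m: "\<phi> \<in> borel_measurable borel" and b: "\<exists>B. \<forall>g. cmod (\<phi> g) \<le> B"
        and per: "\<forall>g. \<phi> (g + (pi / c\<^sup>2) *\<^sub>R \<omega>) = \<phi> g"
      obtain B where "\<And>g. cmod (\<phi> g) \<le> B" using b by blast
      then show "(\<integral>g. f g * geodesic_mean \<phi> g \<partial>lborel) = 0"
        using per by (intro orthogonal_geodesic_mean[OF f nu(3) m]) auto
    qed
    then show ?thesis using charged_geodesic_axioms by blast
  qed
  then obtain \<nu> where G: "\<And>lam. lam \<in> Z \<Longrightarrow> charged_geodesic br lam (\<nu> lam)"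
    and o: "\<And>lam. lam \<in> Z \<Longrightarrow> charged_geodesic.orth br lam (\<nu> lam) f" by metis
  have cont: "continuous_on UNIV (\<lambda>\<mu>. fourier f (\<eta> - \<mu>))" for \<eta>
    by (rule continuous_on_compose2[OF continuous_fourier[OF f]]) (auto intro: continuous_intros)
  have closed: "closed {\<mu>. fourier f (\<eta> - \<mu>) = 0}" for \<eta>
    by (intro closed_Collect_eq cont continuous_on_const)
  have main: "fourier f (\<eta> - \<mu>) = 0" if \<eta>: "\<eta> \<in> hor br" and \<mu>: "\<mu> \<in> center br" for \<eta> \<mu>
  proof (cases "\<exists>r>0. \<forall>lam\<in>Z. norm lam \<ge> r")
    case True
    then obtain r where r: "r > 0" "\<And>lam. lam \<in> Z \<Longrightarrow> norm lam \<ge> r" by auto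
    \<comment> \<open>The frequencies of index 0 form a cone; 0 is left out because left
      translations move only nonzero central frequencies to all horizontal shifts.\<close>
    define W where "W = {w \<in> center br. w \<noteq> 0 \<and> (\<exists>lam\<in>Z. w \<bullet> lam = 0)}"
    have "W \<subseteq> {\<mu>. fourier f (\<eta> - \<mu>) = 0}"
    proof (intro subsetI CollectI)
      fix w assume "w \<in> W"
      then obtain lam where w: "w \<in> center br" "w \<noteq> 0" "lam \<in> Z" "w \<bullet> lam = 0" by (auto simp: W_def)
      interpret charged_geodesic br lam "\<nu> lam" by (rule G[OF w(3)])
      show "fourier f (\<eta> - w) = 0"
        by (rule fourier_eq_0_if_translates[OF H fm w(1,2) _ \<eta>])
          (rule fourier_eq_0_if_orthogonal_to_charge[OF integrable_translate[OF H f] orth_translate[OF fm o[OF w(3)]] w(1,4)])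
    qed
    moreover have "\<mu> \<in> closure W"
      unfolding closure_approachable
    proof (intro allI impI)
      fix e :: real assume e: "e > 0"
      obtain u0 where u0: "u0 \<in> center br" "u0 \<noteq> 0" using H subspace_0[OF subspace_center[OF H]] by (auto simp: H_type_def)
      obtain u where u: "u \<in> center br" "u \<noteq> 0" "norm (u - \<mu>) < e / 2"
      proof (cases "\<mu> = 0")
        case True
        have "norm ((e / (4 * norm u0)) *\<^sub>R u0) < e / 2" using u0 e by simp
        then show thesis using u0 e True by (intro that[of "(e / (4 * norm u0)) *\<^sub>R u0"] center_scale H) auto
      qed (use \<mu> e that[of \<mu>] in auto)
      \<comment> \<open>Rescaled to norm r^2, the frequency is far from all visible frequencies of
        nonzero index, whose norm is at least 2 r^2.\<close>
      define t where "t = r\<^sup>2 / norm u"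
      have t: "t > 0" "norm (t *\<^sub>R u) = r\<^sup>2" using r u by (simp_all add: t_def)
      have "t *\<^sub>R u \<in> closure (\<Union>lam\<in>Z. visible br lam)" using dense center_scale[OF H u(1)] by blast
      \<comment> \<open>The first bound gives accuracy e / 2 after scaling back; the second keeps v
        nonzero and its norm below 2 r^2.\<close>
      moreover have "min (t * (e / 2)) (r\<^sup>2 / 2) > 0" using t e r by simp
      ultimately obtain lam v where v: "lam \<in> Z" "v \<in> visible br lam" "dist v (t *\<^sub>R u) < min (t * (e / 2)) (r\<^sup>2 / 2)"
        unfolding closure_approachable by blast
      have vd: "norm (v - t *\<^sub>R u) < t * (e / 2)" "norm (v - t *\<^sub>R u) < r\<^sup>2 / 2" using v(3) by (simp_all add: dist_norm)
      have "r\<^sup>2 > 0" using r by simp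
      moreover have "norm v \<le> r\<^sup>2 + norm (v - t *\<^sub>R u)"
        using norm_triangle_ineq[of "t *\<^sub>R u" "v - t *\<^sub>R u"] unfolding t(2) by simp
      ultimately have v_upper: "norm v < 2 * r\<^sup>2" using vd(2) by linarith
      have v0: "v \<noteq> 0" using vd(2) t(2) r by auto
      obtain k :: int where k: "v \<bullet> lam = 2 * norm lam ^ 3 * of_int k" and vc: "v \<in> center br"
        using v(2) by (auto simp: visible_def)
      have lam: "norm lam \<ge> r" "norm lam > 0" using r(1) r(2)[OF v(1)] by linarith+
      have "2 * norm lam ^ 3 * \<bar>real_of_int k\<bar> = \<bar>v \<bullet> lam\<bar>" by (simp add: k abs_mult)
      also have "\<dots> \<le> norm v * norm lam" by (rule Cauchy_Schwarz_ineq2)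
      also have "\<dots> < 2 * r\<^sup>2 * norm lam" using v_upper lam by (intro mult_strict_right_mono) auto
      also have "\<dots> \<le> 2 * (norm lam)\<^sup>2 * norm lam" using lam r by (intro mult_right_mono mult_left_mono power_mono) auto
      finally have "2 * norm lam ^ 3 * \<bar>real_of_int k\<bar> < 2 * norm lam ^ 3 * 1" by (simp add: power2_eq_square power3_eq_cube)
      then have "\<bar>real_of_int k\<bar> < 1" using lam by (subst (asm) mult_less_cancel_left_pos) auto
      then have "k = 0" by linarith
      then have "v \<bullet> lam = 0" using k by simp
      then have "(1 / t) *\<^sub>R v \<in> W" using v(1) v0 t(1) vc center_scale[OF H] by (auto simp: W_def)
      moreover have "dist ((1 / t) *\<^sub>R v) \<mu> < e"
      proof -
        have "(1 / t) *\<^sub>R v - u = (1 / t) *\<^sub>R (v - t *\<^sub>R u)" using t(1) by (simp add: scaleR_diff_right)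
        then have "norm ((1 / t) *\<^sub>R v - u) = norm (v - t *\<^sub>R u) / t" using t(1) by simp
        also have "\<dots> < e / 2" using vd(1) t(1) by (simp add: field_simps)
        finally show ?thesis using u(3) norm_triangle_ineq[of "(1 / t) *\<^sub>R v - u" "u - \<mu>"] by (simp add: dist_norm)
      qed
      ultimately show "\<exists>y\<in>W. dist y \<mu> < e" by blast
    qed
    ultimately show ?thesis using closure_minimal[OF _ closed] by blast
  next
    case False
    then have "\<exists>lam\<in>Z. norm lam < 1 / real (Suc n)" for n
      by (meson not_le of_nat_0_less_iff zero_less_Suc zero_less_divide_1_iff)
    then obtain l where l: "\<And>n. l n \<in> Z" "\<And>n. norm (l n) < 1 / real (Suc n)" by metis
    have l0: "l \<longlonglongrightarrow> 0"
      by (rule Lim_null_comparison[OF _ LIMSEQ_inverse_real_of_nat])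
        (use l(2) in \<open>auto simp: inverse_eq_divide less_imp_le intro!: always_eventually\<close>)
    \<comment> \<open>Compactness of the spheres gives a subsequence along which the direction of
      the charge and both frame vectors converge together.\<close>
    let ?S = "sphere 0 1 :: 'g set"
    let ?x = "\<lambda>n. (sgn (l n), \<nu> (l n), charged_geodesic.e1 br (l n) (\<nu> (l n)))"
    have "?x n \<in> ?S \<times> ?S \<times> ?S" for n
      using G[OF l(1)[of n]] charged_geodesic.norm_e1[OF G[OF l(1)[of n]]] by (auto simp: charged_geodesic_def norm_sgn)
    moreover have "seq_compact (?S \<times> ?S \<times> ?S)"
      by (intro compact_imp_seq_compact compact_Times compact_sphere)
    ultimately obtain x r where x: "x \<in> ?S \<times> ?S \<times> ?S" and r: "strict_mono r" "(?x \<circ> r) \<longlonglongrightarrow> x"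
      unfolding seq_compact_def by meson
    obtain \<omega> E2 E1 where x_eq: "x = (\<omega>, E2, E1)" by (cases x)
    have lims: "(\<lambda>n. sgn (l (r n))) \<longlonglongrightarrow> \<omega>" "(\<lambda>n. \<nu> (l (r n))) \<longlonglongrightarrow> E2"
        "(\<lambda>n. charged_geodesic.e1 br (l (r n)) (\<nu> (l (r n)))) \<longlonglongrightarrow> E1"
      using tendsto_fst[OF r(2)] tendsto_fst[OF tendsto_snd[OF r(2)]] tendsto_snd[OF tendsto_snd[OF r(2)]]
      by (simp_all add: x_eq o_def)
    have \<omega>: "\<omega> \<bullet> \<omega> = 1" using x by (simp add: x_eq dot_square_norm)
    have \<omega>_center: "\<omega> \<in> center br"
    proof (rule closed_sequentially[OF closed_subspace[OF subspace_center[OF H]] _ lims(1)])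
      show "sgn (l (r n)) \<in> center br" for n
        using charged_geodesic.\<omega>_center[OF G[OF l(1)], of 1] by simp
    qed
    \<comment> \<open>Stated for general h because it is applied to f and to its conjugate.\<close>
    have pos: "fourier h (\<eta> - \<mu>) = 0"
      if h: "integrable lborel h" and oh: "\<And>n. charged_geodesic.orth br (l n) (\<nu> (l n)) h"
        and \<eta>: "\<eta> \<in> hor br" and \<mu>: "\<mu> \<in> center br" "\<mu> \<bullet> \<omega> > 0" for h \<eta> \<mu>
    proof (rule fourier_eq_0_if_translates[OF H _ \<mu>(1) _ _ \<eta>])
      show hm: "h \<in> borel_measurable borel" using h by simp
      show "\<mu> \<noteq> 0" using \<mu>(2) by auto
      fix g0
      show "fourier (\<lambda>g. h (gmul br g0 g)) (- \<mu>) = 0"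
      proof (rule fourier_eq_0_if_charges_tend_to_0[OF H integrable_translate[OF H h] G[OF l(1)] _ _ lims \<mu>])
        show "charged_geodesic.orth br (l (r n)) (\<nu> (l (r n))) (\<lambda>g. h (gmul br g0 g))" for n
          by (rule charged_geodesic.orth_translate[OF G[OF l(1)] hm oh])
        show "(\<lambda>n. l (r n)) \<longlonglongrightarrow> 0" using LIMSEQ_subseq_LIMSEQ[OF l0 r(1)] by (simp add: o_def)
      qed
    qed
    have off: "fourier f (\<eta> - \<mu>) = 0" if "\<mu> \<in> center br" "\<mu> \<bullet> \<omega> \<noteq> 0" for \<mu>
    proof (cases "\<mu> \<bullet> \<omega> > 0")
      case True
      then show ?thesis using pos[OF f o[OF l(1)] \<eta> that(1)] by simp
    next
      case False
      have "fourier (\<lambda>g. cnj (f g)) (- \<eta> - (- \<mu>)) = 0"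
      proof (rule pos)
        show "integrable lborel (\<lambda>g. cnj (f g))" using f by simp
        show "charged_geodesic.orth br (l n) (\<nu> (l n)) (\<lambda>g. cnj (f g))" for n
          by (rule charged_geodesic.orth_cnj[OF G[OF l(1)] o[OF l(1)]])
        show "- \<eta> \<in> hor br" "- \<mu> \<in> center br"
          using \<eta> that by (auto intro: subspace_neg hor_subspace subspace_center H)
        show "- \<mu> \<bullet> \<omega> > 0" using False that by simp
      qed
      then show ?thesis by (simp add: fourier_cnj)
    qed
    show ?thesis
    proof (cases "\<mu> \<bullet> \<omega> = 0")
      case True
      \<comment> \<open>A frequency orthogonal to \<omega> is the limit of its shifts along
        \<omega>, which are not; continuity of the transform does the rest.\<close>
      have "(\<lambda>n. \<mu> + inverse (real (Suc n)) *\<^sub>R \<omega>) \<longlonglongrightarrow> \<mu> + 0 *\<^sub>R \<omega>"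
        by (intro tendsto_intros LIMSEQ_inverse_real_of_nat)
      then have "\<mu> + 0 *\<^sub>R \<omega> \<in> {\<mu>. fourier f (\<eta> - \<mu>) = 0}"
      proof (rule closed_sequentially[OF closed, rotated])
        show "\<mu> + inverse (real (Suc n)) *\<^sub>R \<omega> \<in> {\<mu>. fourier f (\<eta> - \<mu>) = 0}" for n
          using \<mu> \<omega>_center True \<omega>
          by (auto intro!: off subspace_add subspace_center center_scale H simp: inner_add_left simp del: of_nat_Suc)
      qed
      then show ?thesis by simp
    qed (use off \<mu> in blast)
  qed
  have "fourier f \<xi> = 0" for \<xi>
  proof -
    obtain P where P: "\<And>x. P x \<in> center br" "\<And>x y. y \<in> center br \<Longrightarrow> (x - P x) \<bullet> y = 0"
      using linear_orthogonal_projection[OF subspace_center[OF H]] by metis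
    have "\<xi> - P \<xi> \<in> hor br"
      using P(2) by (auto simp: hor_def orthogonal_comp_def orthogonal_def inner_commute)
    moreover have "- P \<xi> \<in> center br" using P(1) by (intro subspace_neg subspace_center H)
    ultimately show ?thesis using main[of "\<xi> - P \<xi>" "- P \<xi>"] by simp
  qed
  then show "AE x in lborel. f x = 0" by (rule fourier_unique[OF f])
qed

theorem theorem2p3:
  fixes br :: "'g::euclidean_space \<Rightarrow> 'g \<Rightarrow> 'g" and Z :: "'g set"
  assumes "H_type br"
    and "Z \<subseteq> center br - {0}"
  shows "injectivity_set br Z \<longleftrightarrow> center br \<subseteq> closure (\<Union>lam\<in>Z. visible br lam)"
  using injectivity_set_if_dense[OF assms] not_injectivity_set_if_not_dense[OF assms] by blast



end
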